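(* Let $K$ and $K'$ be finite Galois extensions of $\mathbf{Q}$ (inside a fixed algebraic closure $\overline{\mathbf{Q}}$). Then $\mathrm{Int}_{\mathbf{Q}}(\mathcal{O}_K)=\mathrm{Int}_{\mathbf{Q}}(\mathcal{O}_{K'})$ if and only if $K=K'$.
   Context: For a number field $K$, $\mathcal{O}_K$ denotes its ring of algebraic integers, and $\mathrm{Int}_{\mathbf{Q}}(\mathcal{O}_K):=\{f\in\mathbf{Q}[X] \mid f(\mathcal{O}_K)\subseteq\mathcal{O}_K\}$, a subring of $\mathbf{Q}[X]$. *)

theory Defs
  imports "HOL-Computational_Algebra.Computational_Algebra"
begin

text \<open>Number fields are carrier sets inside an ambient field of characteristic zero, the embedding
  of the rationals being \<^const>\<open>of_rat\<close>.\<close>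

definition is_subfield :: "'a::field set \<Rightarrow> bool" where
  "is_subfield K \<longleftrightarrow> 0 \<in> K \<and> 1 \<in> K \<and>
     (\<forall>x\<in>K. \<forall>y\<in>K. x + y \<in> K \<and> x - y \<in> K \<and> x * y \<in> K) \<and>
     (\<forall>x\<in>K. inverse x \<in> K)"

definition number_field :: "'a::field_char_0 set \<Rightarrow> bool" where
  "number_field K \<longleftrightarrow> is_subfield K \<and>
     (\<exists>B. finite B \<and> K = module.span (\<lambda>(q::rat) x. of_rat q * x) B)"

text \<open>The next two notions are meant for an algebraically closed ambient field, where all roots of
  a rational polynomial exist: the polynomial splits over \<open>K\<close> iff all its roots lie in \<open>K\<close>, and it
  is separable iff all its roots are simple, i.e. \<^const>\<open>rsquarefree\<close>.\<close>

definition normal_over_rat :: "'a::{field_char_0,alg_closed_field} set \<Rightarrow> bool" where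
  "normal_over_rat K \<longleftrightarrow>
     (\<forall>p::rat poly. irreducible p \<and> (\<exists>x\<in>K. poly (map_poly of_rat p) x = 0) \<longrightarrow>
        (\<forall>y. poly (map_poly of_rat p) y = 0 \<longrightarrow> y \<in> K))"

definition separable_over_rat :: "'a::{field_char_0,alg_closed_field} set \<Rightarrow> bool" where
  "separable_over_rat K \<longleftrightarrow>
     (\<forall>p::rat poly. irreducible p \<and> (\<exists>x\<in>K. poly (map_poly of_rat p) x = 0) \<longrightarrow>
        rsquarefree (map_poly of_rat p :: 'a poly))"

definition finite_galois_over_rat :: "'a::{field_char_0,alg_closed_field} set \<Rightarrow> bool" where
  "finite_galois_over_rat K \<longleftrightarrow> number_field K \<and> normal_over_rat K \<and> separable_over_rat K"

definition ring_of_integers :: "'a::field_char_0 set \<Rightarrow> 'a set" where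
  "ring_of_integers K = {x \<in> K. algebraic_int x}"

definition Int_rat :: "'a::field_char_0 set \<Rightarrow> rat poly set" where
  "Int_rat R = {f. \<forall>x\<in>R. poly (map_poly of_rat f) x \<in> R}"

end

theory Submission
  imports "Jordan_Normal_Form.Char_Poly" Defs "HOL-Library.FuncSet" "HOL-Computational_Algebra.Field_as_Ring"
begin

text \<open>Membership of \<open>(X\<^sup>p - X) / p\<close> in the ring of integer-valued polynomials says, for all but finitely
  many primes \<open>p\<close>, that \<open>p\<close> splits completely. If \<open>K'\<close> is not contained in \<open>K\<close>, then the
  compositum \<open>L = K K'\<close> has degree \<open>N > n = [K : \<rat>]\<close>, but \<open>L\<close> and \<open>K\<close> have the same split primes
  up to finitely many. This is impossible, because the sum of \<open>1 / p\<close> over the split primes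
  \<open>p \<le> Z\<close> is at least \<open>(1 / n) log log Z - O(1)\<close>, and it is at most
  \<open>(1 / N + \<epsilon>) log log Z + O(1)\<close>.

  Instead of zeta functions and archimedean embeddings, both bounds count lattice points, the
  size of an element being the sum of its absolute coordinates in a fixed basis. For the lower
  bound, a box of elements in which every element has boundedly many associates contains
  about \<open>8\<^sup>j\<^sup>n\<close> elements of norm about \<open>8\<^sup>j\<^sup>n\<close> for each \<open>j\<close>, and the sum of \<open>1 / |N a|\<close> over
  them is dominated by an Euler product. For the upper bound, each finite set of degree one
  primes contains by the pigeonhole principle a common element of norm comparable to the
  product of their norms, and such an element arises from boundedly many sets.\<close>

subsection \<open>Sums and products of algebraic integers\<close>

text \<open>The split primes of a Galois field of degree n have density 1/n, so one set of primes
  cannot serve both degrees n and N. The sum of 1/p sees this density because primes of higher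
  residue degree have norm at least p^2 and contribute only a bounded amount. Ideal factorization is
  bypassed by fixing one maximal ideal over each p. The other primes over p are seen by applying
  automorphisms to elements, and valuations are available for all p not dividing a discriminant-like
  integer \<open>dlt\<close>. The remaining primes must not divide the norms that are counted, which
  dictates the choice of elements congruent to 1 modulo \<open>dlt\<close>. Norms are controlled
  without embeddings because an element whose coordinates are relatively close to those of a large
  rational integer m has norm close to m^n. Boxes far out on the rational axis therefore have norms
  known up to a constant factor, and the quotients inside a box have bounded size. The double
  logarithm enters since Z grows exponentially with the number J of scales, so that log J and log
  log Z differ by a bounded amount.\<close>

text \<open>The determinant trick: the vector of the \<open>m i\<close> is nonzero, hence an
  eigenvector of an integer matrix with eigenvalue \<open>x\<close>, and the characteristic
  polynomial of that matrix is monic.\<close>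

lemma algebraic_int_finite_module:
  fixes m :: "'i \<Rightarrow> 'a::field_char_0"
  assumes "finite I" and nz: "\<exists>i\<in>I. m i \<noteq> 0"
    and act: "\<And>i. i \<in> I \<Longrightarrow> x * m i = (\<Sum>j\<in>I. of_int (a i j) * m j)"
  shows "algebraic_int x"
proof -
  define n where "n = card I"
  obtain h where h: "bij_betw h {0..<n} I"
    using ex_bij_betw_nat_finite[OF assms(1)] n_def by blast
  define A :: "int mat" where "A = mat n n (\<lambda>(i,j). a (h i) (h j))"
  define A' :: "'a mat" where "A' = map_mat of_int A"
  define v where "v = vec n (\<lambda>i. m (h i))"
  have A: "A \<in> carrier_mat n n" and A': "A' \<in> carrier_mat n n"
    by (auto simp: A_def A'_def)
  from nz obtain i where i: "i \<in> I" "m i \<noteq> 0" by blast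
  then obtain k where k: "k < n" "h k = i"
    using h by (metis atLeastLessThan_iff bij_betw_imp_surj_on imageE)
  have "vec_index v k \<noteq> vec_index (0\<^sub>v n) k" using k i by (simp add: v_def)
  then have v0: "v \<noteq> 0\<^sub>v n" by metis
  have "A' *\<^sub>v v = x \<cdot>\<^sub>v v"
  proof (rule eq_vecI)
    fix i assume "i < dim_vec (x \<cdot>\<^sub>v v)"
    then have i: "i < n" by (simp add: v_def)
    then have hi: "h i \<in> I" using h by (auto simp: bij_betw_def)
    have "vec_index (A' *\<^sub>v v) i = (\<Sum>j\<in>{0..<n}. of_int (a (h i) (h j)) * m (h j))"
      using i by (auto simp: A'_def A_def v_def scalar_prod_def intro!: sum.cong)
    also have "\<dots> = (\<Sum>j\<in>I. of_int (a (h i) j) * m j)"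
      by (rule sum.reindex_bij_betw[OF h])
    also have "\<dots> = x * m (h i)" using act[OF hi] by simp
    finally show "vec_index (A' *\<^sub>v v) i = vec_index (x \<cdot>\<^sub>v v) i" using i by (simp add: v_def)
  qed (auto simp: A'_def A_def v_def)
  then have "eigenvector A' v x"
    using v0 A' by (auto simp: eigenvector_def v_def)
  then have "poly (char_poly A') x = 0"
    using eigenvalue_root_char_poly[OF A'] by (auto simp: eigenvalue_def)
  moreover have "char_poly A' = map_poly of_int (char_poly A)"
    unfolding A'_def by (rule of_int_hom.char_poly_hom[OF A])
  ultimately show ?thesis
    using degree_monic_char_poly[OF A] algebraic_int_altdef_ipoly by (metis)
qed

lemma algebraic_int_power_relation:
  fixes x :: "'a::field_char_0"
  assumes "algebraic_int x"
  shows "\<exists>d>0. \<exists>c::nat \<Rightarrow> int. x ^ d = (\<Sum>k<d. of_int (c k) * x ^ k)"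
proof -
  from assms obtain p where p: "poly (map_poly of_int p) x = 0" "lead_coeff p = 1"
    by (auto simp: algebraic_int_altdef_ipoly)
  define d where "d = degree p"
  have eq: "0 = (\<Sum>k\<le>d. of_int (coeff p k) * x ^ k)"
    using p by (simp add: poly_altdef d_def degree_map_poly coeff_map_poly)
  have "d > 0"
  proof (rule ccontr)
    assume "\<not> d > 0"
    then have "0 = (of_int (coeff p d) :: 'a)" using eq by simp
    then show False using p by (simp add: d_def)
  qed
  moreover have "x ^ d = (\<Sum>k<d. of_int (- coeff p k) * x ^ k)"
    using eq p by (simp add: d_def[symmetric] lessThan_Suc_atMost[symmetric] sum_negf
        add_eq_0_iff)
  ultimately show ?thesis
    by (intro exI[of _ d] conjI exI[of _ "\<lambda>k. - coeff p k"])
qed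

text \<open>The products x^i y^j below the degrees of the two monic relations generate a module
  stable under \<open>x\<close> and \<open>y\<close>. The predicate \<open>S\<close> says that an
  element acts on these generators by an integer matrix, and it is closed under sums and
  products.\<close>

lemma algebraic_int_plus_times:
  fixes x y :: "'a::field_char_0"
  assumes "algebraic_int x" "algebraic_int y"
  shows "algebraic_int (x + y) \<and> algebraic_int (x * y)"
proof -
  obtain d c where d: "d > 0" and c: "x ^ d = (\<Sum>k<d. of_int (c k) * x ^ k)"
    using algebraic_int_power_relation[OF assms(1)] by blast
  obtain e b where e: "e > 0" and b: "y ^ e = (\<Sum>k<e. of_int (b k) * y ^ k)"
    using algebraic_int_power_relation[OF assms(2)] by blast
  define I where "I = {..<d} \<times> {..<e}"
  define m where "m = (\<lambda>(i,j). x ^ i * y ^ j)"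
  have fin: "finite I" by (simp add: I_def)
  have nz: "\<exists>i\<in>I. m i \<noteq> 0"
    using d e by (intro bexI[of _ "(0,0)"]) (auto simp: I_def m_def)
  define S where "S z \<longleftrightarrow> (\<exists>a. \<forall>i\<in>I. z * m i = (\<Sum>j\<in>I. of_int (a i j) * m j))" for z
  have S_int: "algebraic_int z" if "S z" for z
    using that algebraic_int_finite_module[OF fin nz] unfolding S_def by metis
  have Splus: "S (z + w)" if zw: "S z" "S w" for z w
  proof -
    from zw obtain A B where A: "\<forall>i\<in>I. z * m i = (\<Sum>j\<in>I. of_int (A i j) * m j)"
      and B: "\<forall>i\<in>I. w * m i = (\<Sum>j\<in>I. of_int (B i j) * m j)" unfolding S_def by blast
    show ?thesis unfolding S_def
      using A B by (intro exI[of _ "\<lambda>i j. A i j + B i j"]) (auto simp: ring_distribs sum.distrib)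
  qed
  have Stimes: "S (z * w)" if zw: "S z" "S w" for z w
  proof -
    from zw obtain A B where A: "\<forall>i\<in>I. z * m i = (\<Sum>j\<in>I. of_int (A i j) * m j)"
      and B: "\<forall>i\<in>I. w * m i = (\<Sum>j\<in>I. of_int (B i j) * m j)" unfolding S_def by blast
    have "z * w * m i = (\<Sum>l\<in>I. of_int (\<Sum>j\<in>I. B i j * A j l) * m l)" if i: "i \<in> I" for i
    proof -
      have "z * w * m i = (\<Sum>j\<in>I. of_int (B i j) * (z * m j))"
        using B i by (simp add: mult.assoc sum_distrib_left mult.left_commute[of z])
      also have "\<dots> = (\<Sum>j\<in>I. of_int (B i j) * (\<Sum>l\<in>I. of_int (A j l) * m l))"
        using A by (intro sum.cong) auto
      also have "\<dots> = (\<Sum>j\<in>I. \<Sum>l\<in>I. of_int (B i j * A j l) * m l)"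
        by (simp add: sum_distrib_left mult.assoc)
      also have "\<dots> = (\<Sum>l\<in>I. \<Sum>j\<in>I. of_int (B i j * A j l) * m l)" by (rule sum.swap)
      finally show ?thesis by (simp add: sum_distrib_right)
    qed
    then show ?thesis unfolding S_def by (intro exI[of _ "\<lambda>i l. \<Sum>j\<in>I. B i j * A j l"]) blast
  qed
  have "\<exists>a. x * m i = (\<Sum>j\<in>I. of_int (a j) * m j)" if "i \<in> I" for i
  proof -
    from that obtain k l where i: "i = (k,l)" "k < d" "l < e" by (auto simp: I_def)
    show ?thesis
    proof (cases "Suc k = d")
      case False
      then have mem: "(Suc k, l) \<in> I" using i by (auto simp: I_def)
      have "(\<Sum>j\<in>I. of_int (if j = (Suc k,l) then 1 else 0) * m j)
          = (\<Sum>j\<in>I. if j = (Suc k,l) then m j else 0)" by (intro sum.cong) auto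
      also have "\<dots> = x * m i" using fin mem by (simp add: sum.delta m_def i)
      finally show ?thesis by metis
    next
      \<comment> \<open>The exponent leaves the index range, and the monic relation for
        \<open>x\<close> brings it back.\<close>
      case True
      have "x * m i = x ^ d * y ^ l" using i by (simp add: m_def True[symmetric])
      also have "\<dots> = (\<Sum>k<d. of_int (c k) * m (k,l))"
        by (simp add: c sum_distrib_right m_def mult.assoc)
      also have "\<dots> = (\<Sum>k<d. \<Sum>l'<e. of_int (if l' = l then c k else 0) * m (k,l'))"
        using i by (intro sum.cong refl) (auto simp: if_distrib if_distribR sum.delta cong: if_cong)
      also have "\<dots> = (\<Sum>(k,l')\<in>I. of_int (if l' = l then c k else 0) * m (k,l'))"
        unfolding I_def by (rule sum.cartesian_product)
      finally show ?thesis
        by (intro exI[of _ "\<lambda>(k,l'). if l' = l then c k else 0"])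
          (auto intro!: sum.cong)
    qed
  qed
  then have Sx: "S x" unfolding S_def by metis
  have "\<exists>a. y * m i = (\<Sum>j\<in>I. of_int (a j) * m j)" if "i \<in> I" for i
  proof -
    from that obtain k l where i: "i = (k,l)" "k < d" "l < e" by (auto simp: I_def)
    show ?thesis
    proof (cases "Suc l = e")
      case False
      then have mem: "(k, Suc l) \<in> I" using i by (auto simp: I_def)
      have "(\<Sum>j\<in>I. of_int (if j = (k,Suc l) then 1 else 0) * m j)
          = (\<Sum>j\<in>I. if j = (k,Suc l) then m j else 0)" by (intro sum.cong) auto
      also have "\<dots> = y * m i" using fin mem by (simp add: sum.delta m_def i)
      finally show ?thesis by metis
    next
      case True
      have "y * m i = x ^ k * y ^ e" using i by (simp add: m_def True[symmetric])
      also have "\<dots> = (\<Sum>l<e. of_int (b l) * m (k,l))"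
        by (simp add: b sum_distrib_left m_def algebra_simps)
      also have "\<dots> = (\<Sum>k'<d. if k' = k then (\<Sum>l<e. of_int (b l) * m (k,l)) else 0)"
        using i by simp
      also have "\<dots> = (\<Sum>k'<d. \<Sum>l<e. of_int (if k' = k then b l else 0) * m (k',l))"
        by (intro sum.cong) auto
      also have "\<dots> = (\<Sum>(k',l)\<in>I. of_int (if k' = k then b l else 0) * m (k',l))"
        unfolding I_def by (rule sum.cartesian_product)
      finally show ?thesis
        by (intro exI[of _ "\<lambda>(k',l). if k' = k then b l else 0"])
          (auto intro!: sum.cong)
    qed
  qed
  then have Sy: "S y" unfolding S_def by metis
  show ?thesis using Splus[OF Sx Sy] Stimes[OF Sx Sy] S_int by blast
qed

lemma algebraic_int_plus: "algebraic_int x \<Longrightarrow> algebraic_int y \<Longrightarrow> algebraic_int (x + y)"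
  and algebraic_int_times: "algebraic_int x \<Longrightarrow> algebraic_int y \<Longrightarrow> algebraic_int (x * y)"
  for x y :: "'a::field_char_0"
  using algebraic_int_plus_times by blast+

lemma algebraic_int_of_int [simp]: "algebraic_int (of_int k :: 'a::field_char_0)"
  by (rule int_imp_algebraic_int) auto

lemma algebraic_int_diff:
  "algebraic_int x \<Longrightarrow> algebraic_int y \<Longrightarrow> algebraic_int (x - y)" for x y :: "'a::field_char_0"
  using algebraic_int_plus[of x "- y"] by auto

lemma algebraic_int_of_ratD:
  assumes "algebraic_int (of_rat q :: 'a::field_char_0)"
  shows "\<exists>k. of_rat q = (of_int k :: 'a)"
  using rational_algebraic_int_is_int[OF assms] by (auto simp: Ints_def)

text \<open>Multiplying an equation of degree d with leading coefficient c by c^(d-1) makes it monic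
  in y = c x.\<close>

lemma algebraic_times_int:
  fixes x :: "'a::field_char_0"
  assumes "algebraic x"
  shows "\<exists>m::int. m > 0 \<and> algebraic_int (of_int m * x)"
proof -
  from assms obtain p where p0: "p \<noteq> 0" and p: "poly (map_poly of_int p) x = 0"
    by (erule algebraicE')
  define c where "c = lead_coeff p"
  define d where "d = degree p"
  have c0: "c \<noteq> 0" using p0 by (simp add: c_def)
  have eq: "0 = (\<Sum>k\<le>d. of_int (coeff p k) * x ^ k)"
    using p by (simp add: poly_altdef d_def degree_map_poly coeff_map_poly)
  have d0: "d > 0"
  proof (rule ccontr)
    assume "\<not> d > 0"
    then have "0 = (of_int (coeff p d) :: 'a)" using eq by simp
    then show False using c0 by (simp add: d_def c_def)
  qed
  define y where "y = of_int c * x"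
  have top: "y ^ d = (\<Sum>k<d. of_int (- coeff p k * c ^ (d - 1 - k)) * y ^ k)"
  proof -
    have "0 = of_int c ^ (d - 1) * (\<Sum>k\<le>d. of_int (coeff p k) * x ^ k)" using eq by simp
    also have "\<dots> = of_int c ^ (d - 1) * (of_int c * x ^ d)
        + of_int c ^ (d - 1) * (\<Sum>k<d. of_int (coeff p k) * x ^ k)"
      by (simp add: lessThan_Suc_atMost[symmetric] c_def d_def ring_distribs add.commute)
    also have "of_int c ^ (d - 1) * (of_int c * x ^ d) = y ^ d"
      using d0 by (cases d) (simp_all add: y_def power_mult_distrib)
    also have "of_int c ^ (d - 1) * (\<Sum>k<d. of_int (coeff p k) * x ^ k)
        = (\<Sum>k<d. of_int (coeff p k * c ^ (d - 1 - k)) * y ^ k)"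
      unfolding sum_distrib_left
    proof (intro sum.cong refl)
      fix k assume "k \<in> {..<d}"
      then have "(of_int c :: 'a) ^ (d - 1) = of_int c ^ (d - 1 - k) * of_int c ^ k"
        by (subst power_add[symmetric]) simp
      then show "of_int c ^ (d - 1) * (of_int (coeff p k) * x ^ k)
          = of_int (coeff p k * c ^ (d - 1 - k)) * y ^ k"
        by (simp add: y_def power_mult_distrib)
    qed
    finally have *: "0 = y ^ d + (\<Sum>k<d. of_int (coeff p k * c ^ (d - 1 - k)) * y ^ k)" .
    show ?thesis using *
      by (simp add: sum_negf eq_neg_iff_add_eq_0)
  qed
  have "\<exists>a. y * y ^ i = (\<Sum>j<d. of_int (a j) * y ^ j)" if "i < d" for i
  proof (cases "Suc i = d")
    case True
    then show ?thesis using top by (metis power_Suc)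
  next
    case False
    then have "Suc i < d" using that by simp
    then have "(\<Sum>j<d. of_int (if j = Suc i then 1 else 0) * y ^ j) = y ^ Suc i"
      by (simp add: if_distrib if_distribR sum.delta cong: if_cong)
    then show ?thesis by (metis power_Suc)
  qed
  then obtain a where a: "\<And>i. i < d \<Longrightarrow> y * y ^ i = (\<Sum>j<d. of_int (a i j) * y ^ j)" by metis
  have "algebraic_int y"
    by (rule algebraic_int_finite_module[of "{..<d}" "\<lambda>i. y ^ i" y a])
      (use a d0 in \<open>auto intro: bexI[of _ 0]\<close>)
  then have 1: "algebraic_int (of_int c * x)" by (simp add: y_def)
  \<comment> \<open>The leading coefficient may be negative, while the multiplier has to be
    positive.\<close>
  have 2: "algebraic_int (of_int (- c) * x)" using algebraic_int_minus[OF 1] by simp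
  show ?thesis
  proof (cases "c > 0")
    case True then show ?thesis using 1 by blast
  next
    case False then have "- c > 0" using c0 by simp
    then show ?thesis using 2 by blast
  qed
qed

subsection \<open>Rational polynomials and simple extensions\<close>

definition evq :: "rat poly \<Rightarrow> 'a::field_char_0 \<Rightarrow> 'a" where
  "evq p x = poly (map_poly of_rat p) x"

lemma evq_0 [simp]: "evq 0 x = 0"
  by (simp add: evq_def)

lemma evq_pCons [simp]: "evq (pCons c p) x = of_rat c + x * evq p x"
  by (simp add: evq_def Polynomial.map_poly_pCons)

lemma evq_1 [simp]: "evq 1 x = 1"
  by (simp add: one_pCons)

lemma evq_add [simp]: "evq (p + q) x = evq p x + evq q x"
proof (induction p arbitrary: q)
  case (pCons a p)
  then show ?case by (cases q) (auto simp: of_rat_add algebra_simps)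
qed auto

lemma evq_smult [simp]: "evq (Polynomial.smult c p) x = of_rat c * evq p x"
  by (induction p) (auto simp: of_rat_mult algebra_simps)

lemma evq_mult [simp]: "evq (p * q) x = evq p x * evq q x"
  by (induction p) (auto simp: algebra_simps)

lemma evq_uminus [simp]: "evq (- p) x = - evq p x"
  using evq_smult[of "-1" p x] by (simp add: of_rat_minus)

lemma evq_diff [simp]: "evq (p - q) x = evq p x - evq q x"
  using evq_add[of p "- q" x] by simp

lemma evq_power [simp]: "evq (p ^ k) x = evq p x ^ k"
  by (induction k) auto

lemma evq_monom [simp]: "evq (monom c k) x = of_rat c * x ^ k"
  by (simp add: evq_def map_poly_monom poly_monom)

lemma evq_sum [simp]: "evq (sum f A) x = (\<Sum>i\<in>A. evq (f i) x)"
  by (induction A rule: infinite_finite_induct) auto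

lemma degree_map_poly_of_rat [simp]:
  "degree (map_poly (of_rat :: rat \<Rightarrow> 'a::field_char_0) p) = degree p"
  by (rule degree_map_poly) auto

lemma pderiv_map_poly_of_rat:
  "pderiv (map_poly (of_rat :: rat \<Rightarrow> 'a::field_char_0) p) = map_poly of_rat (pderiv p)"
  by (auto simp: poly_eq_iff coeff_pderiv coeff_map_poly of_rat_mult of_rat_add)

text \<open>This yields the minimal polynomial up to a unit: in a factorization into nonunits one
  factor still vanishes at \<open>x\<close> and has smaller degree.\<close>

lemma exists_irreducible_annihilator:
  fixes x :: "'a::field_char_0"
  assumes "algebraic x"
  shows "\<exists>f. irreducible f \<and> evq f x = 0"
proof -
  from assms obtain p where p: "p \<noteq> 0" "poly (map_poly of_int p) x = 0" by (erule algebraicE')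
  define q :: "rat poly" where "q = map_poly of_int p"
  have "map_poly (of_rat :: rat \<Rightarrow> 'a) q = map_poly of_int p"
    by (simp add: q_def map_poly_map_poly o_def)
  then have q0: "evq q x = 0" using p by (simp add: evq_def)
  have qn0: "q \<noteq> 0" using p by (auto simp: q_def map_poly_eq_0_iff)
  have "\<not> is_unit q"
  proof
    assume "is_unit q"
    then have "evq q x dvd 1" by (metis evq_1 evq_mult dvd_def)
    then show False using q0 by simp
  qed
  then have "\<exists>f. irreducible f \<and> evq f x = 0" using q0 qn0
  proof (induction "degree q" arbitrary: q rule: less_induct)
    case less
    show ?case
    proof (cases "irreducible q")
      case True then show ?thesis using less by blast
    next
      case False
      then obtain a b where ab: "q = a * b" "\<not> is_unit a" "\<not> is_unit b"
        using less by (auto simp: irreducible_def)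
      have nz: "a \<noteq> 0" "b \<noteq> 0" using ab less by auto
      have da: "degree a > 0" "degree b > 0"
        using ab nz is_unit_iff_degree by (metis gr0I)+
      have dl: "degree a < degree q" "degree b < degree q"
        using da nz by (auto simp: ab degree_mult_eq)
      have "evq a x = 0 \<or> evq b x = 0" using less ab by simp
      then show ?thesis using less.hyps dl ab nz by blast
    qed
  qed
  then show ?thesis .
qed

lemma irreducible_bezout:
  fixes f q :: "rat poly"
  assumes "irreducible f" "\<not> f dvd q"
  shows "\<exists>a b. a * f + b * q = 1"
proof -
  have "coprime f q" using assms by (meson coprimeI dvd_trans irreducibleD')
  then have "fst (bezout_coefficients f q) * f + snd (bezout_coefficients f q) * q = 1"
    by (simp add: bezout_coefficients_fst_snd)
  then show ?thesis by blast
qed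

text \<open>If \<open>f\<close> did not divide \<open>q\<close>, a Bezout identity evaluated at
  \<open>x\<close> would read 0 = 1. As divisibility does not mention \<open>x\<close>, polynomial
  identities carry over from one root of \<open>f\<close> to all others.\<close>

lemma irreducible_annihilator_dvd:
  fixes x :: "'a::field_char_0"
  assumes f: "irreducible f" "evq f x = 0"
  shows "evq q x = 0 \<longleftrightarrow> f dvd q"
proof
  assume "f dvd q" then show "evq q x = 0" using f by auto
next
  assume q: "evq q x = 0"
  show "f dvd q"
  proof (rule ccontr)
    assume "\<not> f dvd q"
    then obtain a b where "a * f + b * q = 1" using irreducible_bezout[OF f(1)] by blast
    then have "evq (a * f + b * q) x = 1" by simp
    then show False using f q by simp
  qed
qed

text \<open>A double root would make \<open>f\<close> divide its derivative, which is nonzero in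
  characteristic zero and of smaller degree.\<close>

lemma irreducible_rsquarefree:
  assumes f: "irreducible f"
  shows "rsquarefree (map_poly (of_rat :: rat \<Rightarrow> 'a::field_char_0) f)"
  unfolding rsquarefree_roots
proof (intro allI notI)
  fix x :: 'a
  assume "poly (map_poly of_rat f) x = 0 \<and> poly (pderiv (map_poly of_rat f)) x = 0"
  then have e: "evq f x = 0" "evq (pderiv f) x = 0"
    by (auto simp: evq_def pderiv_map_poly_of_rat)
  have "degree f \<noteq> 0" using f
    by (metis gr0I irreducible_def is_unit_iff_degree)
  then have "pderiv f \<noteq> 0" by (simp add: pderiv_eq_0_iff)
  moreover have "f dvd pderiv f" using irreducible_annihilator_dvd[OF f e(1)] e(2) by blast
  ultimately have "degree f \<le> degree (pderiv f)" by (simp add: dvd_imp_degree_le)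
  then show False using \<open>degree f \<noteq> 0\<close> by (simp add: degree_pderiv)
qed

lemma rsquarefree_card_roots:
  fixes p :: "'a::{field_char_0,alg_closed_field} poly"
  assumes "rsquarefree p"
  shows "card {x. poly p x = 0} = degree p"
proof -
  have p0: "p \<noteq> 0" using assms by (simp add: rsquarefree_def)
  obtain A where A: "size A = degree p" "p = Polynomial.smult (lead_coeff p) (\<Prod>x\<in>#A. [:-x, 1:])"
    using alg_closed_imp_factorization[OF p0] by blast
  have "proots p = proots (\<Prod>x\<in>#A. [:-x, 1:])"
    by (subst A(2)) (simp add: p0)
  also have "\<dots> = A"
  proof (induction A)
    case (add x A)
    have nz: "(\<Prod>x\<in>#A. [:-x, 1:]) \<noteq> 0" by (auto simp: prod_mset_zero_iff)
    have "proots (\<Prod>x\<in>#add_mset x A. [:-x, 1:]) = proots [:-x,1:] + proots (\<Prod>x\<in>#A. [:-x, 1:])"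
      using proots_mult[OF _ nz, of "[:-x,1:]"] by simp
    then show ?case using add proots_linear_factor[of "-x"] by simp
  qed simp
  finally have sz: "size (proots p) = degree p" using A by simp
  have "count (proots p) x = (if x \<in> {x. poly p x = 0} then 1 else 0)" for x
    using assms p0 by (simp add: rsquarefree_def order_root) (metis neq0_conv)
  then have "proots p = mset_set {x. poly p x = 0}"
    using p0 by (intro multiset_eqI) (auto simp: poly_roots_finite)
  then show ?thesis using sz by simp
qed

section \<open>Simple extensions of the rationals and primitive elements\<close>

text \<open>For algebraic \<open>x\<close> the polynomial values already form a field, the inverses
  coming from Bezout identities with the minimal polynomial.\<close>

definition Qadj :: "'a::field_char_0 \<Rightarrow> 'a set" where
  "Qadj x = range (\<lambda>p. evq p x)"

lemma Qadj_evq [simp]: "evq p x \<in> Qadj x"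
  by (simp add: Qadj_def)

lemma Qadj_self [simp]: "x \<in> Qadj x"
  using Qadj_evq[of "[:0,1:]" x] by simp

lemma Qadj_of_rat [simp]: "of_rat q \<in> Qadj x"
  using Qadj_evq[of "[:q:]" x] by simp

lemma is_subfield_Qadj:
  fixes x :: "'a::field_char_0"
  assumes "algebraic x"
  shows "is_subfield (Qadj x)"
  unfolding is_subfield_def
proof (intro conjI ballI)
  obtain f where f: "irreducible f" "evq f x = 0"
    using exists_irreducible_annihilator[OF assms] by blast
  show "0 \<in> Qadj x" "1 \<in> Qadj x" using Qadj_evq[of 0 x] Qadj_evq[of 1 x] by auto
  fix u assume "u \<in> Qadj x"
  then obtain p where p: "u = evq p x" by (auto simp: Qadj_def)
  show "inverse u \<in> Qadj x"
  proof (cases "u = 0")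
    case True then show ?thesis using Qadj_evq[of 0 x] by simp
  next
    case False
    then have "\<not> f dvd p" using irreducible_annihilator_dvd[OF f] p by blast
    then obtain a b where "a * f + b * p = 1" using irreducible_bezout[OF f(1)] by blast
    then have "evq (a * f + b * p) x = 1" by simp
    then have "evq b x * u = 1" using f p by simp
    then have "inverse u = evq b x" by (metis inverse_unique mult.commute)
    then show ?thesis by simp
  qed
  fix v assume "v \<in> Qadj x"
  then obtain q where q: "v = evq q x" by (auto simp: Qadj_def)
  show "u + v \<in> Qadj x" using Qadj_evq[of "p + q" x] p q by simp
  show "u - v \<in> Qadj x" using Qadj_evq[of "p - q" x] p q by simp
  show "u * v \<in> Qadj x" using Qadj_evq[of "p * q" x] p q by simp
qed

lemma subfield_of_rat:
  assumes "is_subfield K"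
  shows "of_rat q \<in> (K :: 'a::field_char_0 set)"
proof -
  have n: "of_nat k \<in> K" for k using assms by (induction k) (auto simp: is_subfield_def)
  have i: "of_int k \<in> K" for k
  proof (cases k)
    case (nonneg m) then show ?thesis using n by simp
  next
    case (neg m)
    have "0 - of_nat (Suc m) \<in> K" using n assms unfolding is_subfield_def by blast
    then show ?thesis using neg by simp
  qed
  obtain a b where q: "q = of_int a / of_int b" by (meson quotient_of_div surj_pair)
  then have "(of_rat q :: 'a) = of_int a * inverse (of_int b)"
    by (simp add: of_rat_divide field_simps)
  then show ?thesis using i assms by (auto simp: is_subfield_def)
qed

lemma subfield_evq:
  assumes "is_subfield K" "x \<in> K"
  shows "evq p x \<in> (K :: 'a::field_char_0 set)"
  using assms by (induction p) (auto simp: is_subfield_def subfield_of_rat)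

lemma Qadj_subset: "is_subfield K \<Longrightarrow> x \<in> K \<Longrightarrow> Qadj x \<subseteq> K"
  by (auto simp: Qadj_def subfield_evq)

lemma evq_pcompose [simp]: "evq (pcompose p q) x = evq p (evq q x)"
  by (induction p) (auto simp: pcompose_pCons)

lemma subfield_sum:
  assumes "is_subfield F" "\<And>i. i \<in> A \<Longrightarrow> f i \<in> F"
  shows "sum f A \<in> F"
  using assms(2) by (induction A rule: infinite_finite_induct) (use assms(1) in \<open>auto simp: is_subfield_def\<close>)

lemma subfield_prod:
  assumes "is_subfield F" "\<And>i. i \<in> A \<Longrightarrow> f i \<in> F"
  shows "prod f A \<in> F"
  using assms(2) by (induction A rule: infinite_finite_induct) (use assms(1) in \<open>auto simp: is_subfield_def\<close>)

text \<open>The coefficient field is a carrier set inside the ambient type, so it must be checked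
  that division keeps the coefficients in \<open>F\<close>. With a monic divisor each step only
  subtracts a multiple of \<open>h\<close>.\<close>

lemma subfield_poly_remainder:
  fixes h q :: "'a::field poly"
  assumes F: "is_subfield F" and h: "lead_coeff h = 1" "\<forall>i. coeff h i \<in> F"
    and q: "\<forall>i. coeff q i \<in> F"
  shows "\<exists>r. (\<forall>i. coeff r i \<in> F) \<and> (r = 0 \<or> degree r < degree h) \<and> h dvd q - r"
  using q
proof (induction "degree q" arbitrary: q rule: less_induct)
  case less
  have F0: "0 \<in> F" using F by (simp add: is_subfield_def)
  consider "degree h = 0" | "degree q < degree h" | "degree h > 0" "degree h \<le> degree q" by linarith
  then show ?case
  proof cases
    case 1
    then have "h dvd q" using h by (auto elim!: degree_eq_zeroE simp: one_pCons[symmetric])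
    then show ?thesis using F0 by (intro exI[of _ 0]) auto
  next
    case 2
    then show ?thesis using less by (intro exI[of _ q]) auto
  next
    case 3
    define k where "k = degree q - degree h"
    define s where "s = monom (lead_coeff q) k * h"
    define q' where "q' = q - s"
    have cs: "coeff s i = (if k \<le> i then lead_coeff q * coeff h (i - k) else 0)" for i
      by (simp add: s_def coeff_monom_mult)
    have "coeff q' i \<in> F" for i
      using less.prems F h F0 by (auto simp: q'_def cs is_subfield_def)
    moreover have "degree q' \<le> degree q"
    proof (unfold q'_def, rule degree_diff_le)
      show "degree s \<le> degree q"
        using 3 degree_mult_le[of "monom (lead_coeff q) k" h] degree_monom_le[of "lead_coeff q" k]
        by (auto simp: s_def k_def)
    qed simp
    moreover have "coeff q' (degree q) = 0" using 3 h by (simp add: q'_def cs k_def)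
    ultimately have "q' = 0 \<or> degree q' < degree q" and cF: "\<forall>i. coeff q' i \<in> F"
      using eq_zero_or_degree_less by blast+
    then show ?thesis
    proof (elim disjE)
      assume "q' = 0"
      then have "h dvd q" unfolding q'_def s_def by (metis dvd_triv_right eq_iff_diff_eq_0)
      then show ?thesis using F0 by (intro exI[of _ 0]) auto
    next
      assume "degree q' < degree q"
      from less.hyps[OF this cF] obtain r where r: "\<forall>i. coeff r i \<in> F"
        "r = 0 \<or> degree r < degree h" "h dvd q' - r" by blast
      have "q - r = (q' - r) + s" by (simp add: q'_def)
      also have "h dvd \<dots>" using r(3) by (auto simp: s_def)
      finally show ?thesis using r by blast
    qed
  qed
qed

text \<open>For t = x + c y, both g(X) and f(t - c X) have coefficients in Q(t) and vanish at
  \<open>y\<close>. Outside finitely many \<open>c\<close> they share no other root, so the minimal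
  polynomial of \<open>y\<close> over Q(t) is linear.\<close>

lemma primitive_element_two:
  fixes x y :: "'a::{field_char_0,alg_closed_field}"
  assumes alg: "\<And>z::'a. algebraic z"
  shows "\<exists>c::int. x \<in> Qadj (x + of_int c * y) \<and> y \<in> Qadj (x + of_int c * y)"
proof -
  obtain f where f: "irreducible f" "evq f x = 0" using exists_irreducible_annihilator[OF alg] by blast
  obtain g where g: "irreducible g" "evq g y = 0" using exists_irreducible_annihilator[OF alg] by blast
  have f0: "f \<noteq> 0" and g0: "g \<noteq> 0" using f g by auto
  have finf: "finite {a::'a. evq f a = 0}" and fing: "finite {b::'a. evq g b = 0}"
    using f0 g0 unfolding evq_def by (auto intro!: poly_roots_finite simp: map_poly_eq_0_iff)
  \<comment> \<open>A collision a + c b = x + c y of roots with b different from y forces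
    \<open>c\<close> into \<open>S\<close>. Pairs with b = y contribute only the value 0 of a
    division by zero, and excluding c = 0 is harmless.\<close>
  define S where "S = (\<lambda>(a,b). (a - x) / (y - b)) ` ({a. evq f a = 0} \<times> {b. evq g b = 0})"
  have "finite S" using finf fing by (simp add: S_def)
  moreover have "infinite (range (of_int :: int \<Rightarrow> 'a))"
    using infinite_UNIV_int finite_imageD[of "of_int :: int \<Rightarrow> 'a" UNIV] by (auto simp: inj_on_def)
  ultimately obtain c :: int where c: "of_int c \<notin> S"
    by (metis finite_subset image_subset_iff rangeI subsetI UNIV_I)
  define t where "t = x + of_int c * y"
  define F where "F = Qadj t"
  have sub: "is_subfield F" unfolding F_def using is_subfield_Qadj alg by blast
  have avoid: "evq f (t - of_int c * b) \<noteq> 0" if "evq g b = 0" "b \<noteq> y" for b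
  proof
    assume "evq f (t - of_int c * b) = 0"
    then have "((t - of_int c * b) - x) / (y - b) \<in> S"
      unfolding S_def using that by (intro image_eqI[of _ _ "(t - of_int c * b, b)"]) auto
    moreover have "((t - of_int c * b) - x) / (y - b) = of_int c"
      using that by (simp add: t_def field_simps)
    ultimately show False using c by simp
  qed
  define PF where "PF = {p :: 'a poly. \<forall>i. coeff p i \<in> F}"
  have PF_add: "p + q \<in> PF" if "p \<in> PF" "q \<in> PF" for p q
    using that sub by (auto simp: PF_def is_subfield_def)
  have PF_mult: "p * q \<in> PF" if "p \<in> PF" "q \<in> PF" for p q
    using that sub by (auto simp: PF_def coeff_mult intro!: subfield_sum) (auto simp: is_subfield_def)
  have PF_const: "[:a:] \<in> PF" if "a \<in> F" for a
    using that sub by (auto simp: PF_def coeff_pCons is_subfield_def split: nat.splits)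
  define Fx where "Fx = pcompose (map_poly of_rat f) [:t, - of_int c:]"
  define Gx where "Gx = map_poly (of_rat :: rat \<Rightarrow> 'a) g"
  have lin: "[:t, - of_int c:] \<in> PF"
  proof -
    have "t \<in> F" "- of_int c \<in> F"
      using Qadj_of_rat[of "of_int (- c)" t] unfolding F_def
      by (simp, metis of_int_minus of_rat_of_int_eq)
    then show ?thesis using sub by (auto simp: PF_def coeff_pCons is_subfield_def split: nat.splits)
  qed
  have Fx: "Fx \<in> PF" unfolding Fx_def
  proof (induction f)
    case 0 then show ?case using PF_const[of 0] sub by (simp add: is_subfield_def)
  next
    case (pCons a p)
    have "[:of_rat a:] + [:t, - of_int c:] * pcompose (map_poly of_rat p) [:t, - of_int c:] \<in> PF"
      using pCons lin by (intro PF_add PF_mult PF_const) (auto simp: F_def)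
    then show ?case by (simp add: Polynomial.map_poly_pCons pcompose_pCons)
  qed
  have Gx: "Gx \<in> PF" by (auto simp: PF_def Gx_def coeff_map_poly F_def)
  define good where "good h \<longleftrightarrow> h \<in> PF \<and> lead_coeff h = 1 \<and> poly h y = 0" for h
  have norm: "good (Polynomial.smult (inverse (lead_coeff p)) p)" if "p \<in> PF" "p \<noteq> 0" "poly p y = 0" for p
    using that sub by (auto simp: good_def PF_def is_subfield_def)
  have "Gx \<noteq> 0" using g0 by (simp add: Gx_def map_poly_eq_0_iff)
  moreover have "poly Gx y = 0" using g by (simp add: Gx_def evq_def)
  ultimately have "good (Polynomial.smult (inverse (lead_coeff Gx)) Gx)" using norm Gx by blast
  \<comment> \<open>A good polynomial of least degree is the minimal polynomial of \<open>y\<close>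
    over \<open>F\<close>.\<close>
  then obtain h where h: "good h" and hmin: "\<And>h'. good h' \<Longrightarrow> degree h \<le> degree h'"
    using ex_has_least_nat[of good _ degree] by blast
  have dvd: "h dvd q" if q: "q \<in> PF" "poly q y = 0" for q
  proof -
    obtain r where r: "\<forall>i. coeff r i \<in> F" "r = 0 \<or> degree r < degree h" "h dvd q - r"
      using subfield_poly_remainder[OF sub, of h q] h q by (auto simp: good_def PF_def)
    have "poly (q - r) y = 0" using r(3) h unfolding good_def
      by (metis dvdE mult_zero_left poly_mult)
    then have ry: "poly r y = 0" using q by simp
    have "r = 0"
    proof (rule ccontr)
      assume "r \<noteq> 0"
      then have "degree h \<le> degree (Polynomial.smult (inverse (lead_coeff r)) r)"
        using norm[of r] ry r(1) by (intro hmin) (auto simp: PF_def)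
      then show False using r(2) \<open>r \<noteq> 0\<close> by simp
    qed
    then show ?thesis using r by simp
  qed
  have hF: "h dvd Fx" using Fx f by (intro dvd) (auto simp: Fx_def poly_pcompose t_def evq_def)
  have hG: "h dvd Gx" using Gx g by (intro dvd) (auto simp: Gx_def evq_def)
  have only: "b = y" if "poly h b = 0" for b
  proof (rule ccontr)
    assume "b \<noteq> y"
    have "poly Gx b = 0" "poly Fx b = 0" using hF hG that by (metis dvdE mult_zero_left poly_mult)+
    then have "evq g b = 0" "evq f (t - of_int c * b) = 0"
      by (auto simp: Gx_def Fx_def evq_def poly_pcompose algebra_simps)
    then show False using avoid \<open>b \<noteq> y\<close> by blast
  qed
  have "rsquarefree Gx" unfolding Gx_def using irreducible_rsquarefree g by blast
  moreover obtain k where "Gx = h * k" using hG by (elim dvdE)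
  ultimately have "rsquarefree h" unfolding rsquarefree_roots by (auto simp: pderiv_mult)
  then have "card {b. poly h b = 0} = degree h" by (rule rsquarefree_card_roots)
  moreover have "{b. poly h b = 0} = {y}" using only h by (auto simp: good_def)
  \<comment> \<open>\<open>h\<close> is monic with \<open>y\<close> as its only root and no multiple
    root, so it is X - y, and its constant coefficient puts \<open>y\<close> into
    \<open>F\<close>.\<close>
  ultimately have "degree h = 1" by simp
  then have "poly h y = coeff h 0 + y" using h by (simp add: poly_altdef good_def)
  then have "y = 0 - coeff h 0" using h by (simp add: good_def eq_neg_iff_add_eq_0 add.commute)
  then have y: "y \<in> F" using h sub by (auto simp: good_def PF_def is_subfield_def)
  have cF: "of_int c \<in> F" using Qadj_of_rat[of "of_int c" t] by (simp add: F_def)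
  have "x = t - of_int c * y" by (simp add: t_def)
  also have "\<dots> \<in> F" using y cF sub by (auto simp: is_subfield_def F_def)
  finally show ?thesis using y by (auto simp: F_def t_def)
qed

interpretation rv: vector_space "\<lambda>(q::rat) (x::'a::field_char_0). of_rat q * x"
  by standard (auto simp: of_rat_add of_rat_mult ring_distribs)

lemma Qadj_subspace:
  assumes "algebraic (x :: 'a::field_char_0)"
  shows "rv.subspace (Qadj x)"
  using is_subfield_Qadj[OF assms] unfolding rv.subspace_def is_subfield_def by auto

text \<open>A finite spanning set is absorbed into one generator element by element. Scaling by a
  positive integer makes the generator integral and leaves the field unchanged.\<close>

lemma number_field_primitive:
  fixes K :: "'a::{field_char_0,alg_closed_field} set"
  assumes alg: "\<And>z::'a. algebraic z" and K: "number_field K"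
  shows "\<exists>x. algebraic_int x \<and> K = Qadj x"
proof -
  obtain B where B: "finite B" "K = rv.span B" and sub: "is_subfield K"
    using K by (auto simp: number_field_def)
  have BK: "B \<subseteq> K" using B rv.span_superset by blast
  have "\<exists>x\<in>K. B \<subseteq> Qadj x" using B(1) BK
  proof (induction B rule: finite_induct)
    case empty then show ?case using sub by (auto simp: is_subfield_def)
  next
    case (insert b B)
    then obtain x where x: "x \<in> K" "B \<subseteq> Qadj x" by auto
    obtain c :: int where c: "x \<in> Qadj (x + of_int c * b)" "b \<in> Qadj (x + of_int c * b)"
      using primitive_element_two[OF alg] by blast
    have "of_int c \<in> K" using subfield_of_rat[OF sub, of "of_int c"] by simp
    then have "x + of_int c * b \<in> K" using x insert sub by (auto simp: is_subfield_def)
    moreover have "Qadj x \<subseteq> Qadj (x + of_int c * b)"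
      using Qadj_subset[OF is_subfield_Qadj[OF alg] c(1)] .
    ultimately show ?case using c x by (intro bexI[of _ "x + of_int c * b"]) auto
  qed
  then obtain x where x: "x \<in> K" "B \<subseteq> Qadj x" by blast
  have "K \<subseteq> Qadj x" using x B rv.span_minimal[OF _ Qadj_subspace[OF alg]] by blast
  then have Kx: "K = Qadj x" using Qadj_subset[OF sub x(1)] by blast
  obtain m :: int where m: "m > 0" "algebraic_int (of_int m * x)"
    using algebraic_times_int[OF alg] by blast
  have sx: "is_subfield (Qadj x)" "is_subfield (Qadj (of_int m * x))"
    using is_subfield_Qadj alg by blast+
  have "of_int m * x = of_rat (of_int m) * x" by simp
  then have 1: "of_int m * x \<in> Qadj x"
    using sx(1) Qadj_of_rat[of "of_int m" x] Qadj_self[of x] unfolding is_subfield_def by (metis of_rat_of_int_eq)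
  have "of_rat (inverse (of_int m)) * (of_int m * x) \<in> Qadj (of_int m * x)"
    using sx(2) Qadj_of_rat Qadj_self unfolding is_subfield_def by blast
  moreover have "of_rat (inverse (of_int m)) * (of_int m * x) = x"
    using m by (simp add: of_rat_inverse)
  ultimately have 2: "x \<in> Qadj (of_int m * x)" by simp
  have "Qadj x = Qadj (of_int m * x)"
    using Qadj_subset[OF sx(1) 1] Qadj_subset[OF sx(2) 2] by blast
  then show ?thesis using m Kx by blast
qed

section \<open>Galois groups of simple extensions\<close>

text \<open>The automorphisms are total functions on the ambient field, the identity outside \<open>K\<close>, so
  that they form a group under composition.\<close>

locale galois_int =
  fixes K :: "'a::field_char_0 set" and B :: "'a set" and G :: "('a \<Rightarrow> 'a) set"
  assumes subfield: "is_subfield K"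
    and finite_B: "finite B" and indep_B: "rv.independent B" and span_B: "rv.span B = K"
    and one_B: "1 \<in> B" and int_B: "\<And>b. b \<in> B \<Longrightarrow> algebraic_int b"
    and finite_G: "finite G" and card_G: "card G = card B"
    and id_G: "id \<in> G" and comp_G: "\<And>\<sigma> \<tau>. \<sigma> \<in> G \<Longrightarrow> \<tau> \<in> G \<Longrightarrow> \<sigma> \<circ> \<tau> \<in> G"
    and inj_G: "\<And>\<sigma>. \<sigma> \<in> G \<Longrightarrow> inj \<sigma>"
    and G_closed: "\<And>\<sigma> x. \<sigma> \<in> G \<Longrightarrow> x \<in> K \<Longrightarrow> \<sigma> x \<in> K"
    and G_add: "\<And>\<sigma> x y. \<sigma> \<in> G \<Longrightarrow> x \<in> K \<Longrightarrow> y \<in> K \<Longrightarrow> \<sigma> (x + y) = \<sigma> x + \<sigma> y"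
    and G_mult: "\<And>\<sigma> x y. \<sigma> \<in> G \<Longrightarrow> x \<in> K \<Longrightarrow> y \<in> K \<Longrightarrow> \<sigma> (x * y) = \<sigma> x * \<sigma> y"
    and G_rat: "\<And>\<sigma> q. \<sigma> \<in> G \<Longrightarrow> \<sigma> (of_rat q) = of_rat q"
    and G_fixed: "\<And>x. x \<in> K \<Longrightarrow> (\<And>\<sigma>. \<sigma> \<in> G \<Longrightarrow> \<sigma> x = x) \<Longrightarrow> \<exists>q. x = of_rat q"

text \<open>Each root \<open>r\<close> of \<open>f\<close> gives an automorphism sending p(t) to
  p(r). Separability supplies exactly \<open>degree f\<close> roots, which matches the number of
  powers of \<open>t\<close> in the basis.\<close>

lemma galois_int_Qadj:
  fixes t :: "'a::{field_char_0,alg_closed_field}"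
  assumes t: "algebraic_int t" and f: "irreducible f" "evq f t = 0"
    and roots: "\<And>r. evq f r = 0 \<Longrightarrow> r \<in> Qadj t"
  shows "\<exists>G. galois_int (Qadj t) ((\<lambda>i. t ^ i) ` {..<degree f}) G"
proof -
  define n where "n = degree f"
  define K where "K = Qadj t"
  define R :: "'a set" where "R = {r. evq f r = 0}"
  have sub: "is_subfield K" unfolding K_def using t is_subfield_Qadj by blast
  have f0: "f \<noteq> 0" using f by auto
  have n0: "n > 0" unfolding n_def using f(1)
    by (metis gr0I irreducible_def is_unit_iff_degree)
  have finR: "finite R" and cardR: "card R = n"
  proof -
    have rs: "rsquarefree (map_poly (of_rat :: rat \<Rightarrow> 'a) f)" using irreducible_rsquarefree f(1) by blast
    have RR: "R = {x. poly (map_poly of_rat f) x = 0}" by (simp add: R_def evq_def)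
    then show "card R = n" using rsquarefree_card_roots[OF rs] by (simp add: n_def)
    then show "finite R" using n0 by (metis card.infinite less_nat_zero_code)
  qed
  have RK: "R \<subseteq> K" using roots by (auto simp: R_def K_def)
  have tR: "t \<in> R" using f by (simp add: R_def)
  have eq_iff: "evq p r = evq q r \<longleftrightarrow> f dvd p - q" if "r \<in> R" for p q r
    using irreducible_annihilator_dvd[OF f(1), of r "p - q"] that by (simp add: R_def)
  \<comment> \<open>The choice of the representing polynomial does not matter: two of them differ by
    a multiple of \<open>f\<close>, which vanishes at \<open>r\<close> as well.\<close>
  define \<sigma> where "\<sigma> r x = (if x \<in> K then evq (SOME p. evq p t = x) r else x)" for r x :: 'a
  have \<sigma>: "\<sigma> r (evq p t) = evq p r" if "r \<in> R" for r p
  proof -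
    have "evq (SOME q. evq q t = evq p t) t = evq p t" by (rule someI[of _ p]) simp
    then have "f dvd (SOME q. evq q t = evq p t) - p" using eq_iff[OF tR] by simp
    then show ?thesis using eq_iff[OF that] by (simp add: \<sigma>_def K_def)
  qed
  have \<sigma>out: "\<sigma> r x = x" if "x \<notin> K" for r x using that by (simp add: \<sigma>_def)
  have \<sigma>K: "\<sigma> r x \<in> K" if "r \<in> R" "x \<in> K" for r x
    using that RK sub by (auto simp: \<sigma>_def intro!: subfield_evq)
  have Kex: "\<exists>p. x = evq p t" if "x \<in> K" for x using that by (auto simp: K_def Qadj_def)
  have \<sigma>evq: "\<sigma> r (evq p x) = evq p (\<sigma> r x)" if r: "r \<in> R" and x: "x \<in> K" for r p x
  proof -
    from x Kex obtain q where q: "x = evq q t" by blast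
    show ?thesis using \<sigma>[OF r, of "pcompose p q"] \<sigma>[OF r, of q] by (simp add: q)
  qed
  have inj: "inj (\<sigma> r)" if r: "r \<in> R" for r
  proof (rule injI)
    fix x y assume e: "\<sigma> r x = \<sigma> r y"
    show "x = y"
    proof (cases "x \<in> K \<longleftrightarrow> y \<in> K")
      case True
      show ?thesis
      proof (cases "x \<in> K")
        case xK: True
        then obtain p q where "x = evq p t" "y = evq q t" using True Kex by metis
        then show ?thesis using e \<sigma>[OF r] eq_iff[OF r] eq_iff[OF tR] by simp
      qed (use True e \<sigma>out in metis)
    next
      case False
      then show ?thesis using e \<sigma>out \<sigma>K[OF r] by metis
    qed
  qed
  \<comment> \<open>An automorphism is determined by the image of \<open>t\<close>, and
    \<open>\<sigma> r\<close> maps the root \<open>s\<close> of \<open>f\<close> to another root, so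
    composites stay in the family.\<close>
  have comp: "\<sigma> r \<circ> \<sigma> s = \<sigma> (\<sigma> r s) \<and> \<sigma> r s \<in> R" if r: "r \<in> R" and s: "s \<in> R" for r s
  proof -
    have sK: "s \<in> K" using s RK by blast
    have "evq f (\<sigma> r s) = \<sigma> r (evq f s)" using \<sigma>evq[OF r sK] by simp
    also have "\<dots> = 0" using s \<sigma>[OF r, of 0] by (simp add: R_def)
    finally have R: "\<sigma> r s \<in> R" by (simp add: R_def)
    have "\<sigma> r (\<sigma> s x) = \<sigma> (\<sigma> r s) x" for x
    proof (cases "x \<in> K")
      case True
      then obtain p where "x = evq p t" using Kex by blast
      then show ?thesis using \<sigma>[OF s] \<sigma>[OF R] \<sigma>evq[OF r sK] by simp
    qed (simp add: \<sigma>out)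
    then show ?thesis using R by auto
  qed
  define G where "G = \<sigma> ` R"
  have "\<sigma> r t = r" if "r \<in> R" for r using \<sigma>[OF that, of "[:0,1:]"] by simp
  then have "inj_on \<sigma> R" by (metis inj_onI)
  then have cG: "card G = n" using cardR by (simp add: G_def card_image)
  have "\<sigma> t x = x" for x by (cases "x \<in> K") (use Kex \<sigma>[OF tR] \<sigma>out in metis)+
  then have idt: "\<sigma> t = id" by auto
  define B where "B = (\<lambda>i. t ^ i) ` {..<n}"
  have small: "p = 0" if "evq p t = 0" "degree p < n" for p
  proof (rule ccontr)
    assume "p \<noteq> 0"
    moreover have "f dvd p" using irreducible_annihilator_dvd[OF f] that by blast
    ultimately have "n \<le> degree p" unfolding n_def by (rule dvd_imp_degree_le[rotated])
    then show False using that by simp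
  qed
  have degsum: "degree (\<Sum>i<n. monom (c i) i) < n" for c :: "nat \<Rightarrow> rat"
    using n0 by (intro degree_lessI) (auto simp: coeff_sum coeff_monom)
  have lin: "c i = 0" if "(\<Sum>i<n. of_rat (c i) * t ^ i) = 0" "i < n" for c i
  proof -
    have "(\<Sum>i<n. monom (c i) i) = 0" using that degsum[of c] by (intro small) auto
    then have "coeff (\<Sum>i<n. monom (c i) i) i = 0" by simp
    then show ?thesis using that by (simp add: coeff_sum)
  qed
  have injp: "inj_on (\<lambda>i. t ^ i) {..<n}"
  proof (rule inj_onI, rule ccontr)
    fix i j assume ij: "i \<in> {..<n}" "j \<in> {..<n}" "t ^ i = t ^ j" "i \<noteq> j"
    define c :: "nat \<Rightarrow> rat" where "c = (\<lambda>k. (if k = i then 1 else 0) - (if k = j then 1 else 0))"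
    have "(\<Sum>k<n. of_rat (c k) * t ^ k) = (\<Sum>k<n. (if k = i then t ^ k else 0) - (if k = j then t ^ k else 0))"
      by (intro sum.cong) (auto simp: c_def)
    also have "\<dots> = 0" using ij by (simp add: sum_subtractf)
    finally have "c i = 0" using lin ij by blast
    then show False using ij by (simp add: c_def)
  qed
  have indep: "rv.independent B"
  proof (rule rv.independent_if_scalars_zero)
    fix g :: "'a \<Rightarrow> rat" and x assume g: "(\<Sum>x\<in>B. of_rat (g x) * x) = 0" "x \<in> B"
    then have "(\<Sum>i<n. of_rat (g (t ^ i)) * t ^ i) = 0"
      by (simp add: B_def sum.reindex[OF injp])
    then show "g x = 0" using lin[of "\<lambda>i. g (t ^ i)"] g(2) by (auto simp: B_def)
  qed (simp add: B_def)
  have Kdeg: "\<exists>p. x = evq p t \<and> degree p < n" if xK: "x \<in> K" for x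
  proof -
    obtain p where p: "x = evq p t" using Kex xK by blast
    have "f dvd p - p mod f" by (simp add: minus_mod_eq_mult_div)
    then have "x = evq (p mod f) t" using eq_iff[OF tR] p by simp
    moreover have "degree (p mod f) < n"
      using degree_mod_less[OF f0, of p] n0 by (auto simp: n_def)
    ultimately show ?thesis by blast
  qed
  have span: "rv.span B = K"
  proof
    have "t ^ i \<in> K" for i using subfield_evq[OF sub Qadj_self[of t, folded K_def], of "monom 1 i"] by simp
    then have "B \<subseteq> K" by (auto simp: B_def)
    then show "rv.span B \<subseteq> K"
      by (rule rv.span_minimal) (use t in \<open>auto simp: K_def intro!: Qadj_subspace\<close>)
    show "K \<subseteq> rv.span B"
    proof
      fix x assume "x \<in> K"
      then obtain p where p: "x = evq p t" "degree p < n" using Kdeg by blast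
      have "x = (\<Sum>i\<le>degree p. of_rat (coeff p i) * t ^ i)"
        by (simp add: p(1) evq_def poly_altdef coeff_map_poly)
      also have "\<dots> \<in> rv.span B"
        using p(2) by (intro rv.span_sum rv.span_scale rv.span_base) (auto simp: B_def)
      finally show "x \<in> rv.span B" .
    qed
  qed
  have "galois_int K B G"
  proof
    show "is_subfield K" by (fact sub)
    show "finite B" by (simp add: B_def)
    show "rv.independent B" by (fact indep)
    show "rv.span B = K" by (fact span)
    show "1 \<in> B" using n0 by (auto simp: B_def intro!: image_eqI[of _ _ 0])
    show "algebraic_int b" if "b \<in> B" for b
    proof -
      have "algebraic_int (t ^ i)" for i by (induction i) (auto intro: algebraic_int_times t)
      then show ?thesis using that by (auto simp: B_def)
    qed
    show "finite G" using finR by (simp add: G_def)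
    show "card G = card B" using cG card_image[OF injp] by (simp add: B_def)
    show "id \<in> G" using idt tR by (auto simp: G_def intro!: image_eqI[of _ _ t])
    show "\<alpha> \<circ> \<beta> \<in> G" if "\<alpha> \<in> G" "\<beta> \<in> G" for \<alpha> \<beta> using that comp by (auto simp: G_def)
    show "inj \<alpha>" if "\<alpha> \<in> G" for \<alpha> using that inj by (auto simp: G_def)
    show "\<alpha> x \<in> K" if "\<alpha> \<in> G" "x \<in> K" for \<alpha> x using that \<sigma>K by (auto simp: G_def)
    show "\<alpha> (x + y) = \<alpha> x + \<alpha> y" if "\<alpha> \<in> G" "x \<in> K" "y \<in> K" for \<alpha> x y
    proof -
      obtain p q where pq: "x = evq p t" "y = evq q t" using Kex \<open>x \<in> K\<close> \<open>y \<in> K\<close> by metis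
      obtain r where r: "r \<in> R" "\<alpha> = \<sigma> r" using \<open>\<alpha> \<in> G\<close> by (auto simp: G_def)
      show ?thesis using \<sigma>[OF r(1), of "p + q"] \<sigma>[OF r(1), of p] \<sigma>[OF r(1), of q] by (simp add: pq r(2))
    qed
    show "\<alpha> (x * y) = \<alpha> x * \<alpha> y" if "\<alpha> \<in> G" "x \<in> K" "y \<in> K" for \<alpha> x y
    proof -
      obtain p q where pq: "x = evq p t" "y = evq q t" using Kex \<open>x \<in> K\<close> \<open>y \<in> K\<close> by metis
      obtain r where r: "r \<in> R" "\<alpha> = \<sigma> r" using \<open>\<alpha> \<in> G\<close> by (auto simp: G_def)
      show ?thesis using \<sigma>[OF r(1), of "p * q"] \<sigma>[OF r(1), of p] \<sigma>[OF r(1), of q] by (simp add: pq r(2))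
    qed
    show "\<alpha> (of_rat q) = of_rat q" if "\<alpha> \<in> G" for \<alpha> q
      using that \<sigma>[of _ "[:q:]"] by (auto simp: G_def)
    show "\<exists>q. x = of_rat q" if x: "x \<in> K" and fx: "\<And>\<alpha>. \<alpha> \<in> G \<Longrightarrow> \<alpha> x = x" for x
    proof -
      obtain p where p: "x = evq p t" "degree p < n" using Kdeg x by blast
      \<comment> \<open>All \<open>n\<close> roots of \<open>f\<close> are roots of p(X) - x, whose
        degree is below \<open>n\<close>. So it is the zero polynomial, and \<open>x\<close> is the
        constant coefficient of \<open>p\<close>.\<close>
      define P where "P = map_poly of_rat p - [:x:]"
      have "poly P r = 0" if "r \<in> R" for r
        using fx[of "\<sigma> r"] \<sigma>[OF that, of p] that p by (auto simp: G_def P_def evq_def)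
      then have sub: "R \<subseteq> {r. poly P r = 0}" by blast
      have dP: "degree P < n" using p(2) n0 unfolding P_def
        by (intro degree_diff_less) auto
      have "P = 0"
      proof (rule ccontr)
        assume "P \<noteq> 0"
        then have "card R \<le> degree P"
          using card_mono[OF poly_roots_finite[OF \<open>P \<noteq> 0\<close>] sub] card_poly_roots_bound[of P] by linarith
        then show False using dP cardR by simp
      qed
      then have "coeff P 0 = 0" by simp
      then show ?thesis by (auto simp: P_def coeff_map_poly)
    qed
  qed
  then show ?thesis unfolding K_def B_def n_def by blast
qed

lemma finite_galois_int:
  fixes K :: "'a::{field_char_0,alg_closed_field} set"
  assumes alg: "\<And>z::'a. algebraic z" and K: "finite_galois_over_rat K"
  shows "\<exists>t B G. algebraic_int t \<and> K = Qadj t \<and> galois_int K B G"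
proof -
  obtain t where t: "algebraic_int t" "K = Qadj t"
    using number_field_primitive[OF alg] K by (auto simp: finite_galois_over_rat_def)
  obtain f where f: "irreducible f" "evq f t = 0" using exists_irreducible_annihilator[OF alg] by blast
  have "r \<in> Qadj t" if "evq f r = 0" for r
    using K f that t(2) Qadj_self[of t]
    unfolding finite_galois_over_rat_def normal_over_rat_def evq_def by blast
  then show ?thesis using galois_int_Qadj[OF t(1) f] t by blast
qed

text \<open>A conjugate of \<open>t\<close> is a conjugate of \<open>a\<close> plus \<open>c\<close>
  times a conjugate of \<open>b\<close>, and normality keeps both in the compositum. The basis of
  powers of \<open>t\<close> is recorded because splitting of the compositum will be tested on these
  powers.\<close>

lemma galois_int_compositum:
  fixes a b :: "'a::{field_char_0,alg_closed_field}"
  assumes alg: "\<And>z::'a. algebraic z" and int: "algebraic_int a" "algebraic_int b"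
    and na: "normal_over_rat (Qadj a)" and nb: "normal_over_rat (Qadj b)"
  shows "\<exists>c::int. \<exists>n G. a \<in> Qadj (a + of_int c * b) \<and> b \<in> Qadj (a + of_int c * b)
    \<and> galois_int (Qadj (a + of_int c * b)) ((\<lambda>i. (a + of_int c * b) ^ i) ` {..<n}) G"
proof -
  obtain c :: int where c: "a \<in> Qadj (a + of_int c * b)" "b \<in> Qadj (a + of_int c * b)"
    using primitive_element_two[OF alg] by blast
  define t where "t = a + of_int c * b"
  have t: "algebraic_int t" unfolding t_def
    using int by (intro algebraic_int_plus algebraic_int_times) auto
  obtain f where f: "irreducible f" "evq f t = 0" using exists_irreducible_annihilator[OF alg] by blast
  have sub: "is_subfield (Qadj t)" using is_subfield_Qadj alg by blast
  have ct: "a \<in> Qadj t" "b \<in> Qadj t" using c by (auto simp: t_def)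
  then obtain p q where pq: "a = evq p t" "b = evq q t" by (auto simp: Qadj_def)
  have conj: "evq u r \<in> Qadj t" if r: "evq f r = 0" and x: "x = evq u t" "x \<in> Qadj t"
    and n: "normal_over_rat (Qadj x)" for r x u
  proof -
    obtain g where g: "irreducible g" "evq g x = 0" using exists_irreducible_annihilator[OF alg] by blast
    then have "f dvd pcompose g u" using irreducible_annihilator_dvd[OF f, of "pcompose g u"] x by simp
    then have "evq g (evq u r) = 0" using irreducible_annihilator_dvd[OF f(1) r, of "pcompose g u"] by simp
    then have "evq u r \<in> Qadj x"
      using n g Qadj_self[of x] unfolding normal_over_rat_def evq_def by blast
    then show ?thesis using Qadj_subset[OF sub x(2)] by blast
  qed
  have "r \<in> Qadj t" if r: "evq f r = 0" for r
  proof -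
    \<comment> \<open>The relation t = a + c b, with \<open>a\<close> and \<open>b\<close> written
      as polynomials in \<open>t\<close>, passes from \<open>t\<close> to the conjugate
      \<open>r\<close>.\<close>
    define w where "w = [:0,1:] - (p + Polynomial.smult (of_int c) q)"
    have "evq w t = t - (evq p t + of_int c * evq q t)" by (simp add: w_def)
    then have "evq w t = 0" unfolding pq[symmetric] by (simp add: t_def)
    then have "evq w r = 0"
      using irreducible_annihilator_dvd[OF f] irreducible_annihilator_dvd[OF f(1) r] by blast
    then have "r = evq p r + of_rat (of_int c) * evq q r" by (simp add: w_def)
    moreover have "evq p r \<in> Qadj t" "evq q r \<in> Qadj t"
      using conj[OF r pq(1) ct(1) na] conj[OF r pq(2) ct(2) nb] by blast+
    ultimately show ?thesis
      using sub Qadj_of_rat[of "of_int c" t] unfolding is_subfield_def by metis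
  qed
  then have "\<exists>G. galois_int (Qadj t) ((\<lambda>i. t ^ i) ` {..<degree f}) G"
    by (rule galois_int_Qadj[OF t f])
  then show ?thesis using c unfolding t_def by blast
qed

subsection \<open>Arithmetic in the ring of integers\<close>

lemma nat_prime_dvd_power_self_diff:
  assumes "prime p"
  shows "int p dvd int a ^ p - int a"
proof (induction a)
  case 0
  have "p > 0" using assms prime_gt_0_nat by blast
  then show ?case by (simp add: power_0_left)
next
  case (Suc a)
  have p: "p > 1" using assms prime_gt_1_nat by blast
  have mid: "int p dvd (\<Sum>k\<in>{1..<p}. of_nat (p choose k) * int a ^ k)"
  proof (intro dvd_sum dvd_mult2)
    fix k assume k: "k \<in> {1..<p}"
    then have "k * (p choose k) = p * (p - 1 choose (k - 1))" by (intro times_binomial_minus1_eq) auto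
    then have "p dvd k * (p choose k)" by simp
    then have "p dvd p choose k" using k assms by (auto simp: prime_dvd_mult_iff dest: dvd_imp_le)
    then show "int p dvd of_nat (p choose k)" by simp
  qed
  have "{..p} = insert 0 (insert p {1..<p})" using p by auto
  then have "(int a + 1) ^ p = 1 + int a ^ p + (\<Sum>k\<in>{1..<p}. of_nat (p choose k) * int a ^ k)"
    using p by (simp add: binomial_ring)
  then have "int (Suc a) ^ p - int (Suc a)
      = (int a ^ p - int a) + (\<Sum>k\<in>{1..<p}. of_nat (p choose k) * int a ^ k)" by (simp add: add.commute)
  then show ?case using mid Suc by (metis dvd_add)
qed

lemma int_prime_dvd_power_self_diff:
  fixes a :: int
  assumes "prime p"
  shows "int p dvd a ^ p - a"
proof -
  define b where "b = nat (a mod int p)"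
  have p0: "p > 0" using assms prime_gt_0_nat by blast
  then have b: "int b = a mod int p" by (simp add: b_def)
  have "(a ^ p - a) mod int p = (a ^ p mod int p - a mod int p) mod int p" by (simp only: mod_diff_eq)
  also have "\<dots> = ((a mod int p) ^ p mod int p - (a mod int p) mod int p) mod int p"
    by (simp only: power_mod mod_mod_trivial)
  also have "\<dots> = (int b ^ p - int b) mod int p" by (simp only: mod_diff_eq b)
  finally have "(a ^ p - a) mod int p = (int b ^ p - int b) mod int p" .
  then show ?thesis using nat_prime_dvd_power_self_diff[OF assms, of b] by (simp add: dvd_eq_mod_eq_0)
qed

text \<open>Factorization over the field with \<open>p\<close> elements, phrased with integer
  polynomials: a linear factor is split off by synthetic division, and incongruence of the roots
  lets the others pass to the quotient.\<close>

lemma monic_int_poly_roots_mod_prime: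
  fixes f :: "int poly"
  assumes p: "prime p" and A: "finite A" "card A = degree f" "lead_coeff f = 1"
    and inj: "\<And>a b. a \<in> A \<Longrightarrow> b \<in> A \<Longrightarrow> int p dvd a - b \<Longrightarrow> a = b"
    and root: "\<And>a. a \<in> A \<Longrightarrow> int p dvd poly f a"
  shows "\<exists>g. f = (\<Prod>a\<in>A. [:-a, 1:]) + Polynomial.smult (int p) g"
  using A inj root
proof (induction A arbitrary: f rule: finite_induct)
  case empty
  then have "f = 1" by (auto elim!: degree_eq_zeroE simp: one_pCons)
  then show ?case by (intro exI[of _ 0]) simp
next
  case (insert a A)
  define f1 where "f1 = synthetic_div f a"
  have f: "f = [:-a, 1:] * f1 + [:poly f a:]" unfolding f1_def by (rule synthetic_div_correct'[symmetric])
  have df: "degree f = Suc (card A)" using insert by simp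
  have d1: "degree f1 = card A" using df by (simp add: f1_def degree_synthetic_div)
  have "coeff f (Suc (card A)) = coeff f1 (card A)"
    by (subst f) (simp add: coeff_pCons coeff_eq_0 d1)
  then have l1: "lead_coeff f1 = 1" using insert.prems(2) df d1 by simp
  have root1: "int p dvd poly f1 b" if b: "b \<in> A" for b
  proof -
    have "poly f b = (b - a) * poly f1 b + poly f a" by (subst f) (simp add: algebra_simps)
    then have "(b - a) * poly f1 b = poly f b - poly f a" by simp
    then have "int p dvd (b - a) * poly f1 b" using insert.prems(4) b by simp
    moreover have "\<not> int p dvd b - a" using insert.prems(3)[of b a] b insert.hyps by auto
    ultimately show ?thesis using p by (simp add: prime_dvd_mult_iff)
  qed
  obtain g where g: "f1 = (\<Prod>a\<in>A. [:-a, 1:]) + Polynomial.smult (int p) g"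
    using insert.IH[of f1] d1 l1 insert.prems(3) root1 by auto
  obtain c where c: "poly f a = int p * c" using insert.prems(4)[of a] by auto
  have "f = [:-a, 1:] * ((\<Prod>a\<in>A. [:-a, 1:]) + Polynomial.smult (int p) g) + [:poly f a:]"
    using f by (simp only: g)
  also have "\<dots> = (\<Prod>a\<in>insert a A. [:-a, 1:]) + Polynomial.smult (int p) ([:-a, 1:] * g + [:c:])"
    using insert.hyps by (simp only: c prod.insert ring_distribs smult_add_right mult_smult_right) simp
  finally show ?case by blast
qed

lemma common_denominator:
  fixes S :: "rat set"
  assumes "finite S"
  shows "\<exists>d::int. d > 0 \<and> (\<forall>q\<in>S. \<exists>k::int. of_int d * q = of_int k)"
  using assms
proof (induction S rule: finite_induct)
  case empty then show ?case by (intro exI[of _ 1]) auto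
next
  case (insert q S)
  then obtain d :: int where d: "d > 0" "\<forall>q\<in>S. \<exists>k::int. of_int d * q = of_int k" by blast
  obtain a b where q: "q = of_int a / of_int b" "b > 0" by (metis quotient_of_denom_pos quotient_of_div surj_pair)
  have "\<exists>k::int. of_int (d * b) * r = of_int k" if r: "r \<in> insert q S" for r
  proof (cases "r = q")
    case True
    then have "of_int (d * b) * r = of_int (d * a)" using q by simp
    then show ?thesis by blast
  next
    case False
    then obtain k :: int where "of_int d * r = of_int k" using d r False by blast
    then have "of_int (d * b) * r = of_int (k * b)" by (simp add: algebra_simps)
    then show ?thesis by blast
  qed
  then show ?case using d q by (intro exI[of _ "d * b"]) auto
qed

section \<open>Conjugation, norm and trace\<close>

context galois_int
begin

abbreviation OK :: "'a set" where "OK \<equiv> ring_of_integers K"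

lemma OK_iff: "x \<in> OK \<longleftrightarrow> x \<in> K \<and> algebraic_int x"
  by (auto simp: ring_of_integers_def)

lemma K_ops: "x \<in> K \<Longrightarrow> y \<in> K \<Longrightarrow> x + y \<in> K" "x \<in> K \<Longrightarrow> y \<in> K \<Longrightarrow> x - y \<in> K"
  "x \<in> K \<Longrightarrow> y \<in> K \<Longrightarrow> x * y \<in> K" "x \<in> K \<Longrightarrow> inverse x \<in> K" "0 \<in> K" "1 \<in> K"
  "of_rat q \<in> K"
  using subfield subfield_of_rat[OF subfield] by (auto simp: is_subfield_def)

lemma K_of_int: "of_int k \<in> K" using K_ops(7)[of "of_int k"] by simp
lemma K_of_nat: "of_nat k \<in> K" using K_of_int[of "int k"] by simp

lemma OK_K: "x \<in> OK \<Longrightarrow> x \<in> K" by (simp add: OK_iff)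

lemma OK_add: "x \<in> OK \<Longrightarrow> y \<in> OK \<Longrightarrow> x + y \<in> OK"
  and OK_diff: "x \<in> OK \<Longrightarrow> y \<in> OK \<Longrightarrow> x - y \<in> OK"
  and OK_mult: "x \<in> OK \<Longrightarrow> y \<in> OK \<Longrightarrow> x * y \<in> OK"
  by (auto simp: OK_iff K_ops algebraic_int_plus algebraic_int_diff algebraic_int_times)

lemma OK_of_int: "of_int k \<in> OK" by (simp add: OK_iff K_of_int)
lemma OK_of_nat: "of_nat k \<in> OK" using OK_of_int[of "int k"] by simp
lemma OK_0: "0 \<in> OK" and OK_1: "1 \<in> OK" using OK_of_int[of 0] OK_of_int[of 1] by auto
lemma OK_power: "x \<in> OK \<Longrightarrow> x ^ k \<in> OK" by (induction k) (auto simp: OK_1 OK_mult)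
lemma OK_prod: "(\<And>i. i \<in> A \<Longrightarrow> f i \<in> OK) \<Longrightarrow> prod f A \<in> OK"
  by (induction A rule: infinite_finite_induct) (auto simp: OK_1 OK_mult)
lemma OK_sum: "(\<And>i. i \<in> A \<Longrightarrow> f i \<in> OK) \<Longrightarrow> sum f A \<in> OK"
  by (induction A rule: infinite_finite_induct) (auto simp: OK_0 OK_add)

lemmas OK_intros = OK_add OK_diff OK_mult OK_of_int OK_of_nat OK_0 OK_1 OK_power OK_prod OK_sum

lemma B_K: "b \<in> B \<Longrightarrow> b \<in> K" using span_B rv.span_base by blast
lemma B_OK: "b \<in> B \<Longrightarrow> b \<in> OK" using B_K int_B by (simp add: OK_iff)

lemma G_of_int: "\<sigma> \<in> G \<Longrightarrow> \<sigma> (of_int k) = of_int k" using G_rat[of \<sigma> "of_int k"] by simp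
lemma G_of_nat: "\<sigma> \<in> G \<Longrightarrow> \<sigma> (of_nat k) = of_nat k" using G_of_int[of \<sigma> "int k"] by simp
lemma G_0: "\<sigma> \<in> G \<Longrightarrow> \<sigma> 0 = 0" and G_1: "\<sigma> \<in> G \<Longrightarrow> \<sigma> 1 = 1"
  using G_of_int[of \<sigma> 0] G_of_int[of \<sigma> 1] by auto

lemma G_diff:
  assumes "\<sigma> \<in> G" "x \<in> K" "y \<in> K"
  shows "\<sigma> (x - y) = \<sigma> x - \<sigma> y"
proof -
  have "\<sigma> ((x - y) + y) = \<sigma> (x - y) + \<sigma> y" using assms by (intro G_add) (auto simp: K_ops)
  then show ?thesis by simp
qed

lemma G_sum: "\<sigma> \<in> G \<Longrightarrow> (\<And>i. i \<in> A \<Longrightarrow> f i \<in> K) \<Longrightarrow> \<sigma> (sum f A) = (\<Sum>i\<in>A. \<sigma> (f i))"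
proof (induction A rule: infinite_finite_induct)
  case (insert a A)
  have "sum f A \<in> K" using insert by (intro subfield_sum[OF subfield]) auto
  then show ?case using insert by (simp add: G_add)
qed (auto simp: G_0)

lemma G_prod: "\<sigma> \<in> G \<Longrightarrow> (\<And>i. i \<in> A \<Longrightarrow> f i \<in> K) \<Longrightarrow> \<sigma> (prod f A) = (\<Prod>i\<in>A. \<sigma> (f i))"
proof (induction A rule: infinite_finite_induct)
  case (insert a A)
  have "prod f A \<in> K" using insert by (intro subfield_prod[OF subfield]) auto
  then show ?case using insert by (simp add: G_mult)
qed (auto simp: G_1)

lemma G_power: "\<sigma> \<in> G \<Longrightarrow> x \<in> K \<Longrightarrow> \<sigma> (x ^ k) = \<sigma> x ^ k"
  using G_prod[of \<sigma> "{..<k}" "\<lambda>_. x"] by simp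

lemma G_evq:
  assumes "\<sigma> \<in> G" "x \<in> K"
  shows "\<sigma> (evq p x) = evq p (\<sigma> x)"
proof (induction p)
  case (pCons a p)
  have "evq p x \<in> K" by (rule subfield_evq[OF subfield assms(2)])
  then show ?case using pCons assms by (simp add: G_add G_mult K_ops G_rat)
qed (simp add: G_0 assms)

lemma G_OK: "\<sigma> \<in> G \<Longrightarrow> x \<in> OK \<Longrightarrow> \<sigma> x \<in> OK"
proof -
  assume s: "\<sigma> \<in> G" and x: "x \<in> OK"
  from x obtain p where p: "poly (map_poly of_int p) x = 0" "lead_coeff p = 1"
    by (auto simp: OK_iff algebraic_int_altdef_ipoly)
  have eq: "poly (map_poly of_int p) y = evq (map_poly of_int p) y" for y :: 'a
    by (simp add: evq_def map_poly_map_poly o_def)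
  have "poly (map_poly of_int p) (\<sigma> x) = \<sigma> (poly (map_poly of_int p) x)"
    unfolding eq using G_evq s x by (simp add: OK_iff)
  then have "poly (map_poly of_int p) (\<sigma> x) = 0" using p G_0 s by simp
  then show ?thesis using p s x G_closed by (auto simp: OK_iff algebraic_int_altdef_ipoly)
qed

lemma G_bij_left: "\<sigma> \<in> G \<Longrightarrow> bij_betw (\<lambda>\<tau>. \<sigma> \<circ> \<tau>) G G"
proof -
  assume s: "\<sigma> \<in> G"
  have i: "inj_on (\<lambda>\<tau>. \<sigma> \<circ> \<tau>) G" using inj_G[OF s] by (auto simp: inj_on_def fun_eq_iff)
  moreover have "(\<lambda>\<tau>. \<sigma> \<circ> \<tau>) ` G \<subseteq> G" using comp_G s by auto
  ultimately have "(\<lambda>\<tau>. \<sigma> \<circ> \<tau>) ` G = G" using finite_G endo_inj_surj by blast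
  then show ?thesis using i by (simp add: bij_betw_def)
qed

text \<open>The locale provides only a finite monoid of injective maps. Left translation is
  injective on it, hence a permutation, and it therefore hits the identity.\<close>

lemma G_inverse:
  assumes s: "\<sigma> \<in> G"
  shows "\<exists>\<tau>\<in>G. (\<forall>x. \<tau> (\<sigma> x) = x) \<and> (\<forall>x. \<sigma> (\<tau> x) = x)"
proof -
  have "(\<lambda>\<tau>. \<sigma> \<circ> \<tau>) ` G = G" using G_bij_left[OF s] by (simp add: bij_betw_def)
  then obtain \<tau> where t: "\<tau> \<in> G" "\<sigma> \<circ> \<tau> = id" using id_G by (metis imageE)
  then have 1: "\<sigma> (\<tau> x) = x" for x by (metis comp_apply id_apply)
  then have "\<tau> (\<sigma> x) = x" for x using inj_G[OF s] by (metis injD)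
  then show ?thesis using 1 t by blast
qed

lemma G_inj_iff: "\<sigma> \<in> G \<Longrightarrow> \<sigma> x = \<sigma> y \<longleftrightarrow> x = y"
  using inj_G by (auto simp: inj_def)

lemma G_eq_0_iff: "\<sigma> \<in> G \<Longrightarrow> \<sigma> x = 0 \<longleftrightarrow> x = 0"
  using G_inj_iff[of \<sigma> x 0] G_0[of \<sigma>] by simp

lemma invariant_rat:
  assumes "x \<in> K" "\<And>\<sigma>. \<sigma> \<in> G \<Longrightarrow> \<sigma> x = x" "algebraic_int x"
  shows "\<exists>k::int. x = of_int k"
proof -
  obtain q where q: "x = of_rat q" using G_fixed[OF assms(1)] assms(2) by blast
  show ?thesis using algebraic_int_of_ratD[of q] assms(3) unfolding q by blast
qed

text \<open>The value is an \<open>int\<close> so that divisibility and multiplicities apply;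
  \<open>of_int_nrm\<close> justifies the description on integral elements. The trace stays in the
  field because it is also applied to elements that are not integral.\<close>

definition nrm :: "'a \<Rightarrow> int" where "nrm x = (THE k. of_int k = (\<Prod>\<sigma>\<in>G. \<sigma> x))"
definition trc :: "'a \<Rightarrow> 'a" where "trc x = (\<Sum>\<sigma>\<in>G. \<sigma> x)"

lemma of_int_nrm:
  assumes x: "x \<in> OK"
  shows "of_int (nrm x) = (\<Prod>\<sigma>\<in>G. \<sigma> x)"
proof -
  define N where "N = (\<Prod>\<sigma>\<in>G. \<sigma> x)"
  have N: "N \<in> OK" unfolding N_def by (rule OK_prod) (rule G_OK[OF _ x])
  have "\<tau> N = N" if t: "\<tau> \<in> G" for \<tau>
  proof -
    have "\<tau> N = (\<Prod>\<sigma>\<in>G. \<tau> (\<sigma> x))" unfolding N_def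
      by (rule G_prod[OF t]) (rule G_closed[OF _ OK_K[OF x]])
    also have "\<dots> = (\<Prod>\<sigma>\<in>G. (\<tau> \<circ> \<sigma>) x)" by simp
    also have "\<dots> = N" unfolding N_def by (rule prod.reindex_bij_betw[OF G_bij_left[OF t]])
    finally show ?thesis .
  qed
  then obtain k :: int where "N = of_int k" using invariant_rat[of N] N by (auto simp: OK_iff)
  then have "\<exists>!k::int. of_int k = N" by auto
  then show ?thesis unfolding nrm_def N_def by (rule theI')
qed

lemma nrm_eq_0_iff: "x \<in> OK \<Longrightarrow> nrm x = 0 \<longleftrightarrow> x = 0"
proof -
  assume x: "x \<in> OK"
  have "nrm x = 0 \<longleftrightarrow> (of_int (nrm x) :: 'a) = 0" by simp
  also have "\<dots> \<longleftrightarrow> (\<exists>\<sigma>\<in>G. \<sigma> x = 0)" unfolding of_int_nrm[OF x] using finite_G by simp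
  also have "\<dots> \<longleftrightarrow> x = 0" using id_G G_eq_0_iff[of _ x] by (metis id_apply)
  finally show ?thesis .
qed

lemma nrm_dvd:
  assumes x: "x \<in> OK"
  shows "\<exists>y\<in>OK. of_int (nrm x) = x * y"
proof -
  have "of_int (nrm x) = id x * (\<Prod>\<sigma>\<in>G - {id}. \<sigma> x)"
    unfolding of_int_nrm[OF x] by (subst prod.remove[OF finite_G id_G]) simp
  moreover have "(\<Prod>\<sigma>\<in>G - {id}. \<sigma> x) \<in> OK" by (rule OK_prod) (use G_OK[OF _ x] in blast)
  ultimately show ?thesis by auto
qed

lemma trc_K: "x \<in> K \<Longrightarrow> trc x \<in> K"
  unfolding trc_def by (rule subfield_sum[OF subfield]) (rule G_closed)

lemma trc_invariant: "x \<in> K \<Longrightarrow> \<tau> \<in> G \<Longrightarrow> \<tau> (trc x) = trc x"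
proof -
  assume x: "x \<in> K" and t: "\<tau> \<in> G"
  have "\<tau> (trc x) = (\<Sum>\<sigma>\<in>G. \<tau> (\<sigma> x))" unfolding trc_def
    by (rule G_sum[OF t]) (rule G_closed[OF _ x])
  also have "\<dots> = (\<Sum>\<sigma>\<in>G. (\<tau> \<circ> \<sigma>) x)" by simp
  also have "\<dots> = trc x" unfolding trc_def by (rule sum.reindex_bij_betw[OF G_bij_left[OF t]])
  finally show ?thesis .
qed

lemma trc_rat: "x \<in> K \<Longrightarrow> \<exists>q. trc x = of_rat q"
  by (rule G_fixed[OF trc_K]) (auto simp: trc_invariant)

lemma trc_int: "x \<in> OK \<Longrightarrow> \<exists>k::int. trc x = of_int k"
proof (rule invariant_rat)
  assume x: "x \<in> OK"
  show "trc x \<in> K" using x trc_K OK_K by blast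
  show "\<sigma> (trc x) = trc x" if "\<sigma> \<in> G" for \<sigma> using x that trc_invariant OK_K by blast
  have "trc x \<in> OK" unfolding trc_def by (rule OK_sum) (rule G_OK[OF _ x])
  then show "algebraic_int (trc x)" by (simp add: OK_iff)
qed

lemma trc_diff: "x \<in> K \<Longrightarrow> y \<in> K \<Longrightarrow> trc (x - y) = trc x - trc y"
  unfolding trc_def sum_subtractf[symmetric] by (intro sum.cong refl) (rule G_diff)

lemma trc_scale: "x \<in> K \<Longrightarrow> trc (of_rat q * x) = of_rat q * trc x"
  unfolding trc_def sum_distrib_left
proof (intro sum.cong refl)
  fix \<sigma> assume "x \<in> K" "\<sigma> \<in> G"
  then show "\<sigma> (of_rat q * x) = of_rat q * \<sigma> x" using G_mult[of \<sigma> "of_rat q" x] G_rat[of \<sigma> q] K_ops(7) by simp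
qed

lemma trc_sum: "(\<And>i. i \<in> A \<Longrightarrow> f i \<in> K) \<Longrightarrow> trc (sum f A) = (\<Sum>i\<in>A. trc (f i))"
  unfolding trc_def by (subst sum.swap) (intro sum.cong refl G_sum)

section \<open>Coordinates and the trace-dual lattice\<close>

lemma card_B_pos: "card B > 0" using one_B finite_B card_gt_0_iff by blast

definition co :: "'a \<Rightarrow> 'a \<Rightarrow> rat" where "co x b = rv.representation B x b"

lemma co_sum: "x \<in> K \<Longrightarrow> (\<Sum>b\<in>B. of_rat (co x b) * b) = x"
  unfolding co_def by (rule rv.sum_representation_eq) (use indep_B span_B finite_B in auto)

lemma co_unique:
  assumes "b \<in> B"
  shows "co (\<Sum>b\<in>B. of_rat (g b) * b) b = g b"
proof -
  have "(\<Sum>b\<in>B. of_rat (g b) * b) \<in> K" by (intro subfield_sum[OF subfield]) (auto intro: K_ops B_K)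
  then have "(\<Sum>b\<in>B. of_rat (co (\<Sum>b\<in>B. of_rat (g b) * b) b - g b) * b) = 0"
    using co_sum by (simp add: of_rat_diff left_diff_distrib sum_subtractf)
  then have "co (\<Sum>b\<in>B. of_rat (g b) * b) b - g b = 0"
    by (rule rv.independentD[OF indep_B finite_B subset_refl _ assms])
  then show ?thesis by simp
qed

text \<open>Expanding the inverse of a nonzero \<open>x\<close> in \<open>B\<close> would give trace
  0 for x * inverse x = 1, but the trace of 1 is \<open>card G\<close>, nonzero in characteristic
  zero.\<close>

lemma trace_nondegenerate:
  assumes x: "x \<in> K" and z: "\<And>b. b \<in> B \<Longrightarrow> trc (x * b) = 0"
  shows "x = 0"
proof (rule ccontr)
  assume "x \<noteq> 0"
  have "x * (\<Sum>b\<in>B. of_rat (co (inverse x) b) * b) = (\<Sum>b\<in>B. of_rat (co (inverse x) b) * (x * b))"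
    by (simp add: sum_distrib_left mult.left_commute)
  then have "trc (x * inverse x) = trc (\<Sum>b\<in>B. of_rat (co (inverse x) b) * (x * b))"
    using co_sum[OF K_ops(4)[OF x]] by simp
  also have "\<dots> = (\<Sum>b\<in>B. trc (of_rat (co (inverse x) b) * (x * b)))"
    using x by (intro trc_sum) (auto intro: K_ops B_K)
  also have "\<dots> = (\<Sum>b\<in>B. of_rat (co (inverse x) b) * trc (x * b))"
    using x by (intro sum.cong refl trc_scale) (auto intro: K_ops B_K)
  also have "\<dots> = 0" using z by simp
  finally have "trc 1 = 0" using \<open>x \<noteq> 0\<close> by simp
  moreover have "trc 1 = (\<Sum>\<sigma>\<in>G. 1)" unfolding trc_def by (intro sum.cong refl) (rule G_1)
  ultimately show False using card_B_pos card_G by simp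
qed

text \<open>As the trace form is nondegenerate, the map \<open>T\<close> below is a bijection of \<open>K\<close>.\<close>

lemma dual_basis: "\<exists>\<gamma>. \<forall>b\<in>B. \<gamma> b \<in> K \<and> (\<forall>b'\<in>B. trc (\<gamma> b * b') = (if b = b' then 1 else 0))"
proof -
  define q where "q x b = (SOME r. trc (x * b) = of_rat r)" for x b
  have q: "trc (x * b) = of_rat (q x b)" if "x \<in> K" "b \<in> B" for x b
    unfolding q_def by (rule someI_ex) (rule trc_rat[OF K_ops(3)[OF that(1) B_K[OF that(2)]]])
  \<comment> \<open>This is the Gram matrix of the trace form in the basis \<open>B\<close>. A
    preimage of a basis vector \<open>c\<close> has trace 1 against \<open>c\<close> and 0 against
    the rest of \<open>B\<close>.\<close>
  define T where "T x = (\<Sum>b\<in>B. of_rat (q x b) * b)" for x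
  have Tlin: "T (\<Sum>b\<in>B. of_rat (u b) * b) = (\<Sum>b\<in>B. of_rat (u b) * T b)" for u
  proof -
    have m: "of_rat (q (\<Sum>b\<in>B. of_rat (u b) * b) c) = (\<Sum>b\<in>B. of_rat (u b) * (of_rat (q b c) :: 'a))" if c: "c \<in> B" for c
    proof -
      have mem: "(\<Sum>b\<in>B. of_rat (u b) * b) \<in> K" by (intro subfield_sum[OF subfield]) (auto intro: K_ops B_K)
      have "of_rat (q (\<Sum>b\<in>B. of_rat (u b) * b) c) = trc ((\<Sum>b\<in>B. of_rat (u b) * b) * c)"
        using q[OF mem c] by simp
      also have "\<dots> = trc (\<Sum>b\<in>B. of_rat (u b) * (b * c))" by (simp add: sum_distrib_right mult.assoc)
      also have "\<dots> = (\<Sum>b\<in>B. trc (of_rat (u b) * (b * c)))"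
        using c by (intro trc_sum) (auto intro: K_ops B_K)
      also have "\<dots> = (\<Sum>b\<in>B. of_rat (u b) * trc (b * c))"
        using c by (intro sum.cong refl trc_scale) (auto intro: K_ops B_K)
      also have "\<dots> = (\<Sum>b\<in>B. of_rat (u b) * of_rat (q b c))"
        using c q B_K by (intro sum.cong) auto
      finally show ?thesis .
    qed
    have "T (\<Sum>b\<in>B. of_rat (u b) * b) = (\<Sum>c\<in>B. (\<Sum>b\<in>B. of_rat (u b) * of_rat (q b c)) * c)"
      unfolding T_def by (intro sum.cong) (auto simp: m)
    also have "\<dots> = (\<Sum>c\<in>B. \<Sum>b\<in>B. of_rat (u b) * (of_rat (q b c) * c))"
      by (simp add: sum_distrib_right mult.assoc)
    also have "\<dots> = (\<Sum>b\<in>B. \<Sum>c\<in>B. of_rat (u b) * (of_rat (q b c) * c))" by (rule sum.swap)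
    finally show ?thesis by (simp add: T_def sum_distrib_left)
  qed
  have Tinj: "x = 0" if x: "x \<in> K" "T x = 0" for x
  proof (rule trace_nondegenerate[OF x(1)])
    fix b assume b: "b \<in> B"
    have "q x b = 0"
      using rv.independentD[OF indep_B finite_B subset_refl, of "q x"] x(2) b by (simp add: T_def)
    then show "trc (x * b) = 0" using q[OF x(1) b] by simp
  qed
  have TK: "T x \<in> K" if "x \<in> K" for x
    unfolding T_def by (intro subfield_sum[OF subfield]) (auto intro: K_ops B_K)
  have lc: "(\<Sum>b\<in>B. of_rat (u b) * b) \<in> K" for u
    by (intro subfield_sum[OF subfield]) (auto intro: K_ops B_K)
  have Tzero: "u b = 0" if "(\<Sum>b\<in>B. of_rat (u b) * T b) = 0" "b \<in> B" for u b
  proof -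
    have "(\<Sum>b\<in>B. of_rat (u b) * b) = 0" using Tinj[OF lc] that Tlin by simp
    then show ?thesis using rv.independentD[OF indep_B finite_B subset_refl, of u] that by blast
  qed
  have injT: "inj_on T B"
  proof (rule inj_onI, rule ccontr)
    fix b c assume bc: "b \<in> B" "c \<in> B" "T b = T c" "b \<noteq> c"
    define u :: "'a \<Rightarrow> rat" where "u = (\<lambda>x. (if x = b then 1 else 0) - (if x = c then 1 else 0))"
    have "(\<Sum>x\<in>B. of_rat (u x) * T x) = (\<Sum>x\<in>B. (if x = b then T x else 0) - (if x = c then T x else 0))"
      by (intro sum.cong) (auto simp: u_def)
    also have "\<dots> = 0" using bc finite_B by (simp add: sum_subtractf)
    finally have "u b = 0" using Tzero bc by blast
    then show False using bc by (simp add: u_def)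
  qed
  have indT: "rv.independent (T ` B)"
  proof (rule rv.independent_if_scalars_zero)
    fix g x assume g: "(\<Sum>x\<in>T ` B. of_rat (g x) * x) = 0" "x \<in> T ` B"
    then have "(\<Sum>b\<in>B. of_rat (g (T b)) * T b) = 0" by (simp add: sum.reindex[OF injT])
    then show "g x = 0" using Tzero[of "\<lambda>b. g (T b)"] g(2) by auto
  qed (simp add: finite_B)
  have span: "c \<in> rv.span (T ` B)" if c: "c \<in> B" for c
  proof (rule ccontr)
    assume n: "c \<notin> rv.span (T ` B)"
    \<comment> \<open>Otherwise the span of \<open>B\<close> would contain \<open>card B + 1\<close>
      independent vectors.\<close>
    then have i: "rv.independent (insert c (T ` B))" using indT by (rule rv.independent_insertI)
    have "insert c (T ` B) \<subseteq> rv.span B" using span_B c TK B_K by auto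
    then have "card (insert c (T ` B)) \<le> card B" using rv.independent_span_bound[OF finite_B i] by blast
    moreover have "c \<notin> T ` B" using n rv.span_base by blast
    ultimately show False using finite_B card_image[OF injT] by simp
  qed
  have "\<exists>x\<in>K. T x = c" if c: "c \<in> B" for c
  proof -
    have "c \<in> range (\<lambda>u. \<Sum>v\<in>T ` B. of_rat (u v) * v)"
      using span[OF c] rv.span_finite[of "T ` B"] finite_B by auto
    then obtain u where "c = (\<Sum>v\<in>T ` B. of_rat (u v) * v)" by blast
    also have "\<dots> = T (\<Sum>b\<in>B. of_rat (u (T b)) * b)" unfolding Tlin by (simp add: sum.reindex[OF injT])
    finally have "c = T (\<Sum>b\<in>B. of_rat (u (T b)) * b)" .
    then show ?thesis by (intro bexI[OF _ lc]) (erule sym)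
  qed
  then obtain \<gamma> where g: "\<And>c. c \<in> B \<Longrightarrow> \<gamma> c \<in> K \<and> T (\<gamma> c) = c" by metis
  have "trc (\<gamma> b * b') = (if b = b' then 1 else 0)" if b: "b \<in> B" "b' \<in> B" for b b'
  proof -
    have "(\<Sum>x\<in>B. of_rat (if x = b then 1 else 0) * x) = (\<Sum>x\<in>B. if x = b then x else 0)"
      by (intro sum.cong) auto
    also have "\<dots> = T (\<gamma> b)" using b g finite_B by simp
    finally have "q (\<gamma> b) b' = co (\<Sum>x\<in>B. of_rat (if x = b then 1 else 0) * x) b'"
      using co_unique[OF b(2), of "q (\<gamma> b)"] by (simp add: T_def)
    also have "\<dots> = (if b' = b then 1 else 0)" by (rule co_unique[OF b(2)])
    finally show ?thesis using q[of "\<gamma> b" b'] g b by auto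
  qed
  then show ?thesis using g by blast
qed

text \<open>The coordinates of \<open>x\<close> in the dual basis are its traces against
  \<open>B\<close>. If they are integers, a common denominator of the dual basis itself clears the
  denominators of \<open>x\<close>.\<close>

lemma trace_denominator:
  "\<exists>d::int. d > 0 \<and> (\<forall>x\<in>K. (\<forall>b\<in>B. \<exists>k::int. trc (x * b) = of_int k)
      \<longrightarrow> (\<exists>m::'a\<Rightarrow>int. of_int d * x = (\<Sum>b\<in>B. of_int (m b) * b)))"
proof -
  obtain \<gamma> where g: "\<And>b. b \<in> B \<Longrightarrow> \<gamma> b \<in> K"
    and gt: "\<And>b b'. b \<in> B \<Longrightarrow> b' \<in> B \<Longrightarrow> trc (\<gamma> b * b') = (if b = b' then 1 else 0)"
    using dual_basis by metis
  obtain d :: int where d: "d > 0"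
    and dq: "\<forall>q\<in>(\<lambda>(b,c). co (\<gamma> b) c) ` (B \<times> B). \<exists>k::int. of_int d * q = of_int k"
    using common_denominator[of "(\<lambda>(b,c). co (\<gamma> b) c) ` (B \<times> B)"] finite_B by auto
  have "\<forall>b\<in>B. \<forall>c\<in>B. \<exists>k::int. of_int d * co (\<gamma> b) c = of_int k" using dq by auto
  then obtain e where e: "\<And>b c. b \<in> B \<Longrightarrow> c \<in> B \<Longrightarrow> of_int d * co (\<gamma> b) c = of_int (e b c)" by metis
  have "\<exists>m::'a\<Rightarrow>int. of_int d * x = (\<Sum>b\<in>B. of_int (m b) * b)"
    if x: "x \<in> K" and t: "\<forall>b\<in>B. \<exists>k::int. trc (x * b) = of_int k" for x
  proof -
    from t obtain k where k: "\<And>b. b \<in> B \<Longrightarrow> trc (x * b) = of_int (k b)" by metis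
    \<comment> \<open>The difference of \<open>x\<close> and its expansion in the dual basis has
      zero trace against all of \<open>B\<close>.\<close>
    define y where "y = x - (\<Sum>b\<in>B. of_int (k b) * \<gamma> b)"
    have sK: "(\<Sum>b\<in>B. of_int (k b) * \<gamma> b) \<in> K"
      by (intro subfield_sum[OF subfield]) (auto intro: K_ops K_of_int g)
    then have yK: "y \<in> K" using x by (simp add: y_def K_ops)
    have ty: "trc (y * c) = 0" if c: "c \<in> B" for c
    proof -
      have "(\<Sum>b\<in>B. of_int (k b) * \<gamma> b) * c = (\<Sum>b\<in>B. of_rat (of_int (k b)) * (\<gamma> b * c))"
        by (simp add: sum_distrib_right mult.assoc)
      then have "trc ((\<Sum>b\<in>B. of_int (k b) * \<gamma> b) * c) = trc (\<Sum>b\<in>B. of_rat (of_int (k b)) * (\<gamma> b * c))"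
        by (simp only:)
      also have "\<dots> = (\<Sum>b\<in>B. trc (of_rat (of_int (k b)) * (\<gamma> b * c)))"
        by (intro trc_sum K_ops(3) K_ops(7) g B_K c)
      also have "\<dots> = (\<Sum>b\<in>B. of_rat (of_int (k b)) * trc (\<gamma> b * c))"
        by (intro sum.cong refl trc_scale K_ops(3) g B_K c)
      also have "\<dots> = (\<Sum>b\<in>B. if b = c then of_int (k b) else 0)"
        by (intro sum.cong) (auto simp: gt c)
      also have "\<dots> = of_int (k c)" using c finite_B by simp
      finally have 1: "trc ((\<Sum>b\<in>B. of_int (k b) * \<gamma> b) * c) = of_int (k c)" .
      have "y * c = x * c - (\<Sum>b\<in>B. of_int (k b) * \<gamma> b) * c" by (simp add: y_def algebra_simps)
      then have "trc (y * c) = trc (x * c) - trc ((\<Sum>b\<in>B. of_int (k b) * \<gamma> b) * c)"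
        using trc_diff[OF K_ops(3)[OF x B_K[OF c]] K_ops(3)[OF sK B_K[OF c]]] by (simp only:)
      also have "\<dots> = 0" using 1 k[OF c] by simp
      finally show ?thesis .
    qed
    have "y = 0" by (rule trace_nondegenerate[OF yK ty])
    then have "x = (\<Sum>b\<in>B. of_int (k b) * \<gamma> b)" by (simp add: y_def)
    also have "\<dots> = (\<Sum>b\<in>B. of_int (k b) * (\<Sum>c\<in>B. of_rat (co (\<gamma> b) c) * c))"
      by (intro sum.cong refl) (simp add: co_sum g)
    finally have "of_int d * x = (\<Sum>b\<in>B. of_int (k b) * (\<Sum>c\<in>B. of_int d * of_rat (co (\<gamma> b) c) * c))"
      by (simp add: sum_distrib_left algebra_simps)
    also have "\<dots> = (\<Sum>b\<in>B. of_int (k b) * (\<Sum>c\<in>B. of_int (e b c) * c))"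
    proof (intro sum.cong refl arg_cong2[where f="(*)"])
      fix b c assume "b \<in> B" "c \<in> B"
      then have "(of_rat (of_int d * co (\<gamma> b) c) :: 'a) = of_rat (of_int (e b c))" by (simp only: e)
      then show "of_int d * of_rat (co (\<gamma> b) c) = (of_int (e b c) :: 'a)" by (simp add: of_rat_mult)
    qed
    also have "\<dots> = (\<Sum>b\<in>B. \<Sum>c\<in>B. of_int (k b * e b c) * c)" by (simp add: sum_distrib_left mult.assoc)
    also have "\<dots> = (\<Sum>c\<in>B. \<Sum>b\<in>B. of_int (k b * e b c) * c)" by (rule sum.swap)
    also have "\<dots> = (\<Sum>c\<in>B. of_int (\<Sum>b\<in>B. k b * e b c) * c)" by (simp add: sum_distrib_right)
    finally show ?thesis by (rule exI[of _ "\<lambda>c. \<Sum>b\<in>B. k b * e b c"])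
  qed
  then show ?thesis using d by blast
qed

text \<open>A substitute for the discriminant of \<open>B\<close>: a positive integer that moves the
  trace dual of the lattice spanned by \<open>B\<close> into that lattice. In particular it moves
  every integral element there.\<close>

definition dlt :: int where "dlt = (SOME d::int. d > 0 \<and> (\<forall>x\<in>K. (\<forall>b\<in>B. \<exists>k::int. trc (x * b) = of_int k)
      \<longrightarrow> (\<exists>m::'a\<Rightarrow>int. of_int d * x = (\<Sum>b\<in>B. of_int (m b) * b))))"

lemma dlt_pos: "dlt > 0"
  and dlt: "x \<in> K \<Longrightarrow> (\<And>b. b \<in> B \<Longrightarrow> \<exists>k::int. trc (x * b) = of_int k)
    \<Longrightarrow> \<exists>m::'a\<Rightarrow>int. of_int dlt * x = (\<Sum>b\<in>B. of_int (m b) * b)"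
  using someI_ex[OF trace_denominator] unfolding dlt_def by blast+

lemma dlt_OK: "x \<in> OK \<Longrightarrow> \<exists>m::'a\<Rightarrow>int. of_int dlt * x = (\<Sum>b\<in>B. of_int (m b) * b)"
  by (rule dlt[OF OK_K trc_int[OF OK_mult[OF _ B_OK]]])


section \<open>Ideals and primes of the ring of integers\<close>

definition idl :: "'a set \<Rightarrow> bool" where
  "idl I \<longleftrightarrow> I \<subseteq> OK \<and> 0 \<in> I \<and> (\<forall>x\<in>I. \<forall>y\<in>I. x + y \<in> I) \<and> (\<forall>x\<in>OK. \<forall>y\<in>I. x * y \<in> I)"

text \<open>Maximality is stated in the form in which it is used: everything outside
  \<open>M\<close> is invertible modulo \<open>M\<close>.\<close>

definition maxi :: "'a set \<Rightarrow> bool" where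
  "maxi M \<longleftrightarrow> idl M \<and> 1 \<notin> M \<and> (\<forall>x\<in>OK. x \<notin> M \<longrightarrow> (\<exists>z\<in>OK. 1 - z * x \<in> M))"

lemma idlD:
  assumes "idl I"
  shows "x \<in> I \<Longrightarrow> x \<in> OK" "0 \<in> I" "x \<in> I \<Longrightarrow> y \<in> I \<Longrightarrow> x + y \<in> I"
    "x \<in> OK \<Longrightarrow> y \<in> I \<Longrightarrow> x * y \<in> I" "y \<in> OK \<Longrightarrow> x \<in> I \<Longrightarrow> x * y \<in> I"
    "x \<in> I \<Longrightarrow> y \<in> I \<Longrightarrow> x - y \<in> I"
proof -
  show "x \<in> I \<Longrightarrow> x \<in> OK" "0 \<in> I" "x \<in> I \<Longrightarrow> y \<in> I \<Longrightarrow> x + y \<in> I" "x \<in> OK \<Longrightarrow> y \<in> I \<Longrightarrow> x * y \<in> I"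
    using assms by (auto simp: idl_def)
  show "y \<in> OK \<Longrightarrow> x \<in> I \<Longrightarrow> x * y \<in> I" using assms by (metis idl_def mult.commute)
  show "x - y \<in> I" if "x \<in> I" "y \<in> I"
  proof -
    have "of_int (-1) * y \<in> I" using assms that OK_of_int unfolding idl_def by blast
    then have "x + of_int (-1) * y \<in> I" using assms that unfolding idl_def by blast
    then show ?thesis by simp
  qed
qed

lemma idl_sum: "idl I \<Longrightarrow> (\<And>i. i \<in> A \<Longrightarrow> f i \<in> I) \<Longrightarrow> sum f A \<in> I"
  by (induction A rule: infinite_finite_induct) (auto simp: idlD)

text \<open>Zorn's lemma for the ideals that contain \<open>I\<close> and avoid 1. If some
  \<open>x\<close> outside a maximal one were not invertible modulo it, adjoining \<open>x\<close>
  would give a larger such ideal.\<close>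

lemma exists_maxi:
  assumes I: "idl I" "1 \<notin> I"
  shows "\<exists>M. maxi M \<and> I \<subseteq> M"
proof -
  define A where "A = {J. idl J \<and> I \<subseteq> J \<and> 1 \<notin> J}"
  have "\<exists>M\<in>A. \<forall>X\<in>A. M \<subseteq> X \<longrightarrow> X = M"
  proof (rule subset_Zorn_nonempty)
    show "A \<noteq> {}" using I by (auto simp: A_def)
    fix C assume C: "C \<noteq> {}" "subset.chain A C"
    have CA: "idl J \<and> I \<subseteq> J \<and> 1 \<notin> J" if "J \<in> C" for J
      using C that unfolding A_def subset_chain_def by blast
    have tot: "J \<subseteq> J' \<or> J' \<subseteq> J" if "J \<in> C" "J' \<in> C" for J J'
      using C that by (auto simp: subset_chain_def)
    have "idl (\<Union>C)"
      unfolding idl_def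
    proof (intro conjI ballI)
      show "\<Union>C \<subseteq> OK" using CA idlD(1) by blast
      show "0 \<in> \<Union>C" using C(1) CA idlD(2) by blast
      fix x y assume xy: "x \<in> \<Union>C" "y \<in> \<Union>C"
      then obtain J J' where J: "J \<in> C" "x \<in> J" "J' \<in> C" "y \<in> J'" by blast
      then obtain H where "H \<in> C" "x \<in> H" "y \<in> H" using tot[OF J(1) J(3)] by blast
      then show "x + y \<in> \<Union>C" using CA[of H] idlD(3)[of H x y] by blast
    next
      fix x y assume "x \<in> OK" and y: "y \<in> \<Union>C"
      then obtain J where "J \<in> C" "y \<in> J" by blast
      then show "x * y \<in> \<Union>C" using CA[of J] idlD(4)[of J x y] \<open>x \<in> OK\<close> by blast
    qed
    then show "\<Union>C \<in> A" using C(1) CA unfolding A_def by blast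
  qed
  then obtain M where MA: "M \<in> A" and mx: "\<forall>X\<in>A. M \<subseteq> X \<longrightarrow> X = M" by blast
  have M: "idl M" "I \<subseteq> M" "1 \<notin> M" using MA by (auto simp: A_def)
  have max: "X = M" if "idl X" "I \<subseteq> X" "1 \<notin> X" "M \<subseteq> X" for X
    using mx that by (simp add: A_def)
  have "\<exists>z\<in>OK. 1 - z * x \<in> M" if x: "x \<in> OK" "x \<notin> M" for x
  proof (rule ccontr)
    assume n: "\<not> (\<exists>z\<in>OK. 1 - z * x \<in> M)"
    define X where "X = {m + z * x | m z. m \<in> M \<and> z \<in> OK}"
    have iX: "idl X" unfolding idl_def
    proof (intro conjI ballI)
      show "X \<subseteq> OK" unfolding X_def using OK_add[OF idlD(1)[OF M(1)] OK_mult[OF _ x(1)]] by blast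
      have "0 = 0 + 0 * x \<and> 0 \<in> M \<and> 0 \<in> OK" using idlD(2)[OF M(1)] OK_0 by simp
      then show "0 \<in> X" unfolding X_def by blast
      fix u v assume "u \<in> X" "v \<in> X"
      then obtain m z m' z' where "u = m + z * x" "m \<in> M" "z \<in> OK" "v = m' + z' * x" "m' \<in> M" "z' \<in> OK"
        unfolding X_def by blast
      moreover from this have "u + v = (m + m') + (z + z') * x" by (simp add: algebra_simps)
      ultimately show "u + v \<in> X" unfolding X_def using idlD(3)[OF M(1)] OK_add by blast
    next
      fix w u assume w: "w \<in> OK" "u \<in> X"
      then obtain m z where "u = m + z * x" "m \<in> M" "z \<in> OK" unfolding X_def by blast
      moreover from this have "w * u = w * m + (w * z) * x" by (simp add: algebra_simps)
      ultimately show "w * u \<in> X" unfolding X_def using idlD(4)[OF M(1)] OK_mult w by blast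
    qed
    have MX: "M \<subseteq> X"
    proof
      fix m assume "m \<in> M"
      then have "m = m + 0 * x \<and> m \<in> M \<and> 0 \<in> OK" using OK_0 by simp
      then show "m \<in> X" unfolding X_def by blast
    qed
    have "x = 0 + 1 * x \<and> 0 \<in> M \<and> 1 \<in> OK" using idlD(2)[OF M(1)] OK_1 by simp
    then have xX: "x \<in> X" unfolding X_def by blast
    have "1 \<notin> X"
    proof
      assume "1 \<in> X"
      then obtain m z where mz: "1 = m + z * x" "m \<in> M" "z \<in> OK" unfolding X_def by blast
      then have "1 - z * x = m" by (simp add: algebra_simps)
      then show False using n mz by auto
    qed
    then have "X = M" using max[OF iX] MX M(2) by blast
    then show False using xX x by blast
  qed
  then show ?thesis using M by (auto simp: maxi_def)
qed

lemma maxi_idl: "maxi M \<Longrightarrow> idl M" by (simp add: maxi_def)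

lemma maxi_1: "maxi M \<Longrightarrow> 1 \<notin> M" by (simp add: maxi_def)

lemma maxi_prime:
  assumes M: "maxi M" and x: "x \<in> OK" and y: "y \<in> OK" and xy: "x * y \<in> M"
  shows "x \<in> M \<or> y \<in> M"
proof (rule ccontr)
  assume n: "\<not> (x \<in> M \<or> y \<in> M)"
  then obtain z where z: "z \<in> OK" "1 - z * x \<in> M" using M x by (auto simp: maxi_def)
  have "(1 - z * x) * y \<in> M" "z * (x * y) \<in> M"
    using idlD(5)[OF maxi_idl[OF M] y z(2)] idlD(4)[OF maxi_idl[OF M] z(1) xy] by auto
  then have "(1 - z * x) * y + z * (x * y) \<in> M" using idlD(3)[OF maxi_idl[OF M]] by blast
  then show False using n by (simp add: algebra_simps)
qed

lemma maxi_mult: "maxi M \<Longrightarrow> x \<in> OK \<Longrightarrow> y \<in> OK \<Longrightarrow> x \<notin> M \<Longrightarrow> y \<notin> M \<Longrightarrow> x * y \<notin> M"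
  using maxi_prime by blast

lemma maxi_prod:
  assumes M: "maxi M" and "finite A" and "\<And>i. i \<in> A \<Longrightarrow> f i \<in> OK" "\<And>i. i \<in> A \<Longrightarrow> f i \<notin> M"
  shows "prod f A \<notin> M"
  using assms(2-)
proof (induction A rule: finite_induct)
  case (insert a A)
  have "f a * prod f A \<notin> M" by (rule maxi_mult[OF M _ OK_prod]) (use insert in auto)
  then show ?case using insert by simp
qed (simp add: maxi_1[OF M])

lemma idl_prod_mem:
  assumes M: "idl M" and "finite A" "\<And>i. i \<in> A \<Longrightarrow> f i \<in> OK" "i \<in> A" "f i \<in> M"
  shows "prod f A \<in> M"
proof -
  have "prod f A = f i * prod f (A - {i})" using assms by (simp add: prod.remove)
  moreover have "prod f (A - {i}) \<in> OK" using assms by (intro OK_prod) auto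
  ultimately show ?thesis using idlD(5)[OF M] assms by simp
qed

lemma maxi_int_iff:
  assumes M: "maxi M" and p: "prime p" "of_nat p \<in> M"
  shows "of_int k \<in> M \<longleftrightarrow> int p dvd k"
proof
  assume "int p dvd k"
  then obtain c where "k = int p * c" by blast
  then have "of_int k = of_nat p * (of_int c :: 'a)" by simp
  then show "of_int k \<in> M" using idlD(5)[OF maxi_idl[OF M] OK_of_int p(2)] by simp
next
  assume k: "of_int k \<in> M"
  show "int p dvd k"
  proof (rule ccontr)
    assume "\<not> int p dvd k"
    then have "coprime (int p) k" using p by (simp add: prime_imp_coprime)
    then obtain u v where uv: "u * int p + v * k = 1" by (metis bezout_int coprime_iff_gcd_eq_1)
    have "of_int u * of_nat p \<in> M" "of_int v * of_int k \<in> M"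
      using idlD(4)[OF maxi_idl[OF M] OK_of_int] p k by auto
    then have "of_int u * of_nat p + of_int v * of_int k \<in> M" using idlD(3)[OF maxi_idl[OF M]] by blast
    moreover have "of_int u * of_nat p + of_int v * of_int k = (of_int (u * int p + v * k) :: 'a)" by simp
    ultimately show False using uv maxi_1[OF M] by simp
  qed
qed

text \<open>The ideal generated by \<open>p\<close> is proper, since 1/p is rational but not an
  integer and so is not integral.\<close>

lemma exists_maxi_prime:
  assumes p: "prime p"
  shows "\<exists>M. maxi M \<and> of_nat p \<in> M"
proof -
  define I where "I = (\<lambda>x. of_nat p * x) ` OK"
  have "idl I" unfolding idl_def
  proof (intro conjI ballI)
    show "I \<subseteq> OK" by (auto simp: I_def OK_intros)
    show "0 \<in> I" using OK_0 by (auto simp: I_def)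
    fix u v assume "u \<in> I" "v \<in> I"
    then show "u + v \<in> I" by (auto simp: I_def ring_distribs[symmetric] OK_add)
  next
    fix w u assume "w \<in> OK" "u \<in> I"
    then show "w * u \<in> I" by (auto simp: I_def mult.left_commute[of w] OK_mult)
  qed
  moreover have "1 \<notin> I"
  proof
    assume "1 \<in> I"
    then obtain x where x: "x \<in> OK" "1 = of_nat p * x" by (auto simp: I_def)
    have p1: "p > 1" using p prime_gt_1_nat by blast
    have "x = of_rat (1 / of_nat p)" using x(2) p1 by (simp add: of_rat_divide field_simps)
    then obtain k :: int where "x = of_int k" using algebraic_int_of_ratD[of "1 / of_nat p"] x by (auto simp: OK_iff)
    then have "(of_int (int p * k) :: 'a) = of_int 1" using x by simp
    then have "int p * k = 1" by (simp only: of_int_eq_iff)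
    then show False using p1 by (auto simp: zmult_eq_1_iff)
  qed
  ultimately obtain M where "maxi M" "I \<subseteq> M" using exists_maxi by blast
  moreover have "of_nat p \<in> I" using OK_1 by (auto simp: I_def intro: image_eqI[of _ _ 1])
  ultimately show ?thesis by blast
qed

text \<open>One prime over \<open>p\<close> is chosen arbitrarily. The others are reached through
  its conjugates, by testing \<open>\<sigma> x\<close> instead of \<open>x\<close>.\<close>

definition prm :: "nat \<Rightarrow> 'a set" where "prm p = (SOME M. maxi M \<and> of_nat p \<in> M)"

lemma prm: "prime p \<Longrightarrow> maxi (prm p)" "prime p \<Longrightarrow> of_nat p \<in> prm p"
  unfolding prm_def using someI_ex[OF exists_maxi_prime] by blast+

lemma prm_int_iff: "prime p \<Longrightarrow> of_int k \<in> prm p \<longleftrightarrow> int p dvd k"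
  using maxi_int_iff prm by blast

lemma prm_OK: "prime p \<Longrightarrow> x \<in> prm p \<Longrightarrow> x \<in> OK"
  using prm idlD(1) maxi_idl by blast

section \<open>Valuations at primes not dividing \<open>dlt\<close>\<close>

text \<open>Away from the divisors of \<open>dlt\<close> the ring \<open>OK / p OK\<close> is reduced, which is the only consequence
  of unramifiedness that is needed.\<close>

definition good :: "nat \<Rightarrow> bool" where "good p \<longleftrightarrow> prime p \<and> \<not> int p dvd dlt"

lemma good_prime: "good p \<Longrightarrow> prime p" by (simp add: good_def)

text \<open>The traces of x b lie in \<open>prm p\<close> and are integers, so they are divisible by
  \<open>p\<close>. Hence x/p has integral traces against \<open>B\<close>, so \<open>dlt\<close>
  times x/p is integral, and \<open>dlt\<close> is invertible modulo \<open>p\<close>.\<close>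

lemma good_reduced:
  assumes p: "good p" and x: "x \<in> OK" and all: "\<And>\<sigma>. \<sigma> \<in> G \<Longrightarrow> \<sigma> x \<in> prm p"
  shows "\<exists>y\<in>OK. x = of_nat p * y"
proof -
  have pp: "prime p" and p0: "(of_nat p :: 'a) \<noteq> 0" using p good_prime prime_gt_0_nat by force+
  note I = maxi_idl[OF prm(1)[OF pp]]
  define z where "z = x / of_nat p"
  have zr: "z = of_rat (1 / of_nat p) * x" by (simp add: z_def of_rat_divide)
  have zK: "z \<in> K" unfolding zr using K_ops(3)[OF K_ops(7) OK_K[OF x]] .
  have "\<exists>k::int. trc (z * b) = of_int k" if b: "b \<in> B" for b
  proof -
    obtain k :: int where k: "trc (x * b) = of_int k" using trc_int[OF OK_mult[OF x B_OK[OF b]]] by blast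
    have "\<sigma> (x * b) \<in> prm p" if s: "\<sigma> \<in> G" for \<sigma>
      unfolding G_mult[OF s OK_K[OF x] B_K[OF b]]
      by (rule idlD(5)[OF I G_OK[OF s B_OK[OF b]] all[OF s]])
    then have "trc (x * b) \<in> prm p" unfolding trc_def by (intro idl_sum[OF I])
    then have "int p dvd k" using k prm_int_iff[OF pp] by simp
    then obtain c where c: "k = int p * c" by blast
    have "z * b = of_rat (1 / of_nat p) * (x * b)" by (simp add: zr)
    then have "trc (z * b) = trc (of_rat (1 / of_nat p) * (x * b))" by (simp only:)
    also have "\<dots> = of_rat (1 / of_nat p) * trc (x * b)"
      by (rule trc_scale[OF K_ops(3)[OF OK_K[OF x] B_K[OF b]]])
    also have "\<dots> = of_int c" using p0 by (simp add: k c of_rat_divide)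
    finally show ?thesis by blast
  qed
  then obtain m :: "'a \<Rightarrow> int" where m: "of_int dlt * z = (\<Sum>b\<in>B. of_int (m b) * b)" using dlt[OF zK] by blast
  define w where "w = (\<Sum>b\<in>B. of_int (m b) * b)"
  have w: "w \<in> OK" unfolding w_def by (intro OK_sum OK_mult OK_of_int B_OK)
  have dx: "of_int dlt * x = of_nat p * w" using m p0 by (simp add: w_def z_def field_simps)
  have "coprime (int p) dlt" using p by (simp add: good_def prime_imp_coprime)
  then obtain u v where uv: "u * int p + v * dlt = 1" by (metis bezout_int coprime_iff_gcd_eq_1)
  have "x = of_int (u * int p + v * dlt) * x" using uv by simp
  also have "\<dots> = of_nat p * (of_int u * x) + of_int v * (of_int dlt * x)" by (simp add: algebra_simps)
  also have "\<dots> = of_nat p * (of_int u * x + of_int v * w)" unfolding dx by (simp add: algebra_simps)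
  finally have "x = of_nat p * (of_int u * x + of_int v * w)" .
  then show ?thesis using x w by (intro bexI[of _ "of_int u * x + of_int v * w"]) (auto intro: OK_intros)
qed

text \<open>The element \<open>u\<close> avoids \<open>prm p\<close> but is annihilating for every
  other conjugate prime. Then all conjugates of u b lie in \<open>prm p\<close>, and reducedness
  makes u b divisible by \<open>p\<close>.\<close>

lemma good_uniformizer:
  assumes p: "good p"
  shows "\<exists>u\<in>OK. u \<notin> prm p \<and> (\<forall>b\<in>prm p. \<exists>y\<in>OK. u * b = of_nat p * y)"
proof -
  have pp: "prime p" using p good_prime by blast
  note M = prm(1)[OF pp] and I = maxi_idl[OF prm(1)[OF pp]]
  \<comment> \<open>These are the automorphisms that move \<open>prm p\<close>. For the others
    \<open>\<sigma> b\<close> lies in \<open>prm p\<close> already, so only those in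
    \<open>H\<close> have to be handled by \<open>u\<close>.\<close>
  define H where "H = {\<sigma>\<in>G. \<not> \<sigma> ` prm p \<subseteq> prm p}"
  have "\<exists>t\<in>OK. t \<notin> prm p \<and> \<sigma> t \<in> prm p" if s: "\<sigma> \<in> H" for \<sigma>
  proof -
    from s have sG: "\<sigma> \<in> G" and "\<not> \<sigma> ` prm p \<subseteq> prm p" by (auto simp: H_def)
    then obtain b where b: "b \<in> prm p" "\<sigma> b \<notin> prm p" by blast
    obtain \<tau> where t: "\<tau> \<in> G" "\<And>x. \<tau> (\<sigma> x) = x" "\<And>x. \<sigma> (\<tau> x) = x" using G_inverse[OF sG] by blast
    have bO: "b \<in> OK" using prm_OK[OF pp b(1)] .
    then have sb: "\<sigma> b \<in> OK" by (rule G_OK[OF sG])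
    then obtain z where z: "z \<in> OK" "1 - z * \<sigma> b \<in> prm p" using M b(2) by (auto simp: maxi_def)
    \<comment> \<open>An inverse of \<open>\<sigma> b\<close> modulo \<open>prm p\<close>, pulled
      back by \<tau>: as \<open>b\<close> lies in \<open>prm p\<close>, \<open>t\<close> is
      congruent to 1 there, while \<open>\<sigma> t\<close> lies in \<open>prm p\<close>.\<close>
    define t where "t = \<tau> (1 - z * \<sigma> b)"
    have e: "t = 1 - \<tau> z * b"
      using G_diff[OF t(1) K_ops(6) K_ops(3)[OF OK_K[OF z(1)] OK_K[OF sb]]]
        G_mult[OF t(1) OK_K[OF z(1)] OK_K[OF sb]] G_1[OF t(1)] t(2) by (simp add: t_def)
    have zb: "\<tau> z * b \<in> prm p" by (rule idlD(4)[OF I G_OK[OF t(1) z(1)] b(1)])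
    have "t \<notin> prm p"
    proof
      assume "t \<in> prm p"
      then have "t + \<tau> z * b \<in> prm p" using zb idlD(3)[OF I] by blast
      then show False using maxi_1[OF M] by (simp add: e)
    qed
    moreover have "\<sigma> t \<in> prm p" using z(2) t(3) by (simp add: t_def)
    moreover have "t \<in> OK" unfolding t_def
      by (rule G_OK[OF t(1)]) (intro OK_diff OK_1 OK_mult z(1) sb)
    ultimately show ?thesis by blast
  qed
  then obtain t where t: "\<And>\<sigma>. \<sigma> \<in> H \<Longrightarrow> t \<sigma> \<in> OK \<and> t \<sigma> \<notin> prm p \<and> \<sigma> (t \<sigma>) \<in> prm p" by metis
  have fH: "finite H" using finite_G by (simp add: H_def)
  define u where "u = (\<Prod>\<sigma>\<in>H. t \<sigma>)"
  have u: "u \<in> OK" unfolding u_def using t by (intro OK_prod) blast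
  have un: "u \<notin> prm p" unfolding u_def using t fH by (intro maxi_prod[OF M]) blast+
  have "\<exists>y\<in>OK. u * b = of_nat p * y" if b: "b \<in> prm p" for b
  proof (rule good_reduced[OF p])
    have bO: "b \<in> OK" using prm_OK[OF pp b] .
    show "u * b \<in> OK" using u bO OK_mult by blast
    fix \<sigma> assume s: "\<sigma> \<in> G"
    have e: "\<sigma> (u * b) = \<sigma> u * \<sigma> b" by (rule G_mult[OF s OK_K[OF u] OK_K[OF bO]])
    show "\<sigma> (u * b) \<in> prm p"
    proof (cases "\<sigma> \<in> H")
      case False
      then have "\<sigma> b \<in> prm p" using s b by (auto simp: H_def)
      then show ?thesis unfolding e by (rule idlD(4)[OF I G_OK[OF s u]])
    next
      case True
      have "\<sigma> u = (\<Prod>\<tau>\<in>H. \<sigma> (t \<tau>))" unfolding u_def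
        by (rule G_prod[OF s]) (use t OK_K in blast)
      also have "\<dots> \<in> prm p"
        by (rule idl_prod_mem[OF I fH _ True]) (use t True G_OK[OF s] in blast)+
      finally have "\<sigma> u \<in> prm p" .
      then show ?thesis unfolding e by (rule idlD(5)[OF I G_OK[OF s bO]])
    qed
  qed
  then show ?thesis using u un by blast
qed

text \<open>For good \<open>p\<close> the localization of \<open>OK\<close> at \<open>prm p\<close> is a discrete valuation ring with
  uniformizer \<open>p\<close>, so valuations can be read off without ideal factorization.\<close>

definition vrel :: "nat \<Rightarrow> nat \<Rightarrow> 'a \<Rightarrow> bool" where
  "vrel p k x \<longleftrightarrow> (\<exists>w\<in>OK. \<exists>b\<in>OK. w \<notin> prm p \<and> b \<notin> prm p \<and> w * x = of_nat p ^ k * b)"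

lemma vrel_unique:
  assumes pp: "prime p" and "vrel p k x" "vrel p l x"
  shows "k = l"
proof -
  have "\<not> k < l" if kl: "vrel p k x" "vrel p l x" for k l
  proof
    assume lt: "k < l"
    obtain w b where w: "w \<in> OK" "b \<in> OK" "w \<notin> prm p" "b \<notin> prm p" "w * x = of_nat p ^ k * b"
      using kl(1) by (auto simp: vrel_def)
    obtain w' b' where w': "w' \<in> OK" "b' \<in> OK" "w' \<notin> prm p" "b' \<notin> prm p" "w' * x = of_nat p ^ l * b'"
      using kl(2) by (auto simp: vrel_def)
    have p0: "(of_nat p :: 'a) \<noteq> 0" using pp prime_gt_0_nat by force
    have "of_nat p ^ k * (b * w') = w' * (w * x)" using w by (simp add: algebra_simps)
    also have "\<dots> = w * (of_nat p ^ l * b')" using w' by (simp add: mult.left_commute)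
    also have "\<dots> = of_nat p ^ k * (of_nat p * (of_nat p ^ (l - k - 1) * b' * w))"
    proof -
      have "l = k + Suc (l - k - 1)" using lt by simp
      then have "(of_nat p :: 'a) ^ l = of_nat p ^ k * (of_nat p * of_nat p ^ (l - k - 1))"
        by (metis power_Suc power_add)
      then show ?thesis by simp
    qed
    finally have "b * w' = of_nat p * (of_nat p ^ (l - k - 1) * b' * w)" using p0 by simp
    also have "\<dots> \<in> prm p" using w w'
      by (intro idlD(5)[OF maxi_idl[OF prm(1)[OF pp]] _ prm(2)[OF pp]] OK_mult OK_power OK_of_nat)
    finally show False using maxi_mult[OF prm(1)[OF pp]] w w' by blast
  qed
  then show ?thesis using assms by (meson nat_neq_iff)
qed

lemma vrel_of_int:
  assumes pp: "prime p" and "m \<noteq> 0"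
  shows "vrel p (multiplicity (int p) m) (of_int m)"
proof -
  have "\<not> is_unit (int p)" using pp prime_gt_1_nat by force
  then obtain c where c: "m = int p ^ multiplicity (int p) m * c" "\<not> int p dvd c"
    using multiplicity_decompose'[OF assms(2)] by blast
  have "1 * of_int m = of_nat p ^ multiplicity (int p) m * (of_int c :: 'a)"
    using arg_cong[OF c(1), of "of_int :: int \<Rightarrow> 'a"] by simp
  then show ?thesis unfolding vrel_def using c(2) prm_int_iff[OF pp] maxi_1[OF prm(1)[OF pp]] OK_1 OK_of_int by blast
qed

lemma vrel_mult:
  assumes pp: "prime p" and "vrel p k x" "vrel p l y"
  shows "vrel p (k + l) (x * y)"
proof -
  obtain w b where w: "w \<in> OK" "b \<in> OK" "w \<notin> prm p" "b \<notin> prm p" "w * x = of_nat p ^ k * b"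
    using assms(2) by (auto simp: vrel_def)
  obtain w' b' where w': "w' \<in> OK" "b' \<in> OK" "w' \<notin> prm p" "b' \<notin> prm p" "w' * y = of_nat p ^ l * b'"
    using assms(3) by (auto simp: vrel_def)
  have "(w * w') * (x * y) = (w * x) * (w' * y)" by (simp add: algebra_simps)
  also have "\<dots> = of_nat p ^ (k + l) * (b * b')" unfolding w(5) w'(5) by (simp add: power_add algebra_simps)
  finally show ?thesis unfolding vrel_def
    using w w' by (intro bexI[of _ "w * w'"] bexI[of _ "b * b'"] conjI
        maxi_mult[OF prm(1)[OF pp]] OK_mult)
qed

text \<open>Exponents are bounded because \<open>x\<close> divides its nonzero norm, an integer. At
  the largest exponent the cofactor must avoid \<open>prm p\<close>, since otherwise the element
  \<open>u\<close> of \<open>good_uniformizer\<close> would extract one more factor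
  \<open>p\<close>.\<close>

lemma vrel_exists:
  assumes p: "good p" and x: "x \<in> OK" "x \<noteq> 0"
  shows "\<exists>k. vrel p k x"
proof -
  have pp: "prime p" using p good_prime by blast
  note M = prm(1)[OF pp] and I = maxi_idl[OF prm(1)[OF pp]]
  have p0: "(of_nat p :: 'a) \<noteq> 0" using pp prime_gt_0_nat by force
  define Q where "Q k \<longleftrightarrow> (\<exists>w\<in>OK. \<exists>b\<in>OK. w \<notin> prm p \<and> w * x = of_nat p ^ k * b)" for k
  have n0: "nrm x \<noteq> 0" using x nrm_eq_0_iff by blast
  define j where "j = multiplicity (int p) (nrm x)"
  obtain v c where v: "v \<in> OK" "c \<in> OK" "v \<notin> prm p" "c \<notin> prm p" "v * of_int (nrm x) = of_nat p ^ j * c"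
    using vrel_of_int[OF pp n0] by (auto simp: vrel_def j_def)
  obtain y where y: "y \<in> OK" "of_int (nrm x) = x * y" using nrm_dvd[OF x(1)] by blast
  have bound: "k \<le> j" if "Q k" for k
  proof (rule ccontr)
    assume "\<not> k \<le> j"
    then have kj: "k = j + Suc (k - j - 1)" by simp
    obtain w b where w: "w \<in> OK" "b \<in> OK" "w \<notin> prm p" "w * x = of_nat p ^ k * b" using \<open>Q k\<close> by (auto simp: Q_def)
    have pk: "(of_nat p :: 'a) ^ k = of_nat p ^ j * (of_nat p * of_nat p ^ (k - j - 1))"
      using kj by (metis power_Suc power_add)
    have "of_nat p ^ j * (w * c) = w * (v * of_int (nrm x))" using v(5) by (simp add: mult.left_commute)
    also have "\<dots> = (w * x) * (v * y)" using y(2) by (simp add: algebra_simps)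
    also have "\<dots> = of_nat p ^ j * (of_nat p * (of_nat p ^ (k - j - 1) * b * (v * y)))"
      unfolding w(4) pk by (simp add: algebra_simps)
    finally have "w * c = of_nat p * (of_nat p ^ (k - j - 1) * b * (v * y))" using p0 by simp
    also have "\<dots> \<in> prm p"
      by (intro idlD(5)[OF I _ prm(2)[OF pp]] OK_mult OK_power OK_of_nat w v y)
    finally show False using maxi_mult[OF M w(1) v(2) w(3) v(4)] by blast
  qed
  have "1 * x = of_nat p ^ 0 * x" by simp
  then have Q0: "Q 0" unfolding Q_def using OK_1 maxi_1[OF M] x(1) by blast
  define k where "k = (GREATEST k. Q k)"
  have Qk: "Q k" unfolding k_def using GreatestI_nat[of Q 0 j] Q0 bound by blast
  have max: "\<not> Q (Suc k)"
  proof
    assume "Q (Suc k)"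
    then have "Suc k \<le> k" unfolding k_def using Greatest_le_nat[of Q "Suc (GREATEST k. Q k)" j] bound by blast
    then show False by simp
  qed
  obtain w b where w: "w \<in> OK" "b \<in> OK" "w \<notin> prm p" "w * x = of_nat p ^ k * b" using Qk by (auto simp: Q_def)
  have "b \<notin> prm p"
  proof
    assume b: "b \<in> prm p"
    obtain u where u: "u \<in> OK" "u \<notin> prm p" "\<forall>b\<in>prm p. \<exists>y\<in>OK. u * b = of_nat p * y"
      using good_uniformizer[OF p] by blast
    then obtain z where z: "z \<in> OK" "u * b = of_nat p * z" using b by blast
    have "(u * w) * x = of_nat p ^ k * (u * b)" using w(4) by (simp add: algebra_simps)
    then have "(u * w) * x = of_nat p ^ Suc k * z" unfolding z(2) by (simp add: algebra_simps)
    then have "Q (Suc k)" unfolding Q_def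
      using maxi_mult[OF M u(1) w(1) u(2) w(3)] OK_mult[OF u(1) w(1)] z(1) by blast
    then show False using max by blast
  qed
  then show ?thesis unfolding vrel_def using w by blast
qed

definition val :: "nat \<Rightarrow> 'a \<Rightarrow> nat" where "val p x = (THE k. vrel p k x)"

lemma valI: "prime p \<Longrightarrow> vrel p k x \<Longrightarrow> val p x = k"
  unfolding val_def using vrel_unique by blast

lemma vrel_val: "good p \<Longrightarrow> x \<in> OK \<Longrightarrow> x \<noteq> 0 \<Longrightarrow> vrel p (val p x) x"
  using vrel_exists valI good_prime by metis

lemma val_mult: "good p \<Longrightarrow> x \<in> OK \<Longrightarrow> x \<noteq> 0 \<Longrightarrow> y \<in> OK \<Longrightarrow> y \<noteq> 0 \<Longrightarrow> val p (x * y) = val p x + val p y"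
  by (intro valI vrel_mult vrel_val) (auto dest: good_prime)

lemma val_prod:
  assumes "good p" "finite A" "\<And>i. i \<in> A \<Longrightarrow> f i \<in> OK" "\<And>i. i \<in> A \<Longrightarrow> f i \<noteq> 0"
  shows "val p (prod f A) = (\<Sum>i\<in>A. val p (f i))"
  using assms(2-)
proof (induction A rule: finite_induct)
  case empty
  have "vrel p (multiplicity (int p) 1) (of_int 1)" using assms(1) good_prime by (intro vrel_of_int) auto
  then show ?case using valI[OF good_prime[OF assms(1)]] by simp
next
  case (insert a A)
  have "prod f A \<in> OK" using insert by (intro OK_prod) auto
  moreover have "prod f A \<noteq> 0" using insert by auto
  ultimately show ?case using insert by (simp add: val_mult[OF assms(1)])
qed

lemma val_eq_0_iff:
  assumes p: "good p" and x: "x \<in> OK" "x \<noteq> 0"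
  shows "val p x = 0 \<longleftrightarrow> x \<notin> prm p"
proof
  have pp: "prime p" using p good_prime by blast
  note M = prm(1)[OF pp]
  assume "x \<notin> prm p"
  moreover have "1 * x = of_nat p ^ 0 * x" by simp
  ultimately have "vrel p 0 x" unfolding vrel_def using OK_1 maxi_1[OF M] x(1) by blast
  then show "val p x = 0" by (rule valI[OF pp])
next
  have pp: "prime p" using p good_prime by blast
  assume "val p x = 0"
  then have "vrel p 0 x" using vrel_val[OF p x] by simp
  then obtain w b where "w \<in> OK" "b \<notin> prm p" "w * x = b" by (auto simp: vrel_def)
  then show "x \<notin> prm p" using idlD(4)[OF maxi_idl[OF prm(1)[OF pp]]] by blast
qed

text \<open>\<open>val p\<close> is additive on the product of the conjugates and agrees with the
  ordinary multiplicity on integers. Thus a single prime over \<open>p\<close> suffices to describe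
  the \<open>p\<close>-part of a norm.\<close>

lemma multiplicity_nrm:
  assumes p: "good p" and x: "x \<in> OK" "x \<noteq> 0"
  shows "multiplicity (int p) (nrm x) = (\<Sum>\<sigma>\<in>G. val p (\<sigma> x))"
proof -
  have "nrm x \<noteq> 0" using x nrm_eq_0_iff by blast
  then have "multiplicity (int p) (nrm x) = val p (of_int (nrm x))"
    using valI[OF good_prime[OF p] vrel_of_int[OF good_prime[OF p]]] by simp
  also have "\<dots> = (\<Sum>\<sigma>\<in>G. val p (\<sigma> x))" unfolding of_int_nrm[OF x(1)]
    by (rule val_prod[OF p finite_G]) (use G_OK[OF _ x(1)] G_eq_0_iff[of _ x] x(2) in blast)+
  finally show ?thesis .
qed

section \<open>Split primes and divisibility by valuations\<close>

text \<open>Residue degree one at \<open>prm p\<close>. Since \<open>K\<close> is Galois, a good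
  prime with this property splits completely.\<close>

definition split :: "nat \<Rightarrow> bool" where "split p \<longleftrightarrow> (\<forall>y\<in>OK. \<exists>i::int. y - of_int i \<in> prm p)"

text \<open>By Fermat, an element with an integer residue is fixed by the \<open>p\<close>-th power
  modulo \<open>prm p\<close>. Every conjugate of \<open>x\<close> has such a residue, and
  \<open>good_reduced\<close> converts this into divisibility by \<open>p\<close>.\<close>

lemma split_power:
  assumes p: "good p" "split p" and x: "x \<in> OK"
  shows "\<exists>y\<in>OK. x ^ p - x = of_nat p * y"
proof (rule good_reduced[OF p(1)])
  have pp: "prime p" using p good_prime by blast
  note I = maxi_idl[OF prm(1)[OF pp]]
  show "x ^ p - x \<in> OK" by (intro OK_diff OK_power x)
  fix \<sigma> assume s: "\<sigma> \<in> G"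
  define y where "y = \<sigma> x"
  have y: "y \<in> OK" unfolding y_def by (rule G_OK[OF s x])
  have "\<sigma> (x ^ p - x) = y ^ p - y"
    using G_diff[OF s, of "x ^ p" x] G_power[OF s, of x p] OK_K[OF x] OK_K[OF OK_power[OF x]] by (simp add: y_def)
  also have "y ^ p - y \<in> prm p"
  proof -
    obtain i :: int where i: "y - of_int i \<in> prm p" using p(2) y by (auto simp: split_def)
    have "y ^ p - of_int i ^ p = (y - of_int i) * (\<Sum>j<p. of_int i ^ (p - Suc j) * y ^ j)"
      by (rule power_diff_sumr2)
    also have "\<dots> \<in> prm p" by (rule idlD(5)[OF I _ i]) (intro OK_sum OK_mult OK_power OK_of_int y)
    finally have 1: "y ^ p - of_int i ^ p \<in> prm p" .
    have 2: "of_int (i ^ p - i) \<in> prm p"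
      using prm_int_iff[OF pp] int_prime_dvd_power_self_diff[OF pp] by blast
    have "y ^ p - y = (y ^ p - of_int i ^ p) + of_int (i ^ p - i) - (y - of_int i)" by simp
    also have "\<dots> \<in> prm p" by (intro idlD(6)[OF I] idlD(3)[OF I] 1 2 i)
    finally show ?thesis .
  qed
  finally show "\<sigma> (x ^ p - x) \<in> prm p" .
qed

text \<open>The product \<open>z\<close> of the other conjugates of \<open>a\<close> is invertible modulo \<open>prm p\<close> but vanishes modulo
  every other conjugate prime, so modulo \<open>prm p\<close> each multiple of \<open>z\<close> equals its trace.\<close>

lemma sum_val_eq_1_imp_split:
  assumes p: "good p" and a: "a \<in> OK" "a \<noteq> 0" and one: "(\<Sum>\<sigma>\<in>G. val p (\<sigma> a)) = 1"
  shows "split p"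
proof -
  have pp: "prime p" using p good_prime by blast
  note M = prm(1)[OF pp] and I = maxi_idl[OF prm(1)[OF pp]]
  \<comment> \<open>A sum of natural numbers equal to 1 has a single nonzero term. Passing from
    \<open>a\<close> to \<open>\<rho> a\<close> makes the distinguished automorphism the
    identity.\<close>
  obtain \<rho> where r: "\<rho> \<in> G" "val p (\<rho> a) = 1" "\<And>\<sigma>. \<sigma> \<in> G \<Longrightarrow> \<sigma> \<noteq> \<rho> \<Longrightarrow> val p (\<sigma> a) = 0"
    using one sum_eq_1_iff[OF finite_G, of "\<lambda>\<sigma>. val p (\<sigma> a)"] by auto
  define c where "c = \<rho> a"
  have c: "c \<in> OK" "c \<noteq> 0" unfolding c_def using G_OK[OF r(1) a(1)] G_eq_0_iff[OF r(1)] a(2) by auto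
  have cM: "c \<in> prm p" using val_eq_0_iff[OF p c] r(2) by (auto simp: c_def)
  have ncM: "\<tau> c \<notin> prm p" if t: "\<tau> \<in> G" "\<tau> \<noteq> id" for \<tau>
  proof -
    have "\<tau> \<circ> \<rho> \<noteq> \<rho>"
    proof
      assume e: "\<tau> \<circ> \<rho> = \<rho>"
      obtain \<rho>' where "\<And>x. \<rho> (\<rho>' x) = x" using G_inverse[OF r(1)] by blast
      then have "\<tau> x = x" for x using e by (metis comp_apply)
      then show False using t(2) by auto
    qed
    then have "val p (\<tau> c) = 0" using r(3)[OF comp_G[OF t(1) r(1)]] by (simp add: c_def)
    then show ?thesis
      using val_eq_0_iff[OF p G_OK[OF t(1) c(1)]] G_eq_0_iff[OF t(1)] c(2) by blast
  qed
  define z where "z = (\<Prod>\<tau>\<in>G - {id}. \<tau> c)"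
  have zO: "z \<in> OK" unfolding z_def by (rule OK_prod) (use G_OK[OF _ c(1)] in blast)
  have zM: "z \<notin> prm p" unfolding z_def
    by (rule maxi_prod[OF M]) (use finite_G G_OK[OF _ c(1)] ncM in blast)+
  have sz: "\<sigma> z \<in> prm p" if s: "\<sigma> \<in> G" "\<sigma> \<noteq> id" for \<sigma>
  proof -
    obtain \<tau> where t: "\<tau> \<in> G" "\<And>x. \<sigma> (\<tau> x) = x" "\<And>x. \<tau> (\<sigma> x) = x" using G_inverse[OF s(1)] by blast
    have "\<tau> \<noteq> id" using t(2) s(2) by (metis eq_id_iff)
    then have tm: "\<tau> \<in> G - {id}" using t by simp
    have "\<sigma> z = (\<Prod>\<tau>\<in>G - {id}. \<sigma> (\<tau> c))" unfolding z_def
      by (rule G_prod[OF s(1)]) (use G_OK[OF _ c(1)] OK_K in blast)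
    also have "\<dots> \<in> prm p"
    proof (rule idl_prod_mem[OF I _ _ tm])
      show "finite (G - {id})" using finite_G by simp
      show "\<sigma> (\<tau>' c) \<in> OK" if "\<tau>' \<in> G - {id}" for \<tau>'
        using G_OK[OF s(1) G_OK[OF _ c(1)]] that by blast
      show "\<sigma> (\<tau> c) \<in> prm p" using t(2) cM by simp
    qed
    finally show ?thesis .
  qed
  obtain z' where z': "z' \<in> OK" "1 - z' * z \<in> prm p" using M zO zM by (auto simp: maxi_def)
  have "\<exists>i::int. x - of_int i \<in> prm p" if x: "x \<in> OK" for x
  proof -
    define y where "y = (x * z') * z"
    have xz: "x * z' \<in> OK" using x z' OK_mult by blast
    have y: "y \<in> OK" unfolding y_def by (rule OK_mult[OF xz zO])
    obtain i :: int where i: "trc y = of_int i" using trc_int[OF y] by blast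
    define S where "S = (\<Sum>\<sigma>\<in>G - {id}. \<sigma> y)"
    have "trc y = y + S" unfolding trc_def S_def by (subst sum.remove[OF finite_G id_G]) simp
    then have yS: "y + S = of_int i" using i by simp
    have S: "S \<in> prm p" unfolding S_def
    proof (rule idl_sum[OF I])
      fix \<sigma> assume "\<sigma> \<in> G - {id}"
      then have s: "\<sigma> \<in> G" "\<sigma> \<noteq> id" by auto
      show "\<sigma> y \<in> prm p" unfolding y_def G_mult[OF s(1) OK_K[OF xz] OK_K[OF zO]]
        by (rule idlD(4)[OF I G_OK[OF s(1) xz] sz[OF s]])
    qed
    \<comment> \<open>Modulo \<open>prm p\<close>, \<open>x\<close> agrees with y = x z' z because
      z' z is congruent to 1, and \<open>y\<close> agrees with its integer trace because the other
      conjugates vanish.\<close>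
    have "x * (1 - z' * z) - S \<in> prm p" by (rule idlD(6)[OF I idlD(4)[OF I x z'(2)] S])
    moreover have "x * (1 - z' * z) - S = x - of_int i"
      unfolding yS[symmetric] by (simp add: y_def algebra_simps)
    ultimately show ?thesis by metis
  qed
  then show ?thesis by (auto simp: split_def)
qed

text \<open>Modulo \<open>p\<close> the polynomial X^p - X is the product of X - a over a = 0, ...,
  p - 1. Evaluated at \<open>x\<close> this product lies in the prime ideal \<open>prm p\<close>,
  hence so does one factor.\<close>

lemma residue_of_power:
  assumes pp: "prime p" and x: "x \<in> OK" and xp: "x ^ p - x \<in> prm p"
  shows "\<exists>i::int. x - of_int i \<in> prm p"
proof -
  note M = prm(1)[OF pp] and I = maxi_idl[OF prm(1)[OF pp]]
  have p1: "p > 1" using pp prime_gt_1_nat by blast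
  define f :: "int poly" where "f = monom 1 p - monom 1 1"
  define A where "A = {0..<int p}"
  have deg: "degree f = p" unfolding f_def diff_conv_add_uminus using p1
    by (subst degree_add_eq_left) (auto simp: degree_monom_eq)
  have "\<exists>g. f = (\<Prod>a\<in>A. [:-a, 1:]) + Polynomial.smult (int p) g"
  proof (rule monic_int_poly_roots_mod_prime[OF pp])
    show "finite A" "card A = degree f" by (auto simp: A_def deg)
    show "lead_coeff f = 1" using p1 by (simp add: deg) (simp add: f_def)
    show "a = b" if "a \<in> A" "b \<in> A" "int p dvd a - b" for a b
    proof -
      have "a mod int p = b mod int p" using that(3) by (simp add: mod_eq_dvd_iff)
      then show ?thesis using that by (simp add: A_def)
    qed
    show "int p dvd poly f a" if "a \<in> A" for a
      using int_prime_dvd_power_self_diff[OF pp] by (simp add: f_def poly_monom)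
  qed
  then obtain g where g: "f = (\<Prod>a\<in>A. [:-a, 1:]) + Polynomial.smult (int p) g" by blast
  define ev where "ev q = poly (map_poly of_int q) x" for q :: "int poly"
  have ev: "ev q = evq (map_poly of_int q) x" for q
    by (simp add: ev_def evq_def map_poly_map_poly o_def)
  have add: "ev (q + r) = ev q + ev r" and mult: "ev (q * r) = ev q * ev r" for q r
  proof -
    have "map_poly of_int (q + r) = map_poly of_int q + (map_poly of_int r :: rat poly)"
      by (auto simp: poly_eq_iff coeff_map_poly)
    then show "ev (q + r) = ev q + ev r" by (simp add: ev)
    have "map_poly of_int (q * r) = map_poly of_int q * (map_poly of_int r :: rat poly)"
      by (auto simp: poly_eq_iff coeff_map_poly coeff_mult)
    then show "ev (q * r) = ev q * ev r" by (simp add: ev)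
  qed
  have evc: "ev [:a, b:] = of_int a + x * of_int b" for a b by (simp add: ev_def Polynomial.map_poly_pCons)
  have evp: "ev (\<Prod>a\<in>C. [:-a, 1:]) = (\<Prod>a\<in>C. x - of_int a)" for C
  proof (induction C rule: infinite_finite_induct)
    case (insert a C)
    then show ?case by (simp add: mult evc del: mult_pCons_left)
  qed (auto simp: ev_def one_pCons Polynomial.map_poly_pCons)
  have evs: "ev (Polynomial.smult c q) = of_int c * ev q" for c q
    using mult[of "[:c:]" q] evc[of c 0] by (simp add: ev_def Polynomial.map_poly_pCons)
  have evO: "ev q \<in> OK" for q
    by (induction q) (auto simp: ev_def Polynomial.map_poly_pCons intro!: OK_intros x)
  have "ev f = x ^ p - x"
  proof -
    have "f + monom 1 1 = monom 1 p" by (simp add: f_def)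
    then have "ev f + ev (monom 1 1) = ev (monom 1 p)" using add[of f "monom 1 1"] by simp
    then show ?thesis by (simp add: ev_def map_poly_monom poly_monom algebra_simps)
  qed
  then have ef: "ev f \<in> prm p" using xp by simp
  have "ev f = (\<Prod>a\<in>A. x - of_int a) + of_int (int p) * ev g" by (subst g) (simp only: add evp evs)
  then have "(\<Prod>a\<in>A. x - of_int a) = ev f - of_nat p * ev g" by (simp add: algebra_simps)
  also have "\<dots> \<in> prm p" by (rule idlD(6)[OF I ef]) (rule idlD(5)[OF I evO prm(2)[OF pp]])
  finally have "(\<Prod>a\<in>A. x - of_int a) \<in> prm p" .
  then have "\<exists>a\<in>A. x - of_int a \<in> prm p"
    using maxi_prod[OF M _ OK_diff[OF x OK_of_int], of A "\<lambda>a. a"] unfolding A_def by blast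
  then show "\<exists>i::int. x - of_int i \<in> prm p" by blast
qed

text \<open>Otherwise pick for each \<sigma> an element of \<open>prm p\<close> that \<sigma> moves
  out of \<open>M\<close>. The product of the images avoids the prime \<open>M\<close>, yet each of
  its conjugates has a factor in \<open>prm p\<close>, so it is divisible by \<open>p\<close> and
  lies in \<open>M\<close>.\<close>

lemma exists_conjugate_subset:
  assumes p: "good p" and M: "maxi M" "of_nat p \<in> M"
  shows "\<exists>\<sigma>\<in>G. \<sigma> ` prm p \<subseteq> M"
proof (rule ccontr)
  have pp: "prime p" using p good_prime by blast
  note I = maxi_idl[OF prm(1)[OF pp]]
  assume "\<not> (\<exists>\<sigma>\<in>G. \<sigma> ` prm p \<subseteq> M)"
  then have "\<forall>\<sigma>\<in>G. \<exists>b. b \<in> prm p \<and> \<sigma> b \<notin> M" by blast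
  then obtain b where b: "\<And>\<sigma>. \<sigma> \<in> G \<Longrightarrow> b \<sigma> \<in> prm p \<and> \<sigma> (b \<sigma>) \<notin> M" by metis
  have bO: "b \<sigma> \<in> OK" if "\<sigma> \<in> G" for \<sigma> using prm_OK[OF pp] b that by blast
  have sbO: "\<sigma> (b \<sigma>) \<in> OK" if "\<sigma> \<in> G" for \<sigma> using G_OK[OF that bO[OF that]] .
  define x where "x = (\<Prod>\<sigma>\<in>G. \<sigma> (b \<sigma>))"
  have x: "x \<in> OK" unfolding x_def by (rule OK_prod) (rule sbO)
  have "\<exists>y\<in>OK. x = of_nat p * y"
  proof (rule good_reduced[OF p x])
    fix \<tau> assume t: "\<tau> \<in> G"
    obtain \<rho> where r: "\<rho> \<in> G" "\<And>x. \<tau> (\<rho> x) = x" using G_inverse[OF t] by blast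
    have "\<tau> x = (\<Prod>\<sigma>\<in>G. \<tau> (\<sigma> (b \<sigma>)))" unfolding x_def
      by (rule G_prod[OF t]) (rule OK_K[OF sbO])
    also have "\<dots> \<in> prm p"
      by (rule idl_prod_mem[OF I finite_G _ r(1)]) (use G_OK[OF t sbO] r b in auto)
    finally show "\<tau> x \<in> prm p" .
  qed
  then have "x \<in> M" using idlD(5)[OF maxi_idl[OF M(1)] _ M(2)] by blast
  moreover have "x \<notin> M" unfolding x_def
    by (rule maxi_prod[OF M(1) finite_G]) (use sbO b in blast)+
  ultimately show False by blast
qed

lemma maxi_contains_prime:
  assumes M: "maxi M" and "of_int n \<in> M" "n \<noteq> 0"
  shows "\<exists>p. prime p \<and> int p dvd n \<and> of_nat p \<in> M"
proof -
  have "\<exists>p. prime p \<and> p dvd m \<and> of_nat p \<in> M" if "of_nat m \<in> M" "m > 0" for m :: nat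
    using that
  proof (induction m rule: less_induct)
    case (less m)
    have "m \<noteq> 1" using less.prems maxi_1[OF M] by auto
    then obtain q where q: "prime q" "q dvd m" using prime_factor_nat by blast
    then obtain k where k: "m = q * k" by blast
    then have "of_nat q * of_nat k \<in> M" using less.prems by simp
    then consider "of_nat q \<in> M" | "of_nat k \<in> M" using maxi_prime[OF M OK_of_nat OK_of_nat] by blast
    then show ?case
    proof cases
      case 1 then show ?thesis using q by blast
    next
      case 2
      have "k > 0" "k < m" using k less.prems prime_gt_1_nat[OF q(1)] by auto
      then show ?thesis using less.IH[of k] 2 k by auto
    qed
  qed
  moreover have "of_nat (nat \<bar>n\<bar>) \<in> M"
  proof (cases "n \<ge> 0")
    case True then show ?thesis using assms(2) by simp
  next
    case False
    then have "of_nat (nat \<bar>n\<bar>) = 0 - (of_int n :: 'a)" by simp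
    then show ?thesis using idlD(6)[OF maxi_idl[OF M] idlD(2)[OF maxi_idl[OF M]] assms(2)] by simp
  qed
  moreover have "nat \<bar>n\<bar> > 0" using assms(3) by simp
  ultimately obtain p where "prime p" "p dvd nat \<bar>n\<bar>" "of_nat p \<in> M" by blast
  moreover from this have "int p dvd int (nat \<bar>n\<bar>)" by (simp only: int_dvd_int_iff)
  ultimately show ?thesis by auto
qed

text \<open>The local-global step that replaces unique factorization. The denominators of b/a form
  an ideal \<open>J\<close> containing \<open>nrm a\<close>. If it were proper, a maximal ideal over
  it would contain a conjugate of some \<open>prm p\<close>, but equal valuations there yield a
  denominator outside it.\<close>

lemma dvd_of_val_eq:
  assumes a: "a \<in> OK" "a \<noteq> 0" and b: "b \<in> OK" "b \<noteq> 0"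
    and cop: "\<And>p. prime p \<Longrightarrow> int p dvd nrm a \<Longrightarrow> good p"
    and eq: "\<And>p \<sigma>. good p \<Longrightarrow> int p dvd nrm a \<Longrightarrow> \<sigma> \<in> G \<Longrightarrow> val p (\<sigma> a) = val p (\<sigma> b)"
  shows "\<exists>w\<in>OK. b = a * w"
proof -
  define J where "J = {w\<in>OK. \<exists>y\<in>OK. w * b = a * y}"
  have iJ: "idl J" unfolding idl_def
  proof (intro conjI ballI)
    show "J \<subseteq> OK" by (auto simp: J_def)
    show "0 \<in> J" using OK_0 by (auto simp: J_def)
    fix u v assume "u \<in> J" "v \<in> J"
    then obtain y y' where "u \<in> OK" "v \<in> OK" "y \<in> OK" "y' \<in> OK" "u * b = a * y" "v * b = a * y'"
      by (auto simp: J_def)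
    moreover from this have "(u + v) * b = a * (y + y')" by (simp add: algebra_simps)
    ultimately show "u + v \<in> J" unfolding J_def using OK_add by blast
  next
    fix u v assume "u \<in> OK" "v \<in> J"
    then obtain y where "u \<in> OK" "v \<in> OK" "y \<in> OK" "v * b = a * y" by (auto simp: J_def)
    moreover from this have "(u * v) * b = a * (u * y)" by (simp add: algebra_simps)
    ultimately show "u * v \<in> J" unfolding J_def using OK_mult by blast
  qed
  have "1 \<in> J"
  proof (rule ccontr)
    assume "1 \<notin> J"
    then obtain M where M: "maxi M" "J \<subseteq> M" using exists_maxi[OF iJ] by blast
    obtain y where y: "y \<in> OK" "of_int (nrm a) = a * y" using nrm_dvd[OF a(1)] by blast
    have "of_int (nrm a) * b = a * (y * b)" using y by (simp add: algebra_simps)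
    then have "of_int (nrm a) \<in> J" unfolding J_def using OK_mult[OF y(1) b(1)] OK_of_int by blast
    then have "of_int (nrm a) \<in> M" using M by blast
    then obtain p where p: "prime p" "int p dvd nrm a" "of_nat p \<in> M"
      using maxi_contains_prime[OF M(1)] nrm_eq_0_iff[OF a(1)] a(2) by blast
    have g: "good p" using cop p by blast
    note P = prm(1)[OF p(1)]
    obtain \<sigma> where s: "\<sigma> \<in> G" "\<sigma> ` prm p \<subseteq> M" using exists_conjugate_subset[OF g M(1) p(3)] by blast
    obtain \<tau> where t: "\<tau> \<in> G" "\<And>x. \<sigma> (\<tau> x) = x" using G_inverse[OF s(1)] by blast
    define k where "k = val p (\<tau> a)"
    have ta: "\<tau> a \<in> OK" "\<tau> a \<noteq> 0" and tb: "\<tau> b \<in> OK" "\<tau> b \<noteq> 0"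
      using G_OK[OF t(1)] G_eq_0_iff[OF t(1)] a b by auto
    obtain w c where w: "w \<in> OK" "c \<in> OK" "w \<notin> prm p" "c \<notin> prm p" "w * \<tau> a = of_nat p ^ k * c"
      using vrel_val[OF g ta] by (auto simp: vrel_def k_def)
    have "vrel p k (\<tau> b)" using vrel_val[OF g tb] eq[OF g p(2) t(1)] by (simp add: k_def)
    then obtain w' c' where w': "w' \<in> OK" "c' \<in> OK" "w' \<notin> prm p" "c' \<notin> prm p" "w' * \<tau> b = of_nat p ^ k * c'"
      by (auto simp: vrel_def)
    have "(c * w') * \<tau> b = c * (of_nat p ^ k * c')" using w' by (simp add: mult.assoc)
    also have "\<dots> = (w * \<tau> a) * c'" using w(5) by (simp add: algebra_simps)
    \<comment> \<open>Cross-multiplying the two local factorizations cancels the common power of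
      \<open>p\<close> and leaves a denominator outside \<open>prm p\<close>.\<close>
    finally have e: "(c * w') * \<tau> b = \<tau> a * (w * c')" by (simp add: algebra_simps)
    have cw: "c * w' \<in> OK" "w * c' \<in> OK" using w w' OK_mult by blast+
    have "\<sigma> (c * w') * b = a * \<sigma> (w * c')"
      using arg_cong[OF e, of \<sigma>] G_mult[OF s(1) OK_K[OF cw(1)] OK_K[OF tb(1)]]
        G_mult[OF s(1) OK_K[OF ta(1)] OK_K[OF cw(2)]] t(2) by simp
    then have J: "\<sigma> (c * w') \<in> M"
      using M(2) G_OK[OF s(1) cw(1)] G_OK[OF s(1) cw(2)] unfolding J_def by blast
    have "c * w' \<notin> prm p" using maxi_mult[OF P] w w' by blast
    then obtain z where z: "z \<in> OK" "1 - z * (c * w') \<in> prm p" using P cw by (auto simp: maxi_def)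
    have "\<sigma> (1 - z * (c * w')) = 1 - \<sigma> z * \<sigma> (c * w')"
      using G_diff[OF s(1) K_ops(6) K_ops(3)[OF OK_K[OF z(1)] OK_K[OF cw(1)]]]
        G_mult[OF s(1) OK_K[OF z(1)] OK_K[OF cw(1)]] G_1[OF s(1)] by simp
    moreover have "\<sigma> (1 - z * (c * w')) \<in> M" using z s by blast
    moreover have "\<sigma> z * \<sigma> (c * w') \<in> M" by (rule idlD(4)[OF maxi_idl[OF M(1)] G_OK[OF s(1) z(1)] J])
    ultimately have "1 - \<sigma> z * \<sigma> (c * w') + \<sigma> z * \<sigma> (c * w') \<in> M"
      using idlD(3)[OF maxi_idl[OF M(1)]] by metis
    then show False using maxi_1[OF M(1)] by simp
  qed
  then show ?thesis by (auto simp: J_def)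
qed

end

subsection \<open>Heights\<close>

context galois_int
begin

definition ht :: "'a \<Rightarrow> real" where "ht x = (\<Sum>b\<in>B. \<bar>real_of_rat (co x b)\<bar>)"

lemma ht_nonneg [simp]: "0 \<le> ht x" by (auto simp: ht_def intro: sum_nonneg)

lemma co_le_ht: "b \<in> B \<Longrightarrow> \<bar>real_of_rat (co x b)\<bar> \<le> ht x"
  unfolding ht_def using finite_B by (intro member_le_sum) auto

lemma co_add: "x \<in> K \<Longrightarrow> y \<in> K \<Longrightarrow> co (x + y) b = co x b + co y b"
  unfolding co_def using rv.representation_add[OF indep_B, of y x] span_B by (simp add: add.commute)

lemma co_scale: "x \<in> K \<Longrightarrow> co (of_rat q * x) b = q * co x b"
  unfolding co_def using rv.representation_scale[OF indep_B, of x q] span_B by simp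

lemma co_basis: "b \<in> B \<Longrightarrow> co b c = (if c = b then 1 else 0)"
  unfolding co_def using rv.representation_basis[OF indep_B, of b] by simp

lemma ht_add: "x \<in> K \<Longrightarrow> y \<in> K \<Longrightarrow> ht (x + y) \<le> ht x + ht y"
  unfolding ht_def sum.distrib[symmetric]
  by (intro sum_mono) (simp only: co_add of_rat_add abs_triangle_ineq)

lemma ht_scale: "x \<in> K \<Longrightarrow> ht (of_rat q * x) = \<bar>real_of_rat q\<bar> * ht x"
  unfolding ht_def sum_distrib_left by (intro sum.cong refl) (simp add: co_scale of_rat_mult abs_mult)

lemma ht_basis: "b \<in> B \<Longrightarrow> ht b = 1"
proof -
  assume b: "b \<in> B"
  have "ht b = (\<Sum>c\<in>B. if c = b then 1 else 0)" unfolding ht_def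
    by (intro sum.cong refl) (simp add: co_basis[OF b])
  then show ?thesis using b finite_B by simp
qed

lemma ht_1 [simp]: "ht 1 = 1" by (rule ht_basis[OF one_B])

text \<open>The basis contains 1, so rational numbers have a single coordinate. This lets heights of
  norms be read as absolute values.\<close>

lemma ht_of_rat: "ht (of_rat q) = \<bar>real_of_rat q\<bar>"
  using ht_scale[OF K_ops(6), of q] by simp

lemma ht_of_int: "ht (of_int k) = \<bar>real_of_int k\<bar>"
  using ht_of_rat[of "of_int k"] by simp

lemma ht_0 [simp]: "ht 0 = 0" using ht_of_int[of 0] by simp

lemma ht_sum: "(\<And>i. i \<in> A \<Longrightarrow> f i \<in> K) \<Longrightarrow> ht (sum f A) \<le> (\<Sum>i\<in>A. ht (f i))"
proof (induction A rule: infinite_finite_induct)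
  case (insert a A)
  have "sum f A \<in> K" using insert by (intro subfield_sum[OF subfield]) auto
  then have "ht (f a + sum f A) \<le> ht (f a) + ht (sum f A)" using insert by (intro ht_add) auto
  then show ?case using insert by force
qed auto

lemma ht_lin_comb:
  assumes "\<And>b. b \<in> B \<Longrightarrow> f b \<in> K"
  shows "ht (\<Sum>b\<in>B. of_rat (u b) * f b) \<le> (\<Sum>b\<in>B. \<bar>real_of_rat (u b)\<bar> * ht (f b))"
proof -
  have "ht (\<Sum>b\<in>B. of_rat (u b) * f b) \<le> (\<Sum>b\<in>B. ht (of_rat (u b) * f b))"
    using assms by (intro ht_sum K_ops)
  also have "\<dots> = (\<Sum>b\<in>B. \<bar>real_of_rat (u b)\<bar> * ht (f b))"
    using assms by (intro sum.cong refl ht_scale)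
  finally show ?thesis .
qed

text \<open>Conjugation is linear and multiplication bilinear, so both are bounded by their values
  on basis vectors. The added 1 makes the constant at least 1.\<close>

lemma ht_constant: "\<exists>C\<ge>1. (\<forall>\<sigma>\<in>G. \<forall>x\<in>K. ht (\<sigma> x) \<le> C * ht x) \<and> (\<forall>x\<in>K. \<forall>y\<in>K. ht (x * y) \<le> C * ht x * ht y)"
proof -
  define C1 where "C1 = (\<Sum>\<sigma>\<in>G. \<Sum>b\<in>B. ht (\<sigma> b))"
  define C2 where "C2 = (\<Sum>b\<in>B. \<Sum>c\<in>B. ht (b * c))"
  have C0: "C1 \<ge> 0" "C2 \<ge> 0" unfolding C1_def C2_def by (intro sum_nonneg ht_nonneg)+
  have 1: "ht (\<sigma> x) \<le> C1 * ht x" if s: "\<sigma> \<in> G" and x: "x \<in> K" for \<sigma> x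
  proof -
    have sb: "\<sigma> b \<in> K" if "b \<in> B" for b using G_closed[OF s B_K[OF that]] .
    have "\<sigma> x = \<sigma> (\<Sum>b\<in>B. of_rat (co x b) * b)" using co_sum[OF x] by simp
    also have "\<dots> = (\<Sum>b\<in>B. \<sigma> (of_rat (co x b) * b))"
      by (rule G_sum[OF s]) (intro K_ops B_K)
    also have "\<dots> = (\<Sum>b\<in>B. of_rat (co x b) * \<sigma> b)"
      using G_mult[OF s K_ops(7) B_K] G_rat[OF s] by (intro sum.cong refl) simp
    finally have "ht (\<sigma> x) \<le> (\<Sum>b\<in>B. \<bar>real_of_rat (co x b)\<bar> * ht (\<sigma> b))"
      using ht_lin_comb[of \<sigma> "co x"] sb by simp
    also have "\<dots> \<le> (\<Sum>b\<in>B. ht x * ht (\<sigma> b))"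
      by (intro sum_mono mult_right_mono co_le_ht) auto
    also have "\<dots> = ht x * (\<Sum>b\<in>B. ht (\<sigma> b))" by (simp add: sum_distrib_left)
    also have "\<dots> \<le> ht x * C1" unfolding C1_def
      using s finite_G by (intro mult_left_mono member_le_sum) (auto intro: sum_nonneg)
    finally show ?thesis by (simp add: mult.commute)
  qed
  have 2: "ht (x * y) \<le> C2 * ht x * ht y" if x: "x \<in> K" and y: "y \<in> K" for x y
  proof -
    have "x * y = (\<Sum>b\<in>B. of_rat (co x b) * (b * y))"
      by (subst co_sum[OF x, symmetric]) (simp add: sum_distrib_right mult.assoc)
    then have "ht (x * y) \<le> (\<Sum>b\<in>B. \<bar>real_of_rat (co x b)\<bar> * ht (b * y))"
      using ht_lin_comb[of "\<lambda>b. b * y" "co x"] B_K y K_ops(3) by simp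
    also have "\<dots> \<le> (\<Sum>b\<in>B. ht x * (ht y * (\<Sum>c\<in>B. ht (b * c))))"
    proof (intro sum_mono mult_mono co_le_ht)
      fix b assume b: "b \<in> B"
      have "b * y = (\<Sum>c\<in>B. of_rat (co y c) * (b * c))"
        by (subst co_sum[OF y, symmetric]) (simp add: sum_distrib_left mult.left_commute)
      then have "ht (b * y) \<le> (\<Sum>c\<in>B. \<bar>real_of_rat (co y c)\<bar> * ht (b * c))"
        using ht_lin_comb[of "\<lambda>c. b * c" "co y"] B_K b K_ops(3) by simp
      also have "\<dots> \<le> (\<Sum>c\<in>B. ht y * ht (b * c))"
        by (intro sum_mono mult_right_mono co_le_ht) auto
      finally show "ht (b * y) \<le> ht y * (\<Sum>c\<in>B. ht (b * c))" by (simp add: sum_distrib_left)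
    qed auto
    also have "\<dots> = C2 * ht x * ht y"
      by (simp add: C2_def sum_distrib_left sum_distrib_right mult_ac)
    finally show ?thesis .
  qed
  have "ht (\<sigma> x) \<le> (C1 + C2 + 1) * ht x" if "\<sigma> \<in> G" "x \<in> K" for \<sigma> x
    using 1[OF that] mult_right_mono[of C1 "C1 + C2 + 1" "ht x"] C0 by simp
  moreover have "ht (x * y) \<le> (C1 + C2 + 1) * ht x * ht y" if "x \<in> K" "y \<in> K" for x y
    using 2[OF that] mult_right_mono[of C2 "C1 + C2 + 1" "ht x * ht y"] C0 by (simp add: mult.assoc)
  ultimately show ?thesis using C0 by (intro exI[of _ "C1 + C2 + 1"]) auto
qed

definition hC :: real where
  "hC = (SOME C. C \<ge> 1 \<and> (\<forall>\<sigma>\<in>G. \<forall>x\<in>K. ht (\<sigma> x) \<le> C * ht x) \<and> (\<forall>x\<in>K. \<forall>y\<in>K. ht (x * y) \<le> C * ht x * ht y))"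

lemma hC_ge_1: "hC \<ge> 1"
  and ht_G: "\<And>\<sigma> x. \<sigma> \<in> G \<Longrightarrow> x \<in> K \<Longrightarrow> ht (\<sigma> x) \<le> hC * ht x"
  and ht_mult: "\<And>x y. x \<in> K \<Longrightarrow> y \<in> K \<Longrightarrow> ht (x * y) \<le> hC * ht x * ht y"
  using someI_ex[OF ht_constant] unfolding hC_def by blast+

lemma ht_prod:
  assumes "finite A" "\<And>i. i \<in> A \<Longrightarrow> f i \<in> K" "\<And>i. i \<in> A \<Longrightarrow> ht (f i) \<le> r"
  shows "ht (prod f A) \<le> (hC * r) ^ card A"
  using assms
proof (induction A rule: finite_induct)
  case (insert a A)
  have m: "prod f A \<in> K" using insert by (intro subfield_prod[OF subfield]) auto
  have r: "0 \<le> r" using insert.prems(2)[of a] order_trans[OF ht_nonneg[of "f a"]] by simp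
  have IH: "ht (prod f A) \<le> (hC * r) ^ card A" using insert by simp
  have "ht (f a * prod f A) \<le> hC * ht (f a) * ht (prod f A)" using insert m by (intro ht_mult) auto
  also have "\<dots> \<le> (hC * r) * (hC * r) ^ card A"
    using IH hC_ge_1 r insert.prems(2)[of a] by (intro mult_mono) auto
  finally show ?case using insert by simp
qed simp

text \<open>Each conjugate costs one factor \<open>hC\<close> for the action of \<open>G\<close> and
  one for the multiplication.\<close>

lemma abs_nrm_le:
  assumes x: "x \<in> OK"
  shows "\<bar>real_of_int (nrm x)\<bar> \<le> (hC ^ 2 * ht x) ^ card G"
proof -
  have "\<bar>real_of_int (nrm x)\<bar> = ht (\<Prod>\<sigma>\<in>G. \<sigma> x)"
    unfolding of_int_nrm[OF x, symmetric] by (rule ht_of_int[symmetric])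
  also have "\<dots> \<le> (hC * (hC * ht x)) ^ card G"
    by (rule ht_prod[OF finite_G G_closed[OF _ OK_K[OF x]] ht_G[OF _ OK_K[OF x]]])
  finally show ?thesis by (simp add: power2_eq_square mult.assoc)
qed

text \<open>Multiplication by \<open>dlt\<close> gives integer coordinates, and these are
  bounded.\<close>

lemma finite_bounded_height: "finite {x \<in> OK. ht x \<le> r}"
proof -
  define R :: int where "R = \<lceil>of_int dlt * r\<rceil>"
  have "x \<in> (\<lambda>m. (\<Sum>b\<in>B. of_int (m b) * b) / of_int dlt) ` (PiE B (\<lambda>_. {-R..R}))"
    if x: "x \<in> OK" "ht x \<le> r" for x
  proof -
    obtain m :: "'a \<Rightarrow> int" where m: "of_int dlt * x = (\<Sum>b\<in>B. of_int (m b) * b)" using dlt_OK[OF x(1)] by blast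
    have "co (of_rat (of_int dlt) * x) b = of_int (m b)" if "b \<in> B" for b
      using co_unique[OF that, of "\<lambda>b. of_int (m b)"] m by simp
    then have cm: "of_int dlt * co x b = of_int (m b)" if "b \<in> B" for b
      using co_scale[OF OK_K[OF x(1)], of "of_int dlt" b] that by simp
    have "m b \<in> {-R..R}" if b: "b \<in> B" for b
    proof -
      have "real_of_rat (of_int dlt * co x b) = real_of_rat (of_int (m b))" using cm[OF b] by (simp only:)
      then have "real_of_int dlt * real_of_rat (co x b) = real_of_int (m b)" by (simp add: of_rat_mult)
      then have "\<bar>real_of_int (m b)\<bar> = \<bar>real_of_int dlt * real_of_rat (co x b)\<bar>" by (simp only:)
      also have "\<dots> = of_int dlt * \<bar>real_of_rat (co x b)\<bar>" using dlt_pos by (simp add: abs_mult)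
      finally have "\<bar>real_of_int (m b)\<bar> = of_int dlt * \<bar>real_of_rat (co x b)\<bar>" .
      also have "\<dots> \<le> of_int dlt * r" using co_le_ht[OF b, of x] x(2) dlt_pos by (intro mult_left_mono) auto
      also have "\<dots> \<le> of_int R" by (simp add: R_def)
      finally have "\<bar>m b\<bar> \<le> R" by linarith
      then show ?thesis by auto
    qed
    then have 1: "restrict m B \<in> PiE B (\<lambda>_. {-R..R})" by auto
    have "x = (\<Sum>b\<in>B. of_int (restrict m B b) * b) / of_int dlt"
      using m dlt_pos by (simp add: field_simps)
    then show ?thesis using 1 by blast
  qed
  then have "{x \<in> OK. ht x \<le> r} \<subseteq> (\<lambda>m. (\<Sum>b\<in>B. of_int (m b) * b) / of_int dlt) ` (PiE B (\<lambda>_. {-R..R}))"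
    by blast
  moreover have "finite (PiE B (\<lambda>_. {-R..R}))" using finite_B by (intro finite_PiE) auto
  ultimately show ?thesis using finite_surj by blast
qed

section \<open>Boxes of elements with controlled norm\<close>

text \<open>A Lipschitz estimate at 1 with a constant depending only on \<open>A\<close>. The full
  group controls norms; the group without the identity controls inverses.\<close>

lemma ht_prod_near_1:
  assumes "A \<subseteq> G"
  shows "\<exists>D\<ge>0. \<forall>t \<eta>. 0 \<le> t \<longrightarrow> t \<le> 1 \<longrightarrow> \<eta> \<in> K \<longrightarrow> ht \<eta> \<le> t \<longrightarrow> ht ((\<Prod>\<sigma>\<in>A. 1 + \<sigma> \<eta>) - 1) \<le> D * t"
  using finite_subset[OF assms finite_G] assms
proof (induction A rule: finite_induct)
  case empty
  then show ?case by (intro exI[of _ 0]) simp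
next
  case (insert \<sigma> A)
  then obtain D where D: "D \<ge> 0"
    "\<And>t \<eta>. 0 \<le> t \<Longrightarrow> t \<le> 1 \<Longrightarrow> \<eta> \<in> K \<Longrightarrow> ht \<eta> \<le> t \<Longrightarrow> ht ((\<Prod>\<sigma>\<in>A. 1 + \<sigma> \<eta>) - 1) \<le> D * t" by auto
  have s: "\<sigma> \<in> G" and AG: "A \<subseteq> G" using insert by auto
  define E where "E = hC * (1 + hC) * D + hC"
  have "ht ((\<Prod>\<sigma>\<in>insert \<sigma> A. 1 + \<sigma> \<eta>) - 1) \<le> E * t" if t: "0 \<le> t" "t \<le> 1" and h: "\<eta> \<in> K" "ht \<eta> \<le> t" for t \<eta>
  proof -
    define P where "P = (\<Prod>\<sigma>\<in>A. 1 + \<sigma> \<eta>)"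
    have sh: "\<sigma> \<eta> \<in> K" "1 + \<sigma> \<eta> \<in> K" using G_closed[OF s h(1)] K_ops by auto
    have "P \<in> K" unfolding P_def
      by (rule subfield_prod[OF subfield]) (use AG G_closed[OF _ h(1)] K_ops(1,6) in blast)
    then have P: "P - 1 \<in> K" using K_ops by blast
    have hs: "ht (\<sigma> \<eta>) \<le> hC * t"
      using ht_G[OF s h(1)] mult_left_mono[OF h(2), of hC] hC_ge_1 by linarith
    have hs1: "ht (1 + \<sigma> \<eta>) \<le> 1 + hC"
    proof -
      have "hC * t \<le> hC * 1" by (rule mult_left_mono[OF t(2)]) (use hC_ge_1 in simp)
      then show ?thesis using ht_add[OF K_ops(6) sh(1)] hs by simp
    qed
    have "(\<Prod>\<sigma>\<in>insert \<sigma> A. 1 + \<sigma> \<eta>) - 1 = (1 + \<sigma> \<eta>) * (P - 1) + \<sigma> \<eta>"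
      using insert.hyps by (simp add: P_def algebra_simps)
    then have "ht ((\<Prod>\<sigma>\<in>insert \<sigma> A. 1 + \<sigma> \<eta>) - 1) \<le> ht ((1 + \<sigma> \<eta>) * (P - 1)) + ht (\<sigma> \<eta>)"
      using ht_add[OF K_ops(3)[OF sh(2) P] sh(1)] by simp
    also have "\<dots> \<le> hC * ht (1 + \<sigma> \<eta>) * ht (P - 1) + hC * t"
      using ht_mult[OF sh(2) P] hs by simp
    also have "hC * ht (1 + \<sigma> \<eta>) * ht (P - 1) \<le> (hC * (1 + hC)) * (D * t)"
      using hs1 D(2)[OF t h] hC_ge_1 unfolding P_def[symmetric] by (intro mult_mono) auto
    finally show ?thesis by (simp add: E_def algebra_simps)
  qed
  moreover have "E \<ge> 0" using D(1) hC_ge_1 by (simp add: E_def)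
  ultimately show ?case by blast
qed

text \<open>Being congruent to 1 modulo \<open>dlt\<close> keeps the norms of these elements coprime to the bad primes, and
  the factor 8 between consecutive scales separates the norms of different regions.\<close>

definition reg :: "nat \<Rightarrow> nat \<Rightarrow> 'a set" where
  "reg q j = (\<lambda>t. 1 + of_int dlt * (of_nat (q * 8 ^ j) + (\<Sum>b\<in>B. of_nat (t b) * b))) ` PiE B (\<lambda>_. {..<8 ^ j})"

lemma reg_cong_1: "a \<in> reg q j \<Longrightarrow> \<exists>y\<in>OK. a = 1 + of_int dlt * y"
proof -
  assume "a \<in> reg q j"
  then obtain t where "a = 1 + of_int dlt * (of_nat (q * 8 ^ j) + (\<Sum>b\<in>B. of_nat (t b) * b))"
    unfolding reg_def by blast
  moreover have "of_nat (q * 8 ^ j) + (\<Sum>b\<in>B. of_nat (t b) * b) \<in> OK"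
    by (intro OK_add OK_of_nat OK_sum OK_mult B_OK)
  ultimately show ?thesis by blast
qed

lemma reg_OK: "a \<in> reg q j \<Longrightarrow> a \<in> OK"
  using reg_cong_1 OK_add[OF OK_1 OK_mult[OF OK_of_int]] by blast

lemma finite_reg: "finite (reg q j)"
  unfolding reg_def using finite_B by (intro finite_imageI finite_PiE) auto

lemma card_reg: "card (reg q j) = 8 ^ (j * card G)"
proof -
  have "inj_on (\<lambda>t. 1 + of_int dlt * (of_nat (q * 8 ^ j) + (\<Sum>b\<in>B. of_nat (t b) * b))) (PiE B (\<lambda>_. {..<8 ^ j}))"
  proof (rule inj_onI)
    fix t t' :: "'a \<Rightarrow> nat"
    assume t: "t \<in> PiE B (\<lambda>_. {..<8 ^ j})" "t' \<in> PiE B (\<lambda>_. {..<8 ^ j})"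
      and "1 + of_int dlt * (of_nat (q * 8 ^ j) + (\<Sum>b\<in>B. of_nat (t b) * b))
        = 1 + of_int dlt * (of_nat (q * 8 ^ j) + (\<Sum>b\<in>B. of_nat (t' b) * b))"
    then have e: "(\<Sum>b\<in>B. of_nat (t b) * b) = (\<Sum>b\<in>B. of_nat (t' b) * b)" using dlt_pos by simp
    have "t b = t' b" if "b \<in> B" for b
      using co_unique[OF that, of "\<lambda>b. of_nat (t b)"] co_unique[OF that, of "\<lambda>b. of_nat (t' b)"] e by simp
    then show "t = t'" using t by (intro PiE_ext) auto
  qed
  then have "card (reg q j) = card (PiE B (\<lambda>_. {..<8 ^ j} :: nat set))" unfolding reg_def by (rule card_image)
  also have "\<dots> = 8 ^ (j * card G)" using finite_B by (simp add: card_PiE card_G power_mult)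
  finally show ?thesis .
qed

text \<open>Conjugation preserves congruence to 1 modulo \<open>dlt\<close>. So for \<open>p\<close>
  dividing \<open>dlt\<close> no conjugate of \<open>a\<close> lies in \<open>prm p\<close>, and
  neither does the norm.\<close>

lemma reg_good:
  assumes a: "a \<in> reg q j" and p: "prime p" "int p dvd nrm a"
  shows "good p"
proof (rule ccontr)
  assume "\<not> good p"
  then have d: "int p dvd dlt" using p by (simp add: good_def)
  note M = prm(1)[OF p(1)] and I = maxi_idl[OF prm(1)[OF p(1)]]
  obtain y where y: "y \<in> OK" "a = 1 + of_int dlt * y" using reg_cong_1[OF a] by blast
  have aO: "a \<in> OK" using reg_OK a by blast
  have "of_int (nrm a) \<in> prm p" using p prm_int_iff by blast
  then have "(\<Prod>\<sigma>\<in>G. \<sigma> a) \<in> prm p" using of_int_nrm[OF aO] by simp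
  then obtain \<sigma> where s: "\<sigma> \<in> G" "\<sigma> a \<in> prm p"
    using maxi_prod[OF M finite_G, of "\<lambda>\<sigma>. \<sigma> a"] G_OK[OF _ aO] by blast
  have "\<sigma> a = 1 + of_int dlt * \<sigma> y" unfolding y(2)
    using G_add[OF s(1) K_ops(6) K_ops(3)[OF K_of_int OK_K[OF y(1)]]]
      G_mult[OF s(1) K_of_int OK_K[OF y(1)]] G_1[OF s(1)] G_of_int[OF s(1)] by simp
  moreover have "of_int dlt * \<sigma> y \<in> prm p"
    by (rule idlD(5)[OF I G_OK[OF s(1) y(1)]]) (use d prm_int_iff[OF p(1)] in blast)
  ultimately show False using s(2) idlD(6)[OF I, of "\<sigma> a" "of_int dlt * \<sigma> y"] maxi_1[OF M] by simp
qed

text \<open>Up to the rational factor m = dlt q 8^j, every element of a region is close to 1. Its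
  norm is then m^n up to a factor between 1/2 and 2, and a quotient of two elements has bounded
  height, which leaves finitely many integral quotients.\<close>

lemma region_properties:
  "\<exists>q c M::nat. q > 0 \<and> c > 0 \<and> (\<forall>j. \<forall>a\<in>reg q j. real c * 8 ^ (j * card G) / 2 \<le> \<bar>real_of_int (nrm a)\<bar>
      \<and> \<bar>real_of_int (nrm a)\<bar> \<le> 2 * real c * 8 ^ (j * card G)
      \<and> card {b \<in> reg q j. \<exists>u\<in>OK. b = a * u} \<le> M)"
proof -
  define n where "n = card G"
  have n0: "n > 0" using card_B_pos card_G by (simp add: n_def)
  obtain D where D: "D \<ge> 0"
    "\<And>t \<eta>. 0 \<le> t \<Longrightarrow> t \<le> 1 \<Longrightarrow> \<eta> \<in> K \<Longrightarrow> ht \<eta> \<le> t \<Longrightarrow> ht ((\<Prod>\<sigma>\<in>G. 1 + \<sigma> \<eta>) - 1) \<le> D * t"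
    using ht_prod_near_1[OF subset_refl] by blast
  obtain D' where D': "D' \<ge> 0"
    "\<And>t \<eta>. 0 \<le> t \<Longrightarrow> t \<le> 1 \<Longrightarrow> \<eta> \<in> K \<Longrightarrow> ht \<eta> \<le> t \<Longrightarrow> ht ((\<Prod>\<sigma>\<in>G - {id}. 1 + \<sigma> \<eta>) - 1) \<le> D' * t"
    using ht_prod_near_1[of "G - {id}"] by blast
  \<comment> \<open>The deviation from 1 will have height at most t = (n + 1) / q, and this
    \<open>q\<close> makes both t <= 1 and D t <= 1/2.\<close>
  obtain q :: nat where q: "(real n + 1) * (2 * D + 1) < real q" using reals_Archimedean2 by blast
  have "0 \<le> (real n + 1) * (2 * D + 1)" using D by simp
  then have q0: "q > 0" using q by (metis of_nat_0_less_iff order_le_less_trans)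
  define t where "t = (real n + 1) / real q"
  have "(real n + 1) \<le> (real n + 1) * (2 * D + 1)" using D n0 by simp
  then have t: "0 \<le> t" "t \<le> 1" using q q0 by (auto simp: t_def field_simps)
  have Dt: "D * t \<le> 1 / 2" using q q0 n0 by (simp add: t_def field_simps)
  define c where "c = (nat dlt * q) ^ n"
  have c0: "c > 0" using dlt_pos q0 by (simp add: c_def)
  \<comment> \<open>The bound is \<open>hC\<close> times the height 2 of one normalized element
    times the height 2 (1 + D') of the inverse of another.\<close>
  define U where "U = {x \<in> OK. ht x \<le> hC * 2 * (2 * (1 + D'))}"
  have finU: "finite U" unfolding U_def by (rule finite_bounded_height)
  have main: "\<exists>y\<in>K. y \<noteq> 0 \<and> a = of_nat (nat dlt * q * 8 ^ j) * y \<and> ht y \<le> 2 \<and> ht (inverse y) \<le> 2 * (1 + D') \<and>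
     real c * 8 ^ (j * n) / 2 \<le> \<bar>real_of_int (nrm a)\<bar> \<and> \<bar>real_of_int (nrm a)\<bar> \<le> 2 * real c * 8 ^ (j * n)"
    if a: "a \<in> reg q j" for a j
  proof -
    have aO: "a \<in> OK" using reg_OK a by blast
    obtain s where s: "s \<in> PiE B (\<lambda>_. {..<8 ^ j})"
      "a = 1 + of_int dlt * (of_nat (q * 8 ^ j) + (\<Sum>b\<in>B. of_nat (s b) * b))" using a unfolding reg_def by blast
    define m where "m = nat dlt * q * 8 ^ j"
    have m0: "m > 0" using dlt_pos q0 by (simp add: m_def)
    \<comment> \<open>So that a = m (1 + \<eta>): the summand 1 of \<open>a\<close> gives 1/m, at
      most 1/q, and each of the \<open>n\<close> coordinates gives at most 1/q, in total at most
      \<open>t\<close>.\<close>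
    define \<eta> where "\<eta> = of_rat (1 / of_nat m) + (\<Sum>b\<in>B. of_rat (of_nat (s b) / of_nat (q * 8 ^ j)) * b)"
    have sK: "(\<Sum>b\<in>B. of_rat (of_nat (s b) / of_nat (q * 8 ^ j)) * b) \<in> K"
      by (intro subfield_sum[OF subfield] K_ops B_K)
    have hK: "\<eta> \<in> K" unfolding \<eta>_def by (intro K_ops sK)
    define y where "y = 1 + \<eta>"
    have yK: "y \<in> K" unfolding y_def by (intro K_ops hK)
    have dltm: "(of_nat m :: 'a) = of_int dlt * of_nat (q * 8 ^ j)" using dlt_pos by (simp add: m_def)
    have "of_nat m * \<eta> = 1 + (\<Sum>b\<in>B. of_nat m * of_rat (of_nat (s b) / of_nat (q * 8 ^ j)) * b)"
      using m0 by (simp add: \<eta>_def ring_distribs sum_distrib_left of_rat_divide mult.assoc)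
    also have "(\<Sum>b\<in>B. of_nat m * of_rat (of_nat (s b) / of_nat (q * 8 ^ j)) * b)
        = of_int dlt * (\<Sum>b\<in>B. of_nat (s b) * b)"
      unfolding sum_distrib_left using q0 by (intro sum.cong refl) (simp add: dltm of_rat_divide of_rat_mult of_rat_power)
    finally have ay: "a = of_nat m * y"
      by (simp add: s(2) y_def ring_distribs dltm)
    have "ht \<eta> \<le> 1 / real m + (\<Sum>b\<in>B. \<bar>real_of_rat (of_nat (s b) / of_nat (q * 8 ^ j))\<bar> * ht b)"
    proof -
      have "ht (of_rat (1 / of_nat m)) = 1 / real m" by (simp only: ht_of_rat) (simp add: of_rat_divide)
      then show ?thesis unfolding \<eta>_def
        using ht_add[OF K_ops(7)[of "1 / of_nat m"] sK]
          ht_lin_comb[of "\<lambda>b. b" "\<lambda>b. of_nat (s b) / of_nat (q * 8 ^ j)", OF B_K] by linarith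
    qed
    also have "1 / real m \<le> 1 / real q"
    proof -
      have "1 \<le> nat dlt * 8 ^ j" using dlt_pos by simp
      then have "q * 1 \<le> q * (nat dlt * 8 ^ j)" by (rule mult_le_mono2)
      then have "q \<le> m" by (simp add: m_def mult_ac)
      then show ?thesis using q0 by (simp add: frac_le)
    qed
    also have "(\<Sum>b\<in>B. \<bar>real_of_rat (of_nat (s b) / of_nat (q * 8 ^ j))\<bar> * ht b) \<le> (\<Sum>b\<in>B. 1 / real q)"
    proof (intro sum_mono)
      fix b assume b: "b \<in> B"
      have "s b < 8 ^ j" using s b by (auto simp: PiE_def Pi_def)
      then have "real (s b) \<le> 8 ^ j" by (metis less_imp_le of_nat_le_iff of_nat_numeral of_nat_power)
      then have "real (s b) / (real q * 8 ^ j) \<le> 1 / real q" using q0 by (simp add: field_simps)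
      then show "\<bar>real_of_rat (of_nat (s b) / of_nat (q * 8 ^ j))\<bar> * ht b \<le> 1 / real q"
        using ht_basis[OF b] by (simp add: of_rat_divide of_rat_mult of_rat_power)
    qed
    finally have ht: "ht \<eta> \<le> t" by (simp add: t_def n_def card_G add_divide_distrib)
    define P where "P = (\<Prod>\<sigma>\<in>G. \<sigma> y)"
    have sy: "\<sigma> y = 1 + \<sigma> \<eta>" if "\<sigma> \<in> G" for \<sigma>
      unfolding y_def using G_add[OF that K_ops(6) hK] G_1[OF that] by simp
    have P1: "ht (P - 1) \<le> 1 / 2" using D(2)[OF t hK ht] Dt sy by (simp add: P_def)
    have nP: "of_int (nrm a) = of_nat m ^ n * P"
    proof -
      have "\<sigma> a = of_nat m * \<sigma> y" if "\<sigma> \<in> G" for \<sigma>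
        unfolding ay using G_mult[OF that K_of_nat yK] G_of_nat[OF that] by simp
      then have "of_int (nrm a) = (\<Prod>\<sigma>\<in>G. of_nat m * \<sigma> y)" unfolding of_int_nrm[OF aO]
        by (intro prod.cong refl)
      then show ?thesis by (simp add: prod.distrib P_def n_def)
    qed
    \<comment> \<open>\<open>P\<close> is the rational number norm / m^n, so its height distance
      from 1 is an ordinary absolute value.\<close>
    define r where "r = (of_int (nrm a) / of_nat m ^ n :: rat)"
    have Pr: "P = of_rat r" using nP m0 by (simp add: r_def of_rat_divide of_rat_power)
    have "P - 1 = of_rat (r - 1)" by (simp add: Pr of_rat_diff)
    then have "\<bar>real_of_rat r - 1\<bar> \<le> 1 / 2" using P1 ht_of_rat[of "r - 1"] by (simp add: of_rat_diff)
    then have r: "1 / 2 \<le> real_of_rat r" "real_of_rat r \<le> 2" by linarith+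
    have nr: "real_of_int (nrm a) = real m ^ n * real_of_rat r"
      using m0 by (simp add: r_def of_rat_divide of_rat_power)
    have mn: "real m ^ n = real c * 8 ^ (j * n)"
      by (simp add: m_def c_def power_mult_distrib power_mult)
    have mp: "real m ^ n > 0" using m0 by simp
    have absn: "\<bar>real_of_int (nrm a)\<bar> = real c * 8 ^ (j * n) * real_of_rat r"
    proof -
      have "0 \<le> real_of_rat r" using r(1) by linarith
      then have "0 \<le> real c * 8 ^ (j * n) * real_of_rat r" by (rule mult_nonneg_nonneg[rotated]) simp
      then show ?thesis unfolding nr mn by (rule abs_of_nonneg)
    qed
    have cp: "0 \<le> real c * 8 ^ (j * n)" by simp
    have low: "real c * 8 ^ (j * n) / 2 \<le> \<bar>real_of_int (nrm a)\<bar>"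
      using mult_left_mono[OF r(1) cp] by (simp add: absn)
    have up: "\<bar>real_of_int (nrm a)\<bar> \<le> 2 * real c * 8 ^ (j * n)"
      using mult_left_mono[OF r(2) cp] by (simp add: absn)
    have y0: "y \<noteq> 0"
    proof
      assume "y = 0"
      then have "nrm a = 0" using ay nrm_eq_0_iff[OF aO] by simp
      then have "real c * 8 ^ (j * n) \<le> 0" using low by simp
      moreover have "0 < real c * 8 ^ (j * n)" using c0 by simp
      ultimately show False by linarith
    qed
    have hy: "ht y \<le> 2" unfolding y_def using ht_add[OF K_ops(6) hK] ht t(2) by simp
    define V where "V = (\<Prod>\<sigma>\<in>G - {id}. \<sigma> y)"
    have VK: "V \<in> K" unfolding V_def by (rule subfield_prod[OF subfield]) (use G_closed[OF _ yK] in blast)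
    have PV: "P = y * V" unfolding P_def V_def by (subst prod.remove[OF finite_G id_G]) simp
    have r0: "r \<noteq> 0" using r(1) by auto
    \<comment> \<open>The inverse of \<open>y\<close> is the product of its other conjugates divided
      by \<open>r\<close>; this is why the product without the identity was estimated.\<close>
    have "V = of_rat r * inverse y" using PV Pr y0 by (simp add: field_simps)
    then have "inverse y = of_rat (1 / r) * V" using r0 by (simp add: of_rat_divide)
    then have "ht (inverse y) = \<bar>real_of_rat (1 / r)\<bar> * ht V" using ht_scale[OF VK] by simp
    also have "\<dots> \<le> 2 * (1 + D')"
    proof (intro mult_mono)
      define \<rho> where "\<rho> = real_of_rat r"
      have "real_of_rat (1 / r) = 1 / \<rho>" by (simp add: of_rat_divide \<rho>_def)
      moreover have "0 < \<rho>" "1 / \<rho> \<le> 2" using r(1) unfolding \<rho>_def[symmetric] by (simp_all add: field_simps)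
      ultimately show "\<bar>real_of_rat (1 / r)\<bar> \<le> 2" by simp
      have "V = (\<Prod>\<sigma>\<in>G - {id}. 1 + \<sigma> \<eta>)" unfolding V_def using sy by (intro prod.cong refl) blast
      then have "ht (V - 1) \<le> D' * t" using D'(2)[OF t hK ht] by simp
      then have "ht (V - 1) \<le> D'" using mult_left_mono[OF t(2) D'(1)] by simp
      then show "ht V \<le> 1 + D'" using ht_add[OF K_ops(6) K_ops(2)[OF VK K_ops(6)]] by simp
    qed auto
    finally show ?thesis using yK y0 ay hy low up unfolding m_def by blast
  qed
  have "card {b \<in> reg q j. \<exists>u\<in>OK. b = a * u} \<le> card U" if a: "a \<in> reg q j" for a j
  proof -
    obtain y where y: "y \<in> K" "y \<noteq> 0" "a = of_nat (nat dlt * q * 8 ^ j) * y" "ht (inverse y) \<le> 2 * (1 + D')"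
      using main[OF a] by blast
    have "b \<in> (\<lambda>u. a * u) ` U" if b: "b \<in> reg q j" "u \<in> OK" "b = a * u" for b u
    proof -
      obtain z where z: "z \<in> K" "b = of_nat (nat dlt * q * 8 ^ j) * z" "ht z \<le> 2"
        using main[OF b(1)] by blast
      have "of_nat (nat dlt * q * 8 ^ j) * z = of_nat (nat dlt * q * 8 ^ j) * (y * u)"
        using b(3) y(3) z(2) by (simp add: mult.assoc)
      then have "z = y * u" using dlt_pos q0 by simp
      then have "u = z * inverse y" using y(2) by simp
      then have "ht u \<le> hC * ht z * ht (inverse y)" using ht_mult[OF z(1) K_ops(4)[OF y(1)]] by simp
      also have "\<dots> \<le> hC * 2 * (2 * (1 + D'))"
        using z y hC_ge_1 by (intro mult_mono) auto
      finally show ?thesis using b by (auto simp: U_def)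
    qed
    then have "{b \<in> reg q j. \<exists>u\<in>OK. b = a * u} \<subseteq> (\<lambda>u. a * u) ` U" by blast
    then show ?thesis using finU by (meson card_image_le card_mono finite_imageI le_trans)
  qed
  then show ?thesis using main q0 c0 unfolding n_def[symmetric] by blast
qed

end

subsection \<open>A lower bound for the sum over split primes\<close>

lemma nat_eq_prod_prime_powers:
  fixes m Z :: nat
  assumes "m > 0" "m \<le> Z"
  shows "m = (\<Prod>p\<in>{p. prime p \<and> p \<le> Z}. p ^ multiplicity p m)"
proof -
  have "m = (\<Prod>p\<in>prime_factors m. p ^ multiplicity p m)" using prime_factorization_nat[OF assms(1)] .
  also have "\<dots> = (\<Prod>p\<in>{p. prime p \<and> p \<le> Z}. p ^ multiplicity p m)"
  proof (rule prod.mono_neutral_left)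
    show "prime_factors m \<subseteq> {p. prime p \<and> p \<le> Z}"
      using assms by (auto simp: in_prime_factors_iff intro: order_trans[OF dvd_imp_le])
    show "\<forall>p\<in>{p. prime p \<and> p \<le> Z} - prime_factors m. p ^ multiplicity p m = 1"
      using assms by (auto simp: in_prime_factors_iff not_dvd_imp_multiplicity_0)
  qed simp
  finally show ?thesis .
qed

lemma sum_inverse_squares_le: "(\<Sum>k\<in>{1..n}. 1 / (real k) ^ 2) \<le> 2"
proof -
  have "(\<Sum>k\<in>{1..Suc n}. 1 / (real k) ^ 2) \<le> 2 - 1 / real (Suc n)" for n
  proof (induction n)
    case (Suc n)
    define x where "x = real (Suc n)"
    have x: "x > 0" by (simp add: x_def)
    have "1 / (x + 1) ^ 2 \<le> 1 / (x * (x + 1))"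
      using x by (intro divide_left_mono) (auto simp: power2_eq_square)
    also have "\<dots> = 1 / x - 1 / (x + 1)" using x by (simp add: field_simps)
    finally have "1 / (x + 1) ^ 2 \<le> 1 / x - 1 / (x + 1)" .
    moreover have "real (Suc (Suc n)) = x + 1" by (simp add: x_def)
    ultimately have "1 / (real (Suc (Suc n))) ^ 2 \<le> 1 / x - 1 / real (Suc (Suc n))" by (simp only:)
    then show ?case using Suc unfolding x_def by simp
  qed simp
  note le = this
  show ?thesis
  proof (cases n)
    case (Suc m)
    have "0 \<le> 1 / real (Suc m)" by simp
    then show ?thesis using le[of m] unfolding Suc by linarith
  qed simp
qed

lemma multiplicity_nat_abs:
  assumes "prime p" "k \<noteq> 0"
  shows "multiplicity p (nat \<bar>k\<bar>) = multiplicity (int p) k"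
proof (rule multiplicity_eqI)
  have nu: "\<not> is_unit (int p)" using assms prime_gt_1_nat by force
  have eq: "p ^ i dvd nat \<bar>k\<bar> \<longleftrightarrow> int p ^ i dvd k" for i
  proof -
    have "p ^ i dvd nat \<bar>k\<bar> \<longleftrightarrow> int (p ^ i) dvd int (nat \<bar>k\<bar>)" by (simp only: int_dvd_int_iff)
    then show ?thesis by simp
  qed
  show "p ^ multiplicity (int p) k dvd nat \<bar>k\<bar>" unfolding eq by (rule multiplicity_dvd)
  show "\<not> p ^ Suc (multiplicity (int p) k) dvd nat \<bar>k\<bar>" unfolding eq
    using nu assms multiplicity_decompose'[of k "int p"]
    by (metis multiplicity_geI not_less_eq_eq order_refl)
qed

text \<open>Here \<open>e\<close> runs through patterns of valuations at the conjugates. Total 0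
  gives 1, total 1 gives at most \<open>card G\<close> terms 1/p and only if allowed by
  \<open>S\<close>, and the larger totals give O(1/p^2).\<close>

lemma euler_factor_bound:
  fixes G :: "'b set" and p Bd :: nat
  assumes G: "finite G" and p: "p \<ge> 2"
  shows "(\<Sum>e\<in>{e\<in>PiE G (\<lambda>_. {..Bd}). S \<or> sum e G \<noteq> 1}. (1 / real p) ^ sum e G)
    \<le> 1 + (if S then real (card G) / real p else 0) + 4 * 2 ^ card G * (1 / (real p) ^ 2)"
proof -
  define E where "E = PiE G (\<lambda>_. {..Bd})"
  define E' where "E' = {e\<in>E. S \<or> sum e G \<noteq> 1}"
  have finE: "finite E" unfolding E_def using G by (intro finite_PiE) auto
  then have finE': "finite E'" by (simp add: E'_def)
  define x where "x = 1 / real p"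
  have x: "0 \<le> x" "x \<le> 1 / 2" using p by (auto simp: x_def field_simps)
  \<comment> \<open>For s >= 2 the factor x^(s-2) is at most (1/2)^(s-2), which is 4 (1/2)^s. The
    powers of 1/2 make the sum over all patterns converge.\<close>
  have summand: "x ^ s \<le> (if s = 0 then 1 else 0) + (if s = 1 then x else 0) + 4 * x ^ 2 * (1 / 2) ^ s" for s
  proof (cases "s < 2")
    case True
    then have "s = 0 \<or> s = 1" by auto
    then show ?thesis by auto
  next
    case False
    then obtain r where r: "s = r + 2" by (metis add.commute le_Suc_ex not_less)
    have "x ^ s = x ^ 2 * x ^ r" by (simp only: r power_add mult.commute)
    also have "\<dots> \<le> x ^ 2 * (1 / 2) ^ r" using x by (intro mult_left_mono power_mono) auto
    also have "\<dots> = 4 * x ^ 2 * (1 / 2) ^ s"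
    proof -
      have "(1 / 2 :: real) ^ s = (1 / 2) ^ r * (1 / 4)" unfolding r power_add by (simp add: power2_eq_square)
      then show ?thesis by simp
    qed
    finally show ?thesis using False by simp
  qed
  have "(\<Sum>e\<in>E'. x ^ sum e G) \<le> (\<Sum>e\<in>E'. (if sum e G = 0 then 1 else 0)
      + (if sum e G = 1 then x else 0) + 4 * x ^ 2 * (1 / 2) ^ sum e G)"
    by (intro sum_mono summand)
  also have "\<dots> = (\<Sum>e\<in>E'. if sum e G = 0 then 1 else 0) + (\<Sum>e\<in>E'. if sum e G = 1 then x else 0)
      + 4 * x ^ 2 * (\<Sum>e\<in>E'. (1 / 2) ^ sum e G)"
    by (simp add: sum.distrib sum_distrib_left)
  finally have total: "(\<Sum>e\<in>E'. x ^ sum e G) \<le> (\<Sum>e\<in>E'. if sum e G = 0 then 1 else 0)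
      + (\<Sum>e\<in>E'. if sum e G = 1 then x else 0) + 4 * x ^ 2 * (\<Sum>e\<in>E'. (1 / 2) ^ sum e G)" .
  have h0: "(\<Sum>e\<in>E'. if sum e G = 0 then 1 else 0) \<le> (1::real)"
  proof -
    have "e = restrict (\<lambda>_. 0) G" if "e \<in> E" "sum e G = 0" for e
      using that G by (intro extensionalityI[of e G]) (auto simp: E_def PiE_def)
    then have "{e\<in>E'. sum e G = 0} \<subseteq> {restrict (\<lambda>_. 0) G}" by (auto simp: E'_def)
    from card_mono[OF _ this] have "card {e\<in>E'. sum e G = 0} \<le> 1" by simp
    then show ?thesis using finE' by (simp add: sum.If_cases Int_def)
  qed
  have h1: "(\<Sum>e\<in>E'. if sum e G = 1 then x else 0) \<le> (if S then real (card G) / real p else 0)"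
  proof (cases S)
    case False
    then show ?thesis by (auto simp: E'_def intro!: sum_nonpos)
  next
    case True
    have "e \<in> (\<lambda>\<sigma>. restrict (\<lambda>\<tau>. if \<tau> = \<sigma> then 1 else 0) G) ` G" if e: "e \<in> E" "sum e G = 1" for e
    proof -
      obtain \<sigma> where s: "\<sigma> \<in> G" "e \<sigma> = 1" "\<forall>\<tau>\<in>G. \<tau> \<noteq> \<sigma> \<longrightarrow> e \<tau> = 0"
        using e(2) sum_eq_1_iff[OF G, of e] by auto
      have "e = restrict (\<lambda>\<tau>. if \<tau> = \<sigma> then 1 else 0) G"
        using e(1) s by (intro extensionalityI[of e G]) (auto simp: E_def PiE_def)
      then show ?thesis using s by blast
    qed
    then have "{e\<in>E'. sum e G = 1} \<subseteq> (\<lambda>\<sigma>. restrict (\<lambda>\<tau>. if \<tau> = \<sigma> then 1 else 0) G) ` G" by (auto simp: E'_def)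
    then have "card {e\<in>E'. sum e G = 1} \<le> card G"
      using G by (meson card_image_le card_mono finite_imageI le_trans)
    then have "real (card {e\<in>E'. sum e G = 1}) * x \<le> real (card G) * x"
      using x by (intro mult_right_mono) auto
    then show ?thesis using finE' True by (simp add: sum.If_cases Int_def x_def)
  qed
  have "(\<Sum>e\<in>E'. (1 / 2) ^ sum e G) \<le> (2::real) ^ card G"
  proof -
    have "(\<Sum>e\<in>E'. (1 / 2 :: real) ^ sum e G) \<le> (\<Sum>e\<in>E. (1 / 2) ^ sum e G)"
      using finE by (intro sum_mono2) (auto simp: E'_def)
    also have "\<dots> = (\<Sum>e\<in>E. \<Prod>\<sigma>\<in>G. (1 / 2) ^ e \<sigma>)" by (simp only: power_sum)
    also have "\<dots> = (\<Prod>\<sigma>\<in>G. \<Sum>k\<in>{..Bd}. (1 / 2) ^ k)" unfolding E_def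
      using G by (intro prod_sum_PiE[symmetric]) auto
    also have "\<dots> \<le> (\<Prod>\<sigma>\<in>G. 2)"
    proof (intro prod_mono conjI)
      have "(\<Sum>k\<in>{..Bd}. (1 / 2 :: real) ^ k) = 2 - (1 / 2) ^ Bd" by (induction Bd) auto
      then show "(\<Sum>k\<in>{..Bd}. (1 / 2 :: real) ^ k) \<le> 2" by simp
    qed (auto intro: sum_nonneg)
    finally show ?thesis by simp
  qed
  then have h2: "4 * x ^ 2 * (\<Sum>e\<in>E'. (1 / 2) ^ sum e G) \<le> 4 * x ^ 2 * 2 ^ card G"
    by (intro mult_left_mono) auto
  have x2: "x ^ 2 = 1 / (real p) ^ 2" by (simp add: x_def power_one_over)
  have "(\<Sum>e\<in>E'. x ^ sum e G) \<le> 1 + (if S then real (card G) / real p else 0) + 4 * x ^ 2 * 2 ^ card G"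
    using total h0 h1 h2 by linarith
  then show ?thesis unfolding x2 unfolding E'_def E_def x_def by (simp only: mult_ac)
qed

section \<open>Counting elements by their valuation patterns\<close>

context galois_int
begin

definition spl :: "nat set" where "spl = {p. good p \<and> split p}"

definition rec_sum :: "nat \<Rightarrow> real" where "rec_sum Z = (\<Sum>p\<in>{p\<in>spl. p \<le> Z}. 1 / real p)"

text \<open>Each scale has 8^(j n) elements of norm at most 2 c 8^(j n), so \<open>J\<close> scales
  give a sum of inverse norms of at least J / (2 c). An element is determined by its valuations up
  to \<open>M\<close> choices, which bounds the same sum by \<open>M\<close> times an Euler product
  over the split primes.\<close>

lemma lower_bound:
  "\<exists>c>0. \<exists>Z0::nat. Z0 > 0 \<and> (\<forall>J::nat. c * real J \<le> exp (real (card G) * rec_sum (Z0 * 8 ^ (J * card G))))"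
proof -
  define n where "n = card G"
  have n0: "n > 0" using card_B_pos card_G by (simp add: n_def)
  obtain q c M :: nat where q: "q > 0" and c: "c > 0"
    and low: "\<And>j a. a \<in> reg q j \<Longrightarrow> real c * 8 ^ (j * n) / 2 \<le> \<bar>real_of_int (nrm a)\<bar>"
    and up: "\<And>j a. a \<in> reg q j \<Longrightarrow> \<bar>real_of_int (nrm a)\<bar> \<le> 2 * real c * 8 ^ (j * n)"
    and M: "\<And>j a. a \<in> reg q j \<Longrightarrow> card {b \<in> reg q j. \<exists>u\<in>OK. b = a * u} \<le> M"
    using region_properties unfolding n_def[symmetric] by blast
  have rn0: "nrm a \<noteq> 0" if "a \<in> reg q j" for a j
  proof
    assume "nrm a = 0"
    then have "real c * 8 ^ (j * n) / 2 \<le> 0" using low[OF that] by simp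
    moreover have "0 < real c * 8 ^ (j * n)" using c by simp
    ultimately show False by linarith
  qed
  have ra0: "a \<noteq> 0" if "a \<in> reg q j" for a j using rn0[OF that] nrm_eq_0_iff[OF reg_OK[OF that]] by blast
  have main: "real J / (2 * real c) \<le> real M * exp (8 * 2 ^ n) * exp (real n * rec_sum (2 * c * 8 ^ (J * n)))" for J
  proof -
    \<comment> \<open>A bound for all norms that occur, hence for their prime factors.\<close>
    define Z where "Z = 2 * c * 8 ^ (J * n)"
    define Pr where "Pr = {p. prime p \<and> p \<le> Z}"
    have finPr: "finite Pr" by (simp add: Pr_def)
    define I where "I = Sigma {..<J} (reg q)"
    have finI: "finite I" unfolding I_def using finite_reg by auto
    \<comment> \<open>The default 0 at bad primes is the true exponent there, as the norms have no
      bad prime factors. The scale is not recorded; it will be recovered from the norm.\<close>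
    define d where "d = (\<lambda>(j::nat, a). restrict (\<lambda>p. restrict (\<lambda>\<sigma>. if good p then val p (\<sigma> a) else 0) G) Pr)"
    \<comment> \<open>Total exponent 1 at \<open>p\<close> forces \<open>p\<close> to split, so this
      pattern is barred at all other primes and their 1/p terms disappear.\<close>
    define E where "E p = {e\<in>PiE G (\<lambda>_. {..Z}). p \<in> spl \<or> sum e G \<noteq> 1}" for p
    define w where "w e = (\<Prod>p\<in>Pr. (1 / real p) ^ sum (e p) G)" for e :: "nat \<Rightarrow> ('a \<Rightarrow> 'a) \<Rightarrow> nat"
    have w0: "w e \<ge> 0" for e unfolding w_def by (intro prod_nonneg) auto
    have Iz: "nat \<bar>nrm a\<bar> \<le> Z" if "(j,a) \<in> I" for j a
    proof -
      have ja: "j < J" "a \<in> reg q j" using that by (auto simp: I_def)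
      have "j * n \<le> J * n" using ja by simp
      then have "(8::real) ^ (j * n) \<le> 8 ^ (J * n)" by (intro power_increasing) auto
      then have "2 * real c * 8 ^ (j * n) \<le> 2 * real c * 8 ^ (J * n)" by (intro mult_left_mono) auto
      then have "\<bar>real_of_int (nrm a)\<bar> \<le> real Z" using up[OF ja(2)] by (simp add: Z_def)
      then have "of_int \<bar>nrm a\<bar> \<le> real_of_int (int Z)" by simp
      then have "\<bar>nrm a\<bar> \<le> int Z" by (simp only: of_int_le_iff)
      then show ?thesis by simp
    qed
    have dmult: "sum (d (j,a) p) G = multiplicity p (nat \<bar>nrm a\<bar>)" if ja: "(j,a) \<in> I" and p: "p \<in> Pr" for j a p
    proof -
      have a: "a \<in> reg q j" using ja by (auto simp: I_def)
      have pp: "prime p" using p by (simp add: Pr_def)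
      have "sum (d (j,a) p) G = (\<Sum>\<sigma>\<in>G. if good p then val p (\<sigma> a) else 0)" using p by (simp add: d_def)
      also have "\<dots> = multiplicity (int p) (nrm a)"
      proof (cases "good p")
        case True then show ?thesis using multiplicity_nrm[OF True reg_OK[OF a] ra0[OF a]] by simp
      next
        case False
        then have "\<not> int p dvd nrm a" using reg_good[OF a pp] by blast
        then show ?thesis using False by (simp add: not_dvd_imp_multiplicity_0)
      qed
      finally show ?thesis using multiplicity_nat_abs[OF pp rn0[OF a]] by simp
    qed
    have wd: "1 / \<bar>real_of_int (nrm a)\<bar> = w (d (j,a))" if ja: "(j,a) \<in> I" for j a
    proof -
      have a: "a \<in> reg q j" using ja by (auto simp: I_def)
      have "nat \<bar>nrm a\<bar> = (\<Prod>p\<in>Pr. p ^ multiplicity p (nat \<bar>nrm a\<bar>))"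
        unfolding Pr_def using Iz[OF ja] rn0[OF a] by (intro nat_eq_prod_prime_powers) auto
      also have "\<dots> = (\<Prod>p\<in>Pr. p ^ sum (d (j,a) p) G)" using dmult[OF ja] by (intro prod.cong) auto
      finally have "real (nat \<bar>nrm a\<bar>) = real (\<Prod>p\<in>Pr. p ^ sum (d (j,a) p) G)" by (rule arg_cong)
      then have "\<bar>real_of_int (nrm a)\<bar> = (\<Prod>p\<in>Pr. real p ^ sum (d (j,a) p) G)" by simp
      then show ?thesis unfolding w_def by (simp add: power_one_over prod_dividef)
    qed
    have dE: "d i \<in> PiE Pr E" if i: "i \<in> I" for i
    proof -
      obtain j a where ja: "i = (j,a)" by (cases i)
      have a: "a \<in> reg q j" using i by (auto simp: I_def ja)
      have "d (j,a) p \<in> E p" if p: "p \<in> Pr" for p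
      proof -
        have pp: "prime p" using p by (simp add: Pr_def)
        have s: "sum (d (j,a) p) G = multiplicity p (nat \<bar>nrm a\<bar>)" using dmult[OF _ p] i ja by blast
        have le: "multiplicity p (nat \<bar>nrm a\<bar>) \<le> Z"
        proof -
          have "p ^ multiplicity p (nat \<bar>nrm a\<bar>) \<le> nat \<bar>nrm a\<bar>"
            using rn0[OF a] by (intro dvd_imp_le multiplicity_dvd) auto
          moreover have "multiplicity p (nat \<bar>nrm a\<bar>) < p ^ multiplicity p (nat \<bar>nrm a\<bar>)"
            using prime_gt_1_nat[OF pp] by (intro power_gt_expt) simp
          ultimately show ?thesis using Iz[of j a] i ja by simp
        qed
        have "d (j,a) p \<sigma> \<le> Z" if "\<sigma> \<in> G" for \<sigma>
          using member_le_sum[of \<sigma> G "d (j,a) p"] that finite_G le s by simp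
        moreover have "d (j,a) p \<in> extensional G" using p by (simp add: d_def)
        moreover have "p \<in> spl \<or> sum (d (j,a) p) G \<noteq> 1"
        proof (rule ccontr)
          assume nspl: "\<not> (p \<in> spl \<or> sum (d (j,a) p) G \<noteq> 1)"
          then have one: "sum (d (j,a) p) G = 1" by simp
          have g: "good p"
          proof (rule ccontr)
            assume "\<not> good p"
            then have "sum (d (j,a) p) G = 0" using p by (simp add: d_def)
            then show False using one by simp
          qed
          have "(\<Sum>\<sigma>\<in>G. val p (\<sigma> a)) = 1" using one p g by (simp add: d_def)
          then have "p \<in> spl" using sum_val_eq_1_imp_split[OF g reg_OK[OF a] ra0[OF a]] g by (simp add: spl_def)
          then show False using nspl by blast
        qed
        ultimately show ?thesis by (auto simp: E_def PiE_def)
      qed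
      moreover have "d (j,a) \<in> extensional Pr" by (simp add: d_def)
      ultimately show ?thesis by (auto simp: ja PiE_def)
    qed
    \<comment> \<open>Equal patterns give equal norms, which fix the scale, and equal valuations,
      which make one element a multiple of the other. A region contains at most \<open>M\<close>
      multiples of each of its elements.\<close>
    have fib: "card {i \<in> I. d i = e} \<le> M" if e: "e \<in> d ` I" for e
    proof -
      obtain j a where ja: "(j,a) \<in> I" "e = d (j,a)" using e by (metis imageE surj_pair)
      have a: "j < J" "a \<in> reg q j" using ja by (auto simp: I_def)
      have "{i \<in> I. d i = e} \<subseteq> (\<lambda>b. (j,b)) ` {b \<in> reg q j. \<exists>u\<in>OK. b = a * u}"
      proof
        fix i assume "i \<in> {i \<in> I. d i = e}"
        moreover obtain k b where kb: "i = (k,b)" by (cases i)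
        ultimately have kI: "(k,b) \<in> I" "d (k,b) = d (j,a)" using ja by auto
        have b: "b \<in> reg q k" using kI by (auto simp: I_def)
        have "1 / \<bar>real_of_int (nrm a)\<bar> = 1 / \<bar>real_of_int (nrm b)\<bar>" using wd[OF ja(1)] wd[OF kI(1)] kI(2) by simp
        then have nn: "\<bar>real_of_int (nrm a)\<bar> = \<bar>real_of_int (nrm b)\<bar>" by simp
        \<comment> \<open>Norms at scales k < l cannot agree: that would need 8^(l n) <= 4 * 8^(k
          n).\<close>
        have cmp: "\<not> k < l" if "real c * 8 ^ (l * n) / 2 \<le> 2 * real c * 8 ^ (k * n)" for k l
        proof
          assume "k < l"
          have "k * n + 1 \<le> k * n + n" using n0 by simp
          also have "\<dots> \<le> l * n" using \<open>k < l\<close> mult_le_mono1[of "Suc k" l n] by simp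
          finally have "(8::real) ^ (k * n + 1) \<le> 8 ^ (l * n)" by (intro power_increasing) auto
          then have "real c * (8 * 8 ^ (k * n)) \<le> real c * 8 ^ (l * n)" by (intro mult_left_mono) auto
          then have "real c * 8 ^ (k * n) \<le> 0" using that by simp
          moreover have "0 < real c * 8 ^ (k * n)" using c by simp
          ultimately show False by linarith
        qed
        have "\<not> k < j" "\<not> j < k"
          using low[OF a(2)] up[OF b] low[OF b] up[OF a(2)] nn by (intro cmp, linarith)+
        then have kj: "k = j" by simp
        have "\<exists>u\<in>OK. b = a * u"
        proof (rule dvd_of_val_eq[OF reg_OK[OF a(2)] ra0[OF a(2)] reg_OK[OF b] ra0[OF b]])
          show "good p" if "prime p" "int p dvd nrm a" for p using reg_good[OF a(2)] that by blast
          fix p \<sigma> assume p: "good p" "int p dvd nrm a" and s: "\<sigma> \<in> G"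
          have "int p dvd \<bar>nrm a\<bar>" using p by simp
          then have "p dvd nat \<bar>nrm a\<bar>" by (simp add: int_dvd_int_iff[symmetric])
          then have "p \<le> nat \<bar>nrm a\<bar>" using rn0[OF a(2)] by (intro dvd_imp_le) auto
          then have "p \<in> Pr" using Iz[OF ja(1)] good_prime[OF p(1)] by (simp add: Pr_def)
          then have "d (j,a) p \<sigma> = val p (\<sigma> a)" "d (k,b) p \<sigma> = val p (\<sigma> b)" using p s by (auto simp: d_def)
          then show "val p (\<sigma> a) = val p (\<sigma> b)" using kI(2) by simp
        qed
        then show "i \<in> (\<lambda>b. (j,b)) ` {b \<in> reg q j. \<exists>u\<in>OK. b = a * u}" using kb kj b by auto
      qed
      moreover have fin: "finite {b \<in> reg q j. \<exists>u\<in>OK. b = a * u}" using finite_reg[of q j] by simp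
      ultimately have "card {i \<in> I. d i = e} \<le> card ((\<lambda>b. (j,b)) ` {b \<in> reg q j. \<exists>u\<in>OK. b = a * u})"
        by (intro card_mono) auto
      also have "\<dots> \<le> card {b \<in> reg q j. \<exists>u\<in>OK. b = a * u}" by (rule card_image_le[OF fin])
      also have "\<dots> \<le> M" by (rule M[OF a(2)])
      finally show ?thesis .
    qed
    have "real J / (2 * real c) = (\<Sum>j<J. 1 / (2 * real c))" by simp
    also have "\<dots> \<le> (\<Sum>j<J. \<Sum>a\<in>reg q j. 1 / \<bar>real_of_int (nrm a)\<bar>)"
    proof (intro sum_mono)
      fix j
      have "1 / (2 * real c) = (\<Sum>a\<in>reg q j. 1 / (2 * real c * 8 ^ (j * n)))"
        using c by (simp add: card_reg n_def)
      also have "\<dots> \<le> (\<Sum>a\<in>reg q j. 1 / \<bar>real_of_int (nrm a)\<bar>)"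
        using up rn0 by (intro sum_mono divide_left_mono mult_pos_pos) (auto simp: c)
      finally show "1 / (2 * real c) \<le> (\<Sum>a\<in>reg q j. 1 / \<bar>real_of_int (nrm a)\<bar>)" .
    qed
    also have "\<dots> = (\<Sum>(j,a)\<in>I. 1 / \<bar>real_of_int (nrm a)\<bar>)"
      unfolding I_def using finite_reg by (intro sum.Sigma) auto
    also have "\<dots> = (\<Sum>i\<in>I. w (d i))" using wd by (intro sum.cong) auto
    also have "\<dots> = (\<Sum>e\<in>d ` I. \<Sum>i\<in>{i\<in>I. d i = e}. w (d i))" by (rule sum.image_gen[OF finI])
    also have "\<dots> = (\<Sum>e\<in>d ` I. real (card {i\<in>I. d i = e}) * w e)" by (intro sum.cong) auto
    also have "\<dots> \<le> (\<Sum>e\<in>d ` I. real M * w e)"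
      using fib w0 by (intro sum_mono mult_right_mono) auto
    also have "\<dots> = real M * (\<Sum>e\<in>d ` I. w e)" by (simp add: sum_distrib_left)
    finally have A: "real J / (2 * real c) \<le> real M * (\<Sum>e\<in>d ` I. w e)" .
    have "(\<Sum>e\<in>d ` I. w e) \<le> (\<Sum>e\<in>PiE Pr E. w e)"
    proof (rule sum_mono2)
      show "finite (PiE Pr E)" using finPr finite_G by (intro finite_PiE) (auto simp: E_def intro!: finite_PiE)
      show "d ` I \<subseteq> PiE Pr E" using dE by blast
    qed (use w0 in auto)
    \<comment> \<open>The exponents at different primes range independently, so the sum factors into
      an Euler product.\<close>
    also have "(\<Sum>e\<in>PiE Pr E. w e) = (\<Prod>p\<in>Pr. \<Sum>e\<in>E p. (1 / real p) ^ sum e G)" unfolding w_def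
      using finPr finite_G by (intro prod_sum_PiE[symmetric]) (auto simp: E_def intro!: finite_PiE)
    also have "\<dots> \<le> (\<Prod>p\<in>Pr. exp ((if p \<in> spl then real n / real p else 0) + 4 * 2 ^ n * (1 / (real p) ^ 2)))"
    proof (intro prod_mono conjI)
      fix p assume p: "p \<in> Pr"
      then have "p \<ge> 2" using prime_ge_2_nat by (simp add: Pr_def)
      then have "(\<Sum>e\<in>E p. (1 / real p) ^ sum e G) \<le> 1 + ((if p \<in> spl then real n / real p else 0) + 4 * 2 ^ n * (1 / (real p) ^ 2))"
        using euler_factor_bound[OF finite_G, of p Z "p \<in> spl"] unfolding E_def n_def by linarith
      also have "\<dots> \<le> exp ((if p \<in> spl then real n / real p else 0) + 4 * 2 ^ n * (1 / (real p) ^ 2))"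
        by (rule exp_ge_add_one_self)
      finally show "(\<Sum>e\<in>E p. (1 / real p) ^ sum e G) \<le> exp ((if p \<in> spl then real n / real p else 0) + 4 * 2 ^ n * (1 / (real p) ^ 2))" .
    qed (auto intro: sum_nonneg)
    also have "\<dots> = exp ((\<Sum>p\<in>Pr. if p \<in> spl then real n / real p else 0) + 4 * 2 ^ n * (\<Sum>p\<in>Pr. 1 / (real p) ^ 2))"
      by (simp add: exp_sum[OF finPr, symmetric] sum.distrib sum_distrib_left)
    also have "(\<Sum>p\<in>Pr. if p \<in> spl then real n / real p else 0) = real n * rec_sum Z"
    proof -
      have "Pr \<inter> spl = {p\<in>spl. p \<le> Z}" by (auto simp: Pr_def spl_def dest: good_prime)
      then have "(\<Sum>p\<in>Pr. if p \<in> spl then real n / real p else 0) = (\<Sum>p\<in>{p\<in>spl. p \<le> Z}. real n / real p)"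
        using finPr by (simp add: sum.inter_restrict[symmetric])
      then show ?thesis by (simp add: rec_sum_def sum_distrib_left)
    qed
    also have "exp (real n * rec_sum Z + 4 * 2 ^ n * (\<Sum>p\<in>Pr. 1 / (real p) ^ 2)) \<le> exp (real n * rec_sum Z + 8 * 2 ^ n)"
    proof -
      have "(\<Sum>p\<in>Pr. 1 / (real p) ^ 2) \<le> (\<Sum>p\<in>{1..Z}. 1 / (real p) ^ 2)"
        by (intro sum_mono2) (auto simp: Pr_def dest: prime_gt_0_nat)
      also have "\<dots> \<le> 2" by (rule sum_inverse_squares_le)
      finally have "4 * 2 ^ n * (\<Sum>p\<in>Pr. 1 / (real p) ^ 2) \<le> 4 * 2 ^ n * 2" by (intro mult_left_mono) auto
      then show ?thesis by simp
    qed
    finally have "(\<Sum>e\<in>d ` I. w e) \<le> exp (8 * 2 ^ n) * exp (real n * rec_sum Z)"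
      by (simp add: exp_add mult.commute)
    then have "real M * (\<Sum>e\<in>d ` I. w e) \<le> real M * (exp (8 * 2 ^ n) * exp (real n * rec_sum Z))"
      by (intro mult_left_mono) auto
    then show ?thesis using A unfolding Z_def mult.assoc by linarith
  qed
  \<comment> \<open>\<open>M + 1\<close> instead of \<open>M\<close> keeps the denominator positive;
    \<open>exp (8 * 2 ^ n)\<close> absorbs the terms of order 1/p^2.\<close>
  define k where "k = 1 / (2 * real c * (real M + 1) * exp (8 * 2 ^ n))"
  have "k * real J \<le> exp (real n * rec_sum (2 * c * 8 ^ (J * n)))" for J
  proof -
    define X where "X = exp (real n * rec_sum (2 * c * 8 ^ (J * n)))"
    have "real J / (2 * real c) \<le> real M * exp (8 * 2 ^ n) * X" using main[of J] by (simp add: X_def)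
    also have "\<dots> \<le> (real M + 1) * exp (8 * 2 ^ n) * X" by (intro mult_right_mono) (auto simp: X_def)
    finally have "real J / (2 * real c) \<le> (real M + 1) * exp (8 * 2 ^ n) * X" .
    moreover have "(real M + 1) * exp (8 * 2 ^ n) > 0" by simp
    ultimately have "real J / (2 * real c) / ((real M + 1) * exp (8 * 2 ^ n)) \<le> X"
      by (simp only: pos_divide_le_eq mult_ac)
    then show ?thesis unfolding X_def[symmetric] k_def by (simp add: mult.assoc)
  qed
  moreover have "k > 0" using c by (simp add: k_def)
  ultimately show ?thesis unfolding n_def[symmetric] using c by (intro exI[of _ k] conjI exI[of _ "2 * c"]) auto
qed

end

subsection \<open>An upper bound for the sum over split primes\<close>

lemma prod_one_plus:
  fixes g :: "'b \<Rightarrow> 'c::comm_semiring_1"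
  assumes "finite A"
  shows "(\<Prod>i\<in>A. 1 + g i) = (\<Sum>T\<in>Pow A. prod g T)"
  using assms
proof (induction A rule: finite_induct)
  case (insert a A)
  have "(\<Sum>T\<in>Pow (insert a A). prod g T) = (\<Sum>T\<in>Pow A. prod g T) + (\<Sum>T\<in>insert a ` Pow A. prod g T)"
    unfolding Pow_insert using insert by (intro sum.union_disjoint) auto
  also have "(\<Sum>T\<in>insert a ` Pow A. prod g T) = (\<Sum>T\<in>Pow A. prod g (insert a T))"
    using insert by (intro sum.reindex_cong[OF _ refl refl]) (auto simp: inj_on_def)
  also have "\<dots> = (\<Sum>T\<in>Pow A. g a * prod g T)"
    using insert by (intro sum.cong refl prod.insert) (auto intro: finite_subset)
  finally show ?case using insert by (simp add: sum_distrib_left sum.distrib ring_distribs)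
qed simp

text \<open>With y = u ln 2 >= u/2 the series is at most 1 + 1/y, and 1 <= 1/u gives the constant
  3.\<close>

lemma geometric_two_powr_bound:
  fixes u :: real
  assumes u: "0 < u" "u \<le> 1" and A: "finite A"
  shows "(\<Sum>k\<in>A. (2 powr (- u)) ^ k) \<le> 3 / u"
proof -
  define r where "r = 2 powr (- u)"
  define y where "y = u * ln 2"
  \<comment> \<open>This yields ln 2 >= 1/2 from e <= 3 < 4.\<close>
  have "exp (1 / 2 :: real) ^ 2 = exp 1" by (simp add: power2_eq_square exp_add[symmetric])
  also have "\<dots> \<le> 2 ^ 2" using exp_le by simp
  finally have "exp (1 / 2 :: real) \<le> 2" by (rule power2_le_imp_le) simp
  then have "1 / 2 \<le> ln (2::real)" by (subst ln_ge_iff) auto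
  then have "u * (1 / 2) \<le> u * ln 2" using u by (intro mult_left_mono) auto
  then have y: "y \<ge> u / 2" by (simp add: y_def)
  then have y0: "y > 0" using u by linarith
  have r0: "r > 0" by (simp add: r_def)
  have rr: "r = inverse (exp y)" by (simp add: r_def y_def powr_def exp_minus)
  have "1 + y \<le> exp y" by (rule exp_ge_add_one_self)
  then have "r \<le> inverse (1 + y)" unfolding rr using y0 by (intro le_imp_inverse_le) auto
  then have ry: "r \<le> 1 / (1 + y)" by (simp add: inverse_eq_divide)
  have "1 / (1 + y) < 1" using y0 by simp
  then have r1: "r < 1" using ry by linarith
  have "(\<Sum>k\<in>A. r ^ k) \<le> (\<Sum>k. r ^ k)"
    using r0 r1 A by (intro sum_le_suminf summable_geometric) auto
  also have "\<dots> = 1 / (1 - r)" using r0 r1 by (intro suminf_geometric) auto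
  also have "\<dots> \<le> 1 / (y / (1 + y))"
  proof (rule divide_left_mono)
    have "y / (1 + y) = 1 - 1 / (1 + y)" using y0 by (simp add: field_simps)
    then show "y / (1 + y) \<le> 1 - r" using ry by linarith
    show "0 < (1 - r) * (y / (1 + y))" using y0 r1 by (intro mult_pos_pos divide_pos_pos) auto
  qed simp
  also have "\<dots> = 1 + 1 / y" using y0 by (simp add: field_simps)
  also have "\<dots> \<le> 1 / u + 2 / u"
  proof (rule add_mono)
    show "1 \<le> 1 / u" using u by simp
    have "1 / y \<le> 1 / (u / 2)" using y y0 u by (intro divide_left_mono) auto
    then show "1 / y \<le> 2 / u" by simp
  qed
  also have "\<dots> = 3 / u" by (simp add: add_divide_distrib[symmetric])
  finally show ?thesis by (simp add: r_def)
qed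

section \<open>Short vectors divisible by prescribed primes\<close>

context galois_int
begin

lemma spl_prime: "p \<in> spl \<Longrightarrow> prime p" by (simp add: spl_def good_prime)

lemma spl_residue:
  assumes p: "p \<in> spl" and x: "x \<in> OK"
  shows "\<exists>i<p. x - of_nat i \<in> prm p"
proof -
  have pp: "prime p" using p spl_prime by blast
  note I = maxi_idl[OF prm(1)[OF pp]]
  obtain i :: int where i: "x - of_int i \<in> prm p" using p x by (auto simp: spl_def split_def)
  have p0: "p > 0" using pp prime_gt_0_nat by blast
  define j where "j = nat (i mod int p)"
  have j: "int j = i mod int p" using p0 by (simp add: j_def)
  then have "int j < int p" using p0 by simp
  then have jp: "j < p" by simp
  have "of_int (i - int j) \<in> prm p" unfolding j prm_int_iff[OF pp] by (simp add: minus_mod_eq_mult_div)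
  then have "(x - of_int i) + of_int (i - int j) \<in> prm p" using i idlD(3)[OF I] by blast
  then show ?thesis using jp by auto
qed

text \<open>Thue's argument: there are (h + 1)^n coordinate vectors with entries in 0..h but fewer
  residue patterns at the primes of \<open>T\<close>, since each residue field has \<open>p\<close>
  elements. Two vectors with the same pattern are subtracted.\<close>

lemma short_vector:
  assumes T: "finite T" "T \<subseteq> spl \<times> G" and h: "(\<Prod>(p,\<sigma>)\<in>T. p) < (h + 1) ^ card B"
  shows "\<exists>m. m \<in> PiE B (\<lambda>_. {- int h..int h}) \<and> (\<Sum>b\<in>B. of_int (m b) * b) \<noteq> 0
    \<and> (\<forall>(p,\<sigma>)\<in>T. \<sigma> (\<Sum>b\<in>B. of_int (m b) * b) \<in> prm p)"
proof -
  define X where "X t = (\<Sum>b\<in>B. of_nat (t b) * b)" for t :: "'a \<Rightarrow> nat"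
  have XO: "X t \<in> OK" for t unfolding X_def by (intro OK_sum OK_mult OK_of_nat B_OK)
  define R where "R p x = (SOME i. i < p \<and> x - of_nat i \<in> prm p)" for p x
  have R: "R p x < p \<and> x - of_nat (R p x) \<in> prm p" if "p \<in> spl" "x \<in> OK" for p x
    unfolding R_def by (rule someI_ex) (use spl_residue[OF that] in blast)
  define F where "F t = restrict (\<lambda>(p,\<sigma>). R p (\<sigma> (X t))) T" for t
  define A where "A = PiE B (\<lambda>_. {..h})"
  have Fin: "F ` A \<subseteq> PiE T (\<lambda>(p,\<sigma>). {..<p})"
  proof
    fix f assume "f \<in> F ` A"
    then obtain t where t: "f = F t" by blast
    have "R p (\<sigma> (X t)) < p" if "(p,\<sigma>) \<in> T" for p \<sigma>
      using R[of p "\<sigma> (X t)"] that T(2) G_OK[OF _ XO] by blast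
    then show "f \<in> PiE T (\<lambda>(p,\<sigma>). {..<p})" unfolding t F_def by auto
  qed
  have "card (F ` A) \<le> card (PiE T (\<lambda>(p,\<sigma>). {..<p}))"
    using T(1) by (intro card_mono Fin finite_PiE) (auto split: prod.splits)
  also have "\<dots> = (\<Prod>(p,\<sigma>)\<in>T. p)" using T(1) by (simp add: card_PiE case_prod_unfold)
  also have "\<dots> < card A" using h finite_B by (simp add: A_def card_PiE)
  finally have "\<not> inj_on F A" by (rule pigeonhole)
  then obtain t t' where tt: "t \<in> A" "t' \<in> A" "F t = F t'" "t \<noteq> t'" by (auto simp: inj_on_def)
  define m where "m = restrict (\<lambda>b. int (t b) - int (t' b)) B"
  define x where "x = (\<Sum>b\<in>B. of_int (m b) * b)"
  have xX: "x = X t - X t'" unfolding x_def X_def m_def sum_subtractf[symmetric]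
    by (intro sum.cong refl) (simp add: left_diff_distrib)
  have "m b \<in> {- int h..int h}" if "b \<in> B" for b
    using PiE_mem[OF tt(1)[unfolded A_def] that] PiE_mem[OF tt(2)[unfolded A_def] that] that by (simp add: m_def)
  then have m: "m \<in> PiE B (\<lambda>_. {- int h..int h})" by (auto simp: m_def)
  have "x \<noteq> 0"
  proof
    assume "x = 0"
    then have e: "(\<Sum>b\<in>B. of_rat (of_nat (t b)) * b) = (\<Sum>b\<in>B. of_rat (of_nat (t' b)) * b)"
      unfolding xX X_def by simp
    have "t b = t' b" if "b \<in> B" for b
      using co_unique[OF that, of "\<lambda>b. of_nat (t b)"] co_unique[OF that, of "\<lambda>b. of_nat (t' b)"]
      unfolding e by simp
    then have "t = t'" using tt(1,2) unfolding A_def by (intro PiE_ext) auto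
    then show False using tt(4) by blast
  qed
  moreover have "\<sigma> x \<in> prm p" if ps: "(p,\<sigma>) \<in> T" for p \<sigma>
  proof -
    have p: "p \<in> spl" and s: "\<sigma> \<in> G" using ps T(2) by auto
    note I = maxi_idl[OF prm(1)[OF spl_prime[OF p]]]
    have "R p (\<sigma> (X t)) = R p (\<sigma> (X t'))" using fun_cong[OF tt(3), of "(p,\<sigma>)"] ps by (simp add: F_def)
    then have "\<sigma> (X t') - of_nat (R p (\<sigma> (X t))) \<in> prm p" using R[OF p G_OK[OF s XO[of t']]] by simp
    moreover have "\<sigma> (X t) - of_nat (R p (\<sigma> (X t))) \<in> prm p" using R[OF p G_OK[OF s XO[of t]]] by simp
    ultimately have "(\<sigma> (X t) - of_nat (R p (\<sigma> (X t)))) - (\<sigma> (X t') - of_nat (R p (\<sigma> (X t)))) \<in> prm p"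
      by (rule idlD(6)[OF I, rotated])
    then show ?thesis unfolding xX using G_diff[OF s OK_K[OF XO] OK_K[OF XO]] by simp
  qed
  ultimately show ?thesis using m unfolding x_def by blast
qed

text \<open>The number of conjugates lying in \<open>prm p\<close> is at most the sum of their
  valuations, which is the exponent of \<open>p\<close> in the norm.\<close>

lemma prod_support_le_nrm:
  assumes x: "x \<in> OK" "x \<noteq> 0"
  shows "(\<Prod>(p,\<sigma>)\<in>{(p,\<sigma>). p \<in> spl \<and> p \<le> Z \<and> \<sigma> \<in> G \<and> \<sigma> x \<in> prm p}. p) \<le> nat \<bar>nrm x\<bar>"
proof -
  define S where "S = {p\<in>spl. p \<le> Z}"
  have finS: "finite S" by (simp add: S_def)
  have n0: "nrm x \<noteq> 0" using x nrm_eq_0_iff by blast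
  define m where "m = nat \<bar>nrm x\<bar>"
  have m0: "m > 0" using n0 by (simp add: m_def)
  \<comment> \<open>Large enough for \<open>Pr\<close> to contain both \<open>S\<close> and all
    prime factors of the norm.\<close>
  define W where "W = max Z m"
  define Pr where "Pr = {p. prime p \<and> p \<le> W}"
  have SP: "S \<subseteq> Pr" using spl_prime by (auto simp: S_def Pr_def W_def)
  have finPr: "finite Pr" by (simp add: Pr_def)
  have card_le: "card {\<sigma>\<in>G. \<sigma> x \<in> prm p} \<le> multiplicity p m" if p: "p \<in> S" for p
  proof -
    have g: "good p" using p by (simp add: S_def spl_def)
    have "card {\<sigma>\<in>G. \<sigma> x \<in> prm p} = (\<Sum>\<sigma>\<in>G. if \<sigma> x \<in> prm p then 1 else 0)"
      using finite_G by (simp add: sum.If_cases Int_def)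
    also have "\<dots> \<le> (\<Sum>\<sigma>\<in>G. val p (\<sigma> x))"
    proof (rule sum_mono)
      fix \<sigma> assume s: "\<sigma> \<in> G"
      have "val p (\<sigma> x) \<noteq> 0" if "\<sigma> x \<in> prm p"
        using val_eq_0_iff[OF g G_OK[OF s x(1)]] G_eq_0_iff[OF s] x(2) that by blast
      then show "(if \<sigma> x \<in> prm p then 1 else 0) \<le> val p (\<sigma> x)" by (auto simp: Suc_le_eq)
    qed
    also have "\<dots> = multiplicity (int p) (nrm x)" using multiplicity_nrm[OF g x] by simp
    also have "\<dots> = multiplicity p m" using multiplicity_nat_abs[OF good_prime[OF g] n0] by (simp add: m_def)
    finally show ?thesis .
  qed
  have "{(p,\<sigma>). p \<in> spl \<and> p \<le> Z \<and> \<sigma> \<in> G \<and> \<sigma> x \<in> prm p} = Sigma S (\<lambda>p. {\<sigma>\<in>G. \<sigma> x \<in> prm p})"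
    by (auto simp: S_def)
  then have "(\<Prod>(p,\<sigma>)\<in>{(p,\<sigma>). p \<in> spl \<and> p \<le> Z \<and> \<sigma> \<in> G \<and> \<sigma> x \<in> prm p}. p)
      = (\<Prod>(p,\<sigma>)\<in>Sigma S (\<lambda>p. {\<sigma>\<in>G. \<sigma> x \<in> prm p}). p)" by (simp only:)
  also have "\<dots> = (\<Prod>p\<in>S. \<Prod>\<sigma>\<in>{\<sigma>\<in>G. \<sigma> x \<in> prm p}. p)"
    by (rule prod.Sigma[symmetric]) (use finS finite_G in auto)
  also have "\<dots> = (\<Prod>p\<in>S. p ^ card {\<sigma>\<in>G. \<sigma> x \<in> prm p})" by simp
  also have "\<dots> \<le> (\<Prod>p\<in>S. p ^ multiplicity p m)"
  proof (intro prod_mono conjI power_increasing card_le)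
    show "1 \<le> p" if "p \<in> S" for p using that spl_prime prime_ge_1_nat by (auto simp: S_def)
  qed auto
  also have "\<dots> \<le> (\<Prod>p\<in>Pr - S. p ^ multiplicity p m) * (\<Prod>p\<in>S. p ^ multiplicity p m)"
  proof -
    have "(\<Prod>p\<in>Pr - S. p ^ multiplicity p m) > 0"
      by (intro prod_pos) (auto simp: Pr_def dest: prime_gt_0_nat)
    then show ?thesis by simp
  qed
  also have "\<dots> = (\<Prod>p\<in>Pr. p ^ multiplicity p m)" by (rule prod.subset_diff[OF SP finPr, symmetric])
  also have "\<dots> = m" unfolding Pr_def using m0 by (intro nat_eq_prod_prime_powers[symmetric]) (auto simp: W_def)
  finally show ?thesis by (simp add: m_def)
qed

text \<open>A short vector \<open>x\<close> for \<open>T\<close> has norm comparable to the product over \<open>T\<close>. Hence \<open>T\<close> is the support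
  of \<open>x\<close> minus a set of primes bounded independently of \<open>k\<close>, and it suffices to count the \<open>x\<close>.\<close>

lemma dyadic_count:
  "\<exists>C::nat. \<forall>Z k. card {T. T \<subseteq> {p\<in>spl. p \<le> Z} \<times> G \<and> 2 ^ k \<le> (\<Prod>(p,\<sigma>)\<in>T. p) \<and> (\<Prod>(p,\<sigma>)\<in>T. p) < 2 ^ (k + 1)} \<le> C * 2 ^ k"
proof -
  define n where "n = card G"
  have n0: "n > 0" using card_B_pos card_G by (simp add: n_def)
  \<comment> \<open>The constant of \<open>abs_nrm_le\<close> for an element whose \<open>n\<close>
    coordinates are bounded by \<open>h\<close>, with h^n split off.\<close>
  define C0 where "C0 = (hC ^ 2 * real n) ^ n"
  \<comment> \<open>The surplus of a support over \<open>T\<close> has product at most 2 C0, so each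
    of its primes is at most 2 C0, for every \<open>k\<close> and \<open>Z\<close>.\<close>
  define Q where "Q = {..nat \<lfloor>2 * C0\<rfloor>} \<times> G"
  have finQ: "finite Q" unfolding Q_def using finite_G by simp
  define C :: nat where "C = 2 * 3 ^ n * 2 ^ card Q"
  have "card {T. T \<subseteq> {p\<in>spl. p \<le> Z} \<times> G \<and> 2 ^ k \<le> (\<Prod>(p,\<sigma>)\<in>T. p) \<and> (\<Prod>(p,\<sigma>)\<in>T. p) < 2 ^ (k + 1)} \<le> C * 2 ^ k" for Z k
  proof -
    define S where "S = {p\<in>spl. p \<le> Z}"
    have finS: "finite (S \<times> G)" using finite_G by (simp add: S_def)
    define P where "P T = (\<Prod>(p,\<sigma>)\<in>T. p)" for T :: "(nat \<times> ('a \<Rightarrow> 'a)) set"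
    \<comment> \<open>The least \<open>h\<close> admissible for the pigeonhole argument. Minimality
      gives h^n < 2^(k+1), so the number (2 h + 1)^n of vectors is O(2^k).\<close>
    define h where "h = (LEAST h. (2::nat) ^ (k + 1) \<le> (h + 1) ^ n)"
    have "(2::nat) ^ (k + 1) + 1 \<le> (2 ^ (k + 1) + 1) ^ n"
      using n0 by (intro self_le_power) auto
    then have "\<exists>h. (2::nat) ^ (k + 1) \<le> (h + 1) ^ n" by (intro exI[of _ "2 ^ (k + 1)"]) linarith
    then have h: "(2::nat) ^ (k + 1) \<le> (h + 1) ^ n" unfolding h_def by (rule LeastI_ex)
    have h0: "h > 0"
    proof (rule ccontr)
      assume "\<not> h > 0"
      then have "(2::nat) ^ (k + 1) \<le> 1" using h by simp
      moreover have "(1::nat) < 2 ^ (k + 1)" by (rule one_less_power) auto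
      ultimately show False by linarith
    qed
    have hl: "h ^ n < 2 ^ (k + 1)"
    proof (rule ccontr)
      assume "\<not> h ^ n < 2 ^ (k + 1)"
      then have "(2::nat) ^ (k + 1) \<le> (h - 1 + 1) ^ n" using h0 by simp
      then have "h \<le> h - 1" unfolding h_def by (rule Least_le)
      then show False using h0 by simp
    qed
    define sx where "sx m = {(p,\<sigma>). p \<in> spl \<and> p \<le> Z \<and> \<sigma> \<in> G \<and> \<sigma> (\<Sum>b\<in>B. of_int (m b) * b) \<in> prm p}" for m :: "'a \<Rightarrow> int"
    have sxS: "sx m \<subseteq> S \<times> G" for m by (auto simp: sx_def S_def)
    define TT where "TT = {T. T \<subseteq> S \<times> G \<and> 2 ^ k \<le> P T \<and> P T < 2 ^ (k + 1)}"
    have "T \<in> (\<lambda>(m,R). sx m - R) ` (PiE B (\<lambda>_. {- int h..int h}) \<times> Pow Q)" if T: "T \<in> TT" for T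
    proof -
      have TS: "T \<subseteq> S \<times> G" and P2: "2 ^ k \<le> P T" "P T < 2 ^ (k + 1)" using T by (auto simp: TT_def)
      have finT: "finite T" using TS finS finite_subset by blast
      have Tspl: "T \<subseteq> spl \<times> G" using TS by (auto simp: S_def)
      have "P T < (h + 1) ^ card B" using P2 h by (simp add: n_def card_G)
      then obtain m where m: "m \<in> PiE B (\<lambda>_. {- int h..int h})" "(\<Sum>b\<in>B. of_int (m b) * b) \<noteq> 0"
        "\<forall>(p,\<sigma>)\<in>T. \<sigma> (\<Sum>b\<in>B. of_int (m b) * b) \<in> prm p"
        using short_vector[OF finT Tspl] unfolding P_def by blast
      define x where "x = (\<Sum>b\<in>B. of_int (m b) * b)"
      have xO: "x \<in> OK" unfolding x_def by (intro OK_sum OK_mult OK_of_int B_OK)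
      have Tsx: "T \<subseteq> sx m" using m(3) TS by (auto simp: sx_def S_def)
      have fsx: "finite (sx m)" using sxS finS finite_subset by blast
      have "ht x = ht (\<Sum>b\<in>B. of_rat (of_int (m b)) * b)" by (simp add: x_def)
      also have "\<dots> \<le> (\<Sum>b\<in>B. \<bar>real_of_rat (of_int (m b))\<bar> * ht b)" by (rule ht_lin_comb[OF B_K])
      also have "\<dots> \<le> (\<Sum>b\<in>B. real h)"
      proof (rule sum_mono)
        fix b assume b: "b \<in> B"
        have "\<bar>m b\<bar> \<le> int h" using PiE_mem[OF m(1) b] by auto
        then have "\<bar>real_of_int (m b)\<bar> \<le> real h" by linarith
        then show "\<bar>real_of_rat (of_int (m b))\<bar> * ht b \<le> real h" using ht_basis[OF b] by simp
      qed
      finally have hx: "ht x \<le> real n * real h" by (simp add: n_def card_G)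
      have "\<bar>real_of_int (nrm x)\<bar> \<le> (hC ^ 2 * ht x) ^ n" unfolding n_def by (rule abs_nrm_le[OF xO])
      also have "\<dots> \<le> (hC ^ 2 * (real n * real h)) ^ n"
        using hx by (intro power_mono mult_left_mono) auto
      also have "\<dots> = C0 * real (h ^ n)" by (simp add: C0_def power_mult_distrib)
      also have "\<dots> \<le> C0 * real (2 ^ (k + 1))"
        using hl by (intro mult_left_mono) (auto simp: C0_def simp del: of_nat_power power_Suc)
      finally have nx: "\<bar>real_of_int (nrm x)\<bar> \<le> C0 * 2 ^ (k + 1)" by simp
      have "P (sx m) \<le> nat \<bar>nrm x\<bar>"
        unfolding P_def sx_def x_def[symmetric] using prod_support_le_nrm[OF xO] m(2) by (simp add: x_def)
      then have "real (P (sx m)) \<le> \<bar>real_of_int (nrm x)\<bar>" by linarith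
      then have Psx: "real (P (sx m)) \<le> C0 * 2 ^ (k + 1)" using nx by linarith
      have Psplit: "P (sx m) = P (sx m - T) * P T"
        unfolding P_def by (rule prod.subset_diff[OF Tsx fsx])
      have "real (P (sx m - T)) * 2 ^ k \<le> real (P (sx m - T)) * real (P T)"
        using P2(1) by (intro mult_left_mono) (metis of_nat_le_iff of_nat_numeral of_nat_power, simp)
      also have "\<dots> \<le> C0 * 2 ^ (k + 1)" using Psx by (simp add: Psplit)
      finally have "real (P (sx m - T)) * 2 ^ k \<le> (2 * C0) * 2 ^ k" by simp
      then have PR: "real (P (sx m - T)) \<le> 2 * C0" by (rule mult_right_le_imp_le) simp
      have "sx m - T \<subseteq> Q"
      proof
        fix i assume i: "i \<in> sx m - T"
        obtain p \<sigma> where ps: "i = (p,\<sigma>)" by (cases i)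
        have s: "\<sigma> \<in> G" using i by (auto simp: ps sx_def)
        have pos: "0 < q" if "(q,\<tau>) \<in> sx m" for q \<tau> using that spl_prime prime_gt_0_nat by (auto simp: sx_def)
        have "P (sx m - T) = p * P (sx m - T - {i})"
          unfolding P_def using fsx i by (subst prod.remove[of _ i]) (auto simp: ps)
        moreover have "P (sx m - T - {i}) > 0"
          unfolding P_def by (intro prod_pos) (auto dest: pos)
        ultimately have "p \<le> P (sx m - T)" by simp
        then have "real p \<le> 2 * C0" using PR by linarith
        then have "p \<le> nat \<lfloor>2 * C0\<rfloor>" by (simp add: le_nat_floor)
        then show "i \<in> Q" using s by (simp add: Q_def ps)
      qed
      moreover have "T = sx m - (sx m - T)" using Tsx by blast
      ultimately show ?thesis using m(1) by (intro image_eqI[of _ _ "(m, sx m - T)"]) auto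
    qed
    then have sub: "TT \<subseteq> (\<lambda>(m,R). sx m - R) ` (PiE B (\<lambda>_. {- int h..int h}) \<times> Pow Q)" by blast
    have fin: "finite (PiE B (\<lambda>_. {- int h..int h}) \<times> Pow Q)" using finite_B finQ by (intro finite_cartesian_product finite_PiE) auto
    have "card TT \<le> card ((\<lambda>(m,R). sx m - R) ` (PiE B (\<lambda>_. {- int h..int h}) \<times> Pow Q))"
      by (rule card_mono[OF finite_imageI[OF fin] sub])
    also have "\<dots> \<le> card (PiE B (\<lambda>_. {- int h..int h}) \<times> Pow Q)" by (rule card_image_le[OF fin])
    also have "\<dots> = (2 * h + 1) ^ n * 2 ^ card Q"
      using finite_B finQ by (simp add: card_cartesian_product card_PiE card_Pow n_def card_G nat_add_distrib nat_mult_distrib)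
    also have "\<dots> \<le> (3 * h) ^ n * 2 ^ card Q" using h0 by (intro mult_right_mono power_mono) auto
    also have "\<dots> = 3 ^ n * 2 ^ card Q * h ^ n" by (simp add: power_mult_distrib)
    also have "\<dots> \<le> 3 ^ n * 2 ^ card Q * 2 ^ (k + 1)" using hl by (intro mult_left_mono) auto
    also have "\<dots> = C * 2 ^ k" by (simp add: C_def)
    finally show ?thesis by (simp add: TT_def P_def S_def)
  qed
  then show ?thesis by blast
qed

text \<open>The product expands into a sum of P(T)^(-(1+u)) over sets \<open>T\<close> of degree one
  primes. A dyadic block has at most C 2^k sets and contributes at most C 2^(-k u); the geometric
  series over \<open>k\<close> gives the factor 1/u.\<close>

lemma euler_product_upper:
  "\<exists>C::real. C > 0 \<and> (\<forall>Z u. 0 < u \<longrightarrow> u \<le> 1 \<longrightarrow>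
     (\<Prod>p\<in>{p\<in>spl. p \<le> Z}. (1 + real p powr (- (1 + u))) ^ card G) \<le> C / u)"
proof -
  obtain C :: nat where C: "\<And>Z k. card {T. T \<subseteq> {p\<in>spl. p \<le> Z} \<times> G \<and> 2 ^ k \<le> (\<Prod>(p,\<sigma>)\<in>T. p) \<and> (\<Prod>(p,\<sigma>)\<in>T. p) < 2 ^ (k + 1)} \<le> C * 2 ^ k"
    using dyadic_count by blast
  have "(\<Prod>p\<in>{p\<in>spl. p \<le> Z}. (1 + real p powr (- (1 + u))) ^ card G) \<le> (3 * real C + 1) / u"
    if u: "0 < u" "u \<le> 1" for Z and u :: real
  proof -
    define S where "S = {p\<in>spl. p \<le> Z}"
    have finS: "finite S" by (simp add: S_def)
    have finSG: "finite (S \<times> G)" using finS finite_G by simp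
    define P where "P T = (\<Prod>(p,\<sigma>)\<in>T. p)" for T :: "(nat \<times> ('a \<Rightarrow> 'a)) set"
    have P1: "P T \<ge> 1" if "T \<in> Pow (S \<times> G)" for T
    proof -
      have "P T > 0" unfolding P_def using that spl_prime by (intro prod_pos) (auto simp: S_def dest!: prime_gt_0_nat)
      then show ?thesis by simp
    qed
    define \<kappa> where "\<kappa> T = (SOME k. 2 ^ k \<le> P T \<and> P T < 2 ^ (k + 1))" for T
    have \<kappa>: "2 ^ \<kappa> T \<le> P T \<and> P T < 2 ^ (\<kappa> T + 1)" if "T \<in> Pow (S \<times> G)" for T
      unfolding \<kappa>_def by (rule someI_ex) (use ex_power_ivl1[of 2 "P T"] P1[OF that] in auto)
    define f where "f T = real (P T) powr (- (1 + u))" for T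
    have "(\<Prod>p\<in>S. (1 + real p powr (- (1 + u))) ^ card G) = (\<Prod>p\<in>S. \<Prod>\<sigma>\<in>G. 1 + real p powr (- (1 + u)))"
      by simp
    also have "\<dots> = (\<Prod>(p,\<sigma>)\<in>S \<times> G. 1 + real p powr (- (1 + u)))" by (rule prod.cartesian_product)
    also have "\<dots> = (\<Prod>i\<in>S \<times> G. 1 + real (fst i) powr (- (1 + u)))" by (intro prod.cong) auto
    also have "\<dots> = (\<Sum>T\<in>Pow (S \<times> G). \<Prod>i\<in>T. real (fst i) powr (- (1 + u)))" by (rule prod_one_plus[OF finSG])
    also have "\<dots> = (\<Sum>T\<in>Pow (S \<times> G). f T)"
    proof (intro sum.cong refl)
      fix T assume "T \<in> Pow (S \<times> G)"
      have "real (P T) = (\<Prod>i\<in>T. real (fst i))" by (simp add: P_def case_prod_unfold)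
      then show "(\<Prod>i\<in>T. real (fst i) powr (- (1 + u))) = f T"
        unfolding f_def by (simp add: prod_powr_distrib)
    qed
    also have "\<dots> = (\<Sum>k\<in>\<kappa> ` Pow (S \<times> G). \<Sum>T\<in>{T\<in>Pow (S \<times> G). \<kappa> T = k}. f T)"
      using finSG by (intro sum.image_gen) auto
    also have "\<dots> \<le> (\<Sum>k\<in>\<kappa> ` Pow (S \<times> G). real C * (2 powr (- u)) ^ k)"
    proof (rule sum_mono)
      fix k assume "k \<in> \<kappa> ` Pow (S \<times> G)"
      have "(\<Sum>T\<in>{T\<in>Pow (S \<times> G). \<kappa> T = k}. f T) \<le> (\<Sum>T\<in>{T\<in>Pow (S \<times> G). \<kappa> T = k}. (2 ^ k) powr (- (1 + u)))"
      proof (rule sum_mono)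
        fix T assume "T \<in> {T\<in>Pow (S \<times> G). \<kappa> T = k}"
        then have "2 ^ k \<le> P T" using \<kappa> by auto
        then have "(2::real) ^ k \<le> real (P T)" by (metis of_nat_le_iff of_nat_numeral of_nat_power)
        then show "f T \<le> (2 ^ k) powr (- (1 + u))" unfolding f_def using u by (intro powr_mono2') auto
      qed
      also have "\<dots> = real (card {T\<in>Pow (S \<times> G). \<kappa> T = k}) * (2 ^ k) powr (- (1 + u))" by simp
      also have "\<dots> \<le> real (C * 2 ^ k) * (2 ^ k) powr (- (1 + u))"
      proof (rule mult_right_mono)
        have "{T\<in>Pow (S \<times> G). \<kappa> T = k} \<subseteq> {T. T \<subseteq> S \<times> G \<and> 2 ^ k \<le> P T \<and> P T < 2 ^ (k + 1)}"
          using \<kappa> by auto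
        moreover have "finite {T. T \<subseteq> S \<times> G \<and> 2 ^ k \<le> P T \<and> P T < 2 ^ (k + 1)}"
          by (rule finite_subset[of _ "Pow (S \<times> G)"]) (use finSG in auto)
        ultimately have "card {T\<in>Pow (S \<times> G). \<kappa> T = k} \<le> card {T. T \<subseteq> S \<times> G \<and> 2 ^ k \<le> P T \<and> P T < 2 ^ (k + 1)}"
          by (intro card_mono)
        also have "\<dots> \<le> C * 2 ^ k" using C[of Z k] by (simp add: S_def P_def)
        finally show "real (card {T\<in>Pow (S \<times> G). \<kappa> T = k}) \<le> real (C * 2 ^ k)" by (simp only: of_nat_le_iff)
      qed simp
      also have "\<dots> = real C * (2 powr (- u)) ^ k"
      proof -
        have "(2::real) ^ k * (2 ^ k) powr (- (1 + u)) = (2 ^ k) powr 1 * (2 ^ k) powr (- (1 + u))" by simp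
        also have "\<dots> = (2 ^ k) powr (1 + (- (1 + u)))" by (simp only: powr_add)
        also have "\<dots> = (2 ^ k) powr (- u)" by simp
        also have "\<dots> = (2 powr (- u)) ^ k" by (simp add: powr_power powr_realpow[symmetric] powr_powr mult.commute)
        finally show ?thesis by (simp add: mult.assoc)
      qed
      finally show "(\<Sum>T\<in>{T\<in>Pow (S \<times> G). \<kappa> T = k}. f T) \<le> real C * (2 powr (- u)) ^ k" .
    qed
    also have "\<dots> = real C * (\<Sum>k\<in>\<kappa> ` Pow (S \<times> G). (2 powr (- u)) ^ k)" by (simp add: sum_distrib_left)
    also have "\<dots> \<le> real C * (3 / u)"
      using geometric_two_powr_bound[OF u, of "\<kappa> ` Pow (S \<times> G)"] finSG by (intro mult_left_mono) auto
    also have "\<dots> \<le> (3 * real C + 1) / u" using u by (simp add: divide_right_mono)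
    finally show ?thesis by (simp add: S_def)
  qed
  then show ?thesis by (intro exI[of _ "3 * real C + 1"]) auto
qed

text \<open>Rankin's device: with u = e / log Z the factor p^(-u) is at least exp(-e) for all p <=
  Z. The Euler product thus controls the plain sum of 1/p, and the logarithm of C/u is log log Z +
  O(1).\<close>

lemma upper_bound:
  assumes e: "0 < e" "e \<le> 1"
  shows "\<exists>C. \<forall>Z\<ge>3. real (card G) * exp (- e) * rec_sum Z \<le> ln (ln (real Z)) + C"
proof -
  define N where "N = real (card G)"
  obtain C where C: "C > 0"
    and E: "\<And>Z u. 0 < u \<Longrightarrow> u \<le> 1 \<Longrightarrow> (\<Prod>p\<in>{p\<in>spl. p \<le> Z}. (1 + real p powr (- (1 + u))) ^ card G) \<le> C / u"
    using euler_product_upper by blast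
  have "N * exp (- e) * rec_sum Z \<le> ln (ln (real Z)) + (ln (C / e) + 2 * N)" if Z: "Z \<ge> 3" for Z
  proof -
    define S where "S = {p\<in>spl. p \<le> Z}"
    have finS: "finite S" by (simp add: S_def)
    define l where "l = ln (real Z)"
    have "exp 1 \<le> real Z" using exp_le Z by linarith
    then have l: "l \<ge> 1" unfolding l_def using Z by (subst ln_ge_iff) auto
    \<comment> \<open>Z >= 3 > e makes l = log Z at least 1, so \<open>u\<close> stays in the range
      of the product bound.\<close>
    define u where "u = e / l"
    have u: "0 < u" "u \<le> 1" using e l by (auto simp: u_def)
    define t where "t p = real p powr (- (1 + u))" for p :: nat
    have t: "0 < t p" "exp (- e) * (1 / real p) - 1 / (real p) ^ 2 \<le> ln (1 + t p)" if p: "p \<in> S" for p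
    proof -
      have p1: "p > 1" using p spl_prime prime_gt_1_nat by (auto simp: S_def)
      show t0: "0 < t p" using p1 by (simp add: t_def)
      have tp: "t p = (1 / real p) * exp (- (u * ln (real p)))"
      proof -
        have "- (1 + u) = (- 1) + (- u)" by simp
        then have "t p = real p powr (- 1) * real p powr (- u)" unfolding t_def by (simp only: powr_add)
        moreover have "real p powr (- 1) = 1 / real p" using p1 by (simp add: powr_minus_divide)
        moreover have "real p powr (- u) = exp (- (u * ln (real p)))" using p1 by (simp add: powr_def)
        ultimately show ?thesis by (simp only:)
      qed
      have lp: "0 \<le> ln (real p)" "ln (real p) \<le> l" using p1 p by (auto simp: l_def S_def)
      have "exp (- (u * ln (real p))) \<le> 1" using u lp by simp
      then have "t p \<le> (1 / real p) * 1" unfolding tp by (intro mult_left_mono) auto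
      then have tle: "t p \<le> 1 / real p" by simp
      have "u * ln (real p) \<le> u * l" using u lp by (intro mult_left_mono) auto
      also have "\<dots> = e" using l by (simp add: u_def)
      finally have "exp (- e) \<le> exp (- (u * ln (real p)))" by simp
      then have tge: "exp (- e) * (1 / real p) \<le> t p" unfolding tp mult.commute[of "exp (- e)"] by (intro mult_left_mono) auto
      have "1 / real p \<le> 1" using p1 by simp
      then have "t p - (t p)\<^sup>2 \<le> ln (1 + t p)" using t0 tle by (intro ln_one_plus_pos_lower_bound) auto
      moreover have "(t p)\<^sup>2 \<le> (1 / real p)\<^sup>2" using t0 tle by (intro power_mono) auto
      ultimately show "exp (- e) * (1 / real p) - 1 / (real p) ^ 2 \<le> ln (1 + t p)"
        using tge by (simp add: power_one_over)
    qed
    have "ln (\<Prod>p\<in>S. (1 + t p) ^ card G) = N * (\<Sum>p\<in>S. ln (1 + t p))"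
    proof -
      have "(1 + t p) ^ card G \<noteq> 0" if "p \<in> S" for p using t(1)[OF that] by simp
      then have "ln (\<Prod>p\<in>S. (1 + t p) ^ card G) = (\<Sum>p\<in>S. ln ((1 + t p) ^ card G))"
        using finS by (intro ln_prod)
      also have "\<dots> = (\<Sum>p\<in>S. N * ln (1 + t p))"
      proof (intro sum.cong refl)
        fix p assume "p \<in> S"
        then have "0 < 1 + t p" using t(1)[of p] by simp
        then show "ln ((1 + t p) ^ card G) = N * ln (1 + t p)" unfolding N_def by (simp add: ln_realpow)
      qed
      finally show ?thesis by (simp add: sum_distrib_left)
    qed
    moreover have "ln (\<Prod>p\<in>S. (1 + t p) ^ card G) \<le> ln (C / u)"
    proof -
      have "0 < (\<Prod>p\<in>S. (1 + t p) ^ card G)"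
        using t(1) by (intro prod_pos ballI zero_less_power add_pos_pos) auto
      moreover have "(\<Prod>p\<in>S. (1 + t p) ^ card G) \<le> C / u" using E[OF u] unfolding S_def t_def .
      ultimately show ?thesis by simp
    qed
    moreover have "C / u = C / e * l" using l e by (simp add: u_def)
    moreover have "ln (C / e * l) = ln (C / e) + ln l" using C e l by (subst ln_mult_pos) auto
    ultimately have "N * (\<Sum>p\<in>S. ln (1 + t p)) \<le> ln (C / e) + ln l" by simp
    moreover have "N * (\<Sum>p\<in>S. exp (- e) * (1 / real p) - 1 / (real p) ^ 2) \<le> N * (\<Sum>p\<in>S. ln (1 + t p))"
      using t(2) by (intro mult_left_mono sum_mono) (auto simp: N_def)
    moreover have "(\<Sum>p\<in>S. exp (- e) * (1 / real p) - 1 / (real p) ^ 2) = exp (- e) * rec_sum Z - (\<Sum>p\<in>S. 1 / (real p) ^ 2)"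
      by (simp add: sum_subtractf sum_distrib_left rec_sum_def S_def)
    moreover have "N * (\<Sum>p\<in>S. 1 / (real p) ^ 2) \<le> N * 2"
    proof (rule mult_left_mono)
      have "(\<Sum>p\<in>S. 1 / (real p) ^ 2) \<le> (\<Sum>p\<in>{1..Z}. 1 / (real p) ^ 2)"
        using spl_prime prime_ge_1_nat by (intro sum_mono2) (auto simp: S_def)
      then show "(\<Sum>p\<in>S. 1 / (real p) ^ 2) \<le> 2" using sum_inverse_squares_le[of Z] by linarith
    qed (simp add: N_def)
    ultimately show ?thesis unfolding l_def[symmetric] by (simp add: right_diff_distrib mult.assoc)
  qed
  then show ?thesis unfolding N_def by blast
qed

end

subsection \<open>Comparing the split primes of two fields\<close>

context galois_int
begin

lemma residue_add:
  assumes pp: "prime p" and "\<exists>i::int. x - of_int i \<in> prm p" "\<exists>i::int. y - of_int i \<in> prm p"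
  shows "\<exists>i::int. x + y - of_int i \<in> prm p"
proof -
  obtain i j :: int where "x - of_int i \<in> prm p" "y - of_int j \<in> prm p" using assms by blast
  then have "(x - of_int i) + (y - of_int j) \<in> prm p" using idlD(3)[OF maxi_idl[OF prm(1)[OF pp]]] by blast
  moreover have "(x - of_int i) + (y - of_int j) = x + y - of_int (i + j)" by simp
  ultimately show ?thesis by metis
qed

lemma residue_mult:
  assumes pp: "prime p" and x: "x \<in> OK" and y: "\<exists>i::int. y - of_int i \<in> prm p"
    and xi: "\<exists>i::int. x - of_int i \<in> prm p"
  shows "\<exists>i::int. x * y - of_int i \<in> prm p"
proof -
  note I = maxi_idl[OF prm(1)[OF pp]]
  obtain i j :: int where ij: "x - of_int i \<in> prm p" "y - of_int j \<in> prm p" using y xi by blast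
  have "x * (y - of_int j) + (x - of_int i) * of_int j \<in> prm p"
    by (rule idlD(3)[OF I idlD(4)[OF I x ij(2)] idlD(5)[OF I OK_of_int ij(1)]])
  moreover have "x * (y - of_int j) + (x - of_int i) * of_int j = x * y - of_int (i * j)" by (simp add: algebra_simps)
  ultimately show ?thesis by metis
qed

lemma residue_of_int: "prime p \<Longrightarrow> \<exists>i::int. of_int k - of_int i \<in> prm p"
  using idlD(2)[OF maxi_idl[OF prm(1)]] by (intro exI[of _ k]) simp

lemma residue_power:
  assumes pp: "prime p" and x: "x \<in> OK" and xi: "\<exists>i::int. x - of_int i \<in> prm p"
  shows "\<exists>i::int. x ^ k - of_int i \<in> prm p"
proof (induction k)
  case 0 then show ?case using residue_of_int[OF pp, of 1] by simp
next
  case (Suc k) then show ?case using residue_mult[OF pp x _ xi] by simp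
qed

lemma residue_sum:
  assumes pp: "prime p"
  shows "(\<And>a. a \<in> A \<Longrightarrow> \<exists>i::int. f a - of_int i \<in> prm p) \<Longrightarrow> \<exists>i::int. sum f A - of_int i \<in> prm p"
proof (induction A rule: infinite_finite_induct)
  case (insert a A)
  have "\<exists>i::int. sum f A - of_int i \<in> prm p" "\<exists>i::int. f a - of_int i \<in> prm p" using insert by simp_all
  then show ?case using residue_add[OF pp, of "f a" "sum f A"] insert.hyps by simp
qed (use residue_of_int[OF pp, of 0] in simp_all)

text \<open>\<open>B\<close> may span a proper sublattice of the ring of integers, but
  \<open>dlt\<close> moves every integral element into it and is invertible modulo a good
  \<open>p\<close>.\<close>

lemma split_of_basis:
  assumes p: "good p" and b: "\<And>b. b \<in> B \<Longrightarrow> \<exists>i::int. b - of_int i \<in> prm p"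
  shows "split p"
  unfolding split_def
proof
  fix x assume x: "x \<in> OK"
  have pp: "prime p" using p good_prime by blast
  note I = maxi_idl[OF prm(1)[OF pp]]
  obtain m :: "'a \<Rightarrow> int" where m: "of_int dlt * x = (\<Sum>b\<in>B. of_int (m b) * b)" using dlt_OK[OF x] by blast
  have "\<exists>i::int. (\<Sum>b\<in>B. of_int (m b) * b) - of_int i \<in> prm p"
    by (intro residue_sum[OF pp] residue_mult[OF pp OK_of_int] b residue_of_int[OF pp])
  then obtain k :: int where k: "of_int dlt * x - of_int k \<in> prm p" unfolding m by blast
  have "coprime (int p) dlt" using p by (simp add: good_def prime_imp_coprime)
  then obtain u v where uv: "u * int p + v * dlt = 1" by (metis bezout_int coprime_iff_gcd_eq_1)
  have "of_nat p * (of_int u * x) + of_int v * (of_int dlt * x - of_int k) \<in> prm p"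
    by (rule idlD(3)[OF I idlD(5)[OF I OK_mult[OF OK_of_int x] prm(2)[OF pp]] idlD(4)[OF I OK_of_int k]])
  moreover have "of_nat p * (of_int u * x) + of_int v * (of_int dlt * x - of_int k)
      = of_int (u * int p + v * dlt) * x - of_int (v * k)" by (simp add: algebra_simps)
  ultimately show "\<exists>i::int. x - of_int i \<in> prm p" unfolding uv by (intro exI[of _ "v * k"]) simp
qed

lemma rec_sum_nonneg: "0 \<le> rec_sum Z" by (auto simp: rec_sum_def intro: sum_nonneg)

end

section \<open>Degrees compared through the growth of the sum over split primes\<close>

text \<open>Write n and N for the orders of \<open>G\<close> and \<open>G'\<close>. If N >= n + 1,
  the two bounds give (n + 1/2) log J <= n log J + O(1), which fails for large \<open>J\<close>; the
  finite set \<open>F\<close> only changes the bounded term.\<close>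

lemma card_lt_of_split_subset:
  fixes K K' :: "'a::field_char_0 set"
  assumes "galois_int K B G" and "galois_int K' B' G'"
    and fin: "finite F" and sub: "galois_int.spl K B G - F \<subseteq> galois_int.spl K' B' G'"
  shows "card G' \<le> card G"
proof (rule ccontr)
  interpret A: galois_int K B G by fact
  interpret L: galois_int K' B' G' by fact
  assume "\<not> card G' \<le> card G"
  define n where "n = real (card G)"
  define N where "N = real (card G')"
  have nN: "n + 1 \<le> N" using \<open>\<not> card G' \<le> card G\<close> by (simp add: n_def N_def)
  have n1: "n \<ge> 1" using A.card_B_pos A.card_G by (simp add: n_def Suc_le_eq)
  \<comment> \<open>Then N exp(-e) >= N - 1/2 >= n + 1/2, so half a unit of the gap between the
    degrees survives.\<close>
  define e where "e = 1 / (2 * N)"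
  have e: "0 < e" "e \<le> 1" using nN n1 by (auto simp: e_def field_simps)
  have "1 + - e \<le> exp (- e)" by (rule exp_ge_add_one_self)
  then have "N * (1 - e) \<le> N * exp (- e)" using nN n1 by (intro mult_left_mono) auto
  moreover have "N * (1 - e) = N - 1 / 2" using nN n1 by (simp add: e_def field_simps)
  ultimately have Ne: "n + 1 / 2 \<le> N * exp (- e)" using nN by linarith
  obtain c Z0 where c: "c > 0" and Z0: "Z0 > 0"
    and low: "\<And>J::nat. c * real J \<le> exp (n * A.rec_sum (Z0 * 8 ^ (J * card G)))"
    using A.lower_bound unfolding n_def by blast
  obtain C where up: "\<And>Z. Z \<ge> 3 \<Longrightarrow> N * exp (- e) * L.rec_sum Z \<le> ln (ln (real Z)) + C"
    using L.upper_bound[OF e] unfolding N_def by blast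
  define f where "f = real (card F)"
  have cmp: "A.rec_sum Z \<le> L.rec_sum Z + f" for Z
  proof -
    have "A.rec_sum Z \<le> (\<Sum>p\<in>{p\<in>L.spl. p \<le> Z} \<union> F. 1 / real p)"
      unfolding A.rec_sum_def using sub fin by (intro sum_mono2) auto
    also have "\<dots> \<le> L.rec_sum Z + (\<Sum>p\<in>F. 1 / real p)"
      unfolding L.rec_sum_def using fin by (subst sum.union_inter[symmetric]) (auto intro: sum_nonneg)
    also have "(\<Sum>p\<in>F. 1 / real p) \<le> (\<Sum>p\<in>F. 1)"
    proof (rule sum_mono)
      \<comment> \<open>\<open>F\<close> may contain 0, where the quotient is 0.\<close>
      show "1 / real p \<le> 1" for p by (cases "p = 0") auto
    qed
    finally show ?thesis by (simp add: f_def)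
  qed
  \<comment> \<open>Chosen so that log Z <= J D for J >= 1, whence log log Z <= log J + log
    D.\<close>
  define D where "D = ln (real Z0) + n * ln 8"
  have "ln (real Z0) \<ge> 0" using Z0 by simp
  moreover have "n * ln 8 > 0" using n1 by simp
  ultimately have D: "D > 0" by (simp add: D_def)
  \<comment> \<open>The terms left over when half of log J is isolated; none of them depends on
    \<open>J\<close>.\<close>
  define X where "X = n * (ln D + C) + (n + 1 / 2) * (n * f - ln c)"
  have key: "ln (real J) \<le> 2 * X" if J: "J \<ge> 1" for J :: nat
  proof -
    define Z where "Z = Z0 * 8 ^ (J * card G)"
    have "J * card G \<ge> 1" using J n1 by (simp add: n_def Suc_le_eq)
    then have "(8::nat) ^ 1 \<le> 8 ^ (J * card G)" by (intro power_increasing) auto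
    then have "1 * 8 \<le> Z" unfolding Z_def using Z0 by (intro mult_le_mono) auto
    then have Z3: "Z \<ge> 3" by simp
    have lZ: "ln (real Z) = ln (real Z0) + real J * (n * ln 8)"
      using Z0 by (simp add: Z_def ln_mult ln_realpow n_def)
    have "ln (real Z0) \<le> real J * ln (real Z0)" using J Z0 mult_right_mono[of 1 "real J" "ln (real Z0)"] by simp
    then have "ln (real Z) \<le> real J * D" unfolding lZ D_def by (simp add: ring_distribs)
    moreover have "ln (real Z) > 0" using Z3 by simp
    ultimately have "ln (ln (real Z)) \<le> ln (real J * D)" by simp
    also have "\<dots> = ln (real J) + ln D" using J D by (subst ln_mult_pos) auto
    finally have llZ: "ln (ln (real Z)) \<le> ln (real J) + ln D" .
    have "0 < c * real J" using c J by simp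
    then have "ln (c * real J) \<le> ln (exp (n * A.rec_sum Z))"
      using low[of J] unfolding Z_def[symmetric] by (subst ln_le_cancel_iff) auto
    then have "ln (c * real J) \<le> n * A.rec_sum Z" by simp
    moreover have "ln (c * real J) = ln c + ln (real J)" using c J by (subst ln_mult_pos) auto
    moreover have "n * A.rec_sum Z \<le> n * (L.rec_sum Z + f)" using cmp n1 by (intro mult_left_mono) auto
    ultimately have "ln c + ln (real J) - n * f \<le> n * L.rec_sum Z" by (simp add: ring_distribs)
    then have "(n + 1 / 2) * (ln c + ln (real J) - n * f) \<le> (n + 1 / 2) * (n * L.rec_sum Z)"
      using n1 by (intro mult_left_mono) auto
    also have "\<dots> = n * ((n + 1 / 2) * L.rec_sum Z)" by simp
    also have "\<dots> \<le> n * (ln (real J) + ln D + C)"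
    proof (rule mult_left_mono)
      have "(n + 1 / 2) * L.rec_sum Z \<le> N * exp (- e) * L.rec_sum Z"
        using Ne L.rec_sum_nonneg by (rule mult_right_mono)
      then show "(n + 1 / 2) * L.rec_sum Z \<le> ln (real J) + ln D + C" using up[OF Z3] llZ by linarith
    qed (use n1 in simp)
    finally show ?thesis by (simp add: X_def algebra_simps)
  qed
  obtain J :: nat where J: "exp (2 * X) < real J" using reals_Archimedean2 by blast
  have "real J > 0" using J exp_gt_zero[of "2 * X"] by linarith
  then have "J \<ge> 1" by simp
  then have "ln (real J) \<le> 2 * X" by (rule key)
  then have "exp (ln (real J)) \<le> exp (2 * X)" by simp
  then show False using J \<open>real J > 0\<close> by simp
qed

lemma Int_rat_frobenius_iff:
  fixes K :: "'a::field_char_0 set"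
  assumes "galois_int K B G" and p: "p > 0"
  shows "Polynomial.smult (1 / of_nat p) (monom 1 p - monom 1 1) \<in> Int_rat (ring_of_integers K)
    \<longleftrightarrow> (\<forall>x\<in>ring_of_integers K. \<exists>y\<in>ring_of_integers K. x ^ p - x = of_nat p * y)"
proof -
  have "poly (map_poly of_rat (Polynomial.smult (1 / of_nat p) (monom 1 p - monom 1 1))) x \<in> ring_of_integers K
      \<longleftrightarrow> (\<exists>y\<in>ring_of_integers K. x ^ p - x = of_nat p * y)" for x :: 'a
  proof -
    define v where "v = poly (map_poly of_rat (Polynomial.smult (1 / of_nat p) (monom 1 p - monom 1 1))) x"
    have "v = (x ^ p - x) / of_nat p"
      unfolding v_def evq_def[symmetric] by (simp add: of_rat_divide)
    then have "x ^ p - x = of_nat p * v" using p by simp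
    moreover have "y = v" if "of_nat p * v = of_nat p * y" for y using that p by simp
    ultimately show ?thesis unfolding v_def[symmetric] by metis
  qed
  then show ?thesis unfolding Int_rat_def by blast
qed

text \<open>An element of \<open>K'\<close> outside \<open>K\<close> makes the compositum strictly
  larger than \<open>K\<close>. Yet a prime split in \<open>K\<close> has the congruence x^p = x
  modulo p in \<open>K\<close>, by hypothesis also in \<open>K'\<close>, hence at both generators of
  the compositum, so it splits there too, up to the divisors of \<open>L.dlt\<close>.\<close>

lemma subset_of_Int_rat_eq:
  fixes K K' :: "'a::{field_char_0,alg_closed_field} set"
  assumes alg: "\<And>z::'a. algebraic z"
    and K: "finite_galois_over_rat K" and K': "finite_galois_over_rat K'"
    and eq: "Int_rat (ring_of_integers K) = Int_rat (ring_of_integers K')"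
  shows "K' \<subseteq> K"
proof (rule ccontr)
  assume "\<not> K' \<subseteq> K"
  then obtain z where z: "z \<in> K'" "z \<notin> K" by blast
  obtain a B G where a: "algebraic_int a" "K = Qadj a" "galois_int K B G"
    using finite_galois_int[OF alg K] by blast
  obtain b B' G' where b: "algebraic_int b" "K' = Qadj b" "galois_int K' B' G'"
    using finite_galois_int[OF alg K'] by blast
  have "normal_over_rat (Qadj a)" "normal_over_rat (Qadj b)"
    using K K' a(2) b(2) by (auto simp: finite_galois_over_rat_def)
  then obtain c :: int and n GL where ct: "a \<in> Qadj (a + of_int c * b)" "b \<in> Qadj (a + of_int c * b)"
    and gl: "galois_int (Qadj (a + of_int c * b)) ((\<lambda>i. (a + of_int c * b) ^ i) ` {..<n}) GL"
    using galois_int_compositum[OF alg a(1) b(1)] by blast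
  define t where "t = a + of_int c * b"
  define BL where "BL = (\<lambda>i. t ^ i) ` {..<n}"
  interpret A: galois_int K B G by fact
  interpret A': galois_int K' B' G' by fact
  interpret L: galois_int "Qadj t" BL GL using gl by (simp add: t_def BL_def)
  have KL: "K \<subseteq> Qadj t" "K' \<subseteq> Qadj t"
    using Qadj_subset[OF L.subfield] ct a(2) b(2) by (auto simp: t_def)
  have OKL: "A.OK \<subseteq> L.OK" "A'.OK \<subseteq> L.OK" using KL by (auto simp: ring_of_integers_def)
  have aO: "a \<in> A.OK" "b \<in> A'.OK" using a b by (auto simp: ring_of_integers_def)
  have "a + of_int c * b \<in> L.OK"
    by (intro L.OK_add L.OK_mult L.OK_of_int) (use aO OKL in auto)
  then have tO: "t \<in> L.OK" by (fold t_def)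
  have "p \<in> L.spl" if p: "p \<in> A.spl" "L.good p" for p
  proof -
    have pp: "prime p" and p0: "p > 0" using p A.spl_prime prime_gt_0_nat by blast+
    have frK: "\<forall>x\<in>A.OK. \<exists>y\<in>A.OK. x ^ p - x = of_nat p * y"
      using A.split_power[of p] p(1) by (auto simp: A.spl_def)
    then have "Polynomial.smult (1 / of_nat p) (monom 1 p - monom 1 1) \<in> Int_rat A.OK"
      using Int_rat_frobenius_iff[OF a(3) p0] by blast
    \<comment> \<open>The equivalence with membership holds for every positive \<open>p\<close>, so
      \<open>p\<close> is not asked to be good for \<open>K'\<close>.\<close>
    then have frK': "\<forall>x\<in>A'.OK. \<exists>y\<in>A'.OK. x ^ p - x = of_nat p * y"
      unfolding eq using Int_rat_frobenius_iff[OF b(3) p0] by blast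
    note I = L.maxi_idl[OF L.prm(1)[OF pp]]
    have res: "\<exists>i::int. x - of_int i \<in> L.prm p" if x: "x \<in> L.OK" "\<exists>y\<in>L.OK. x ^ p - x = of_nat p * y" for x
    proof (rule L.residue_of_power[OF pp x(1)])
      obtain y where "y \<in> L.OK" "x ^ p - x = of_nat p * y" using x(2) by blast
      then show "x ^ p - x \<in> L.prm p" using L.idlD(5)[OF I _ L.prm(2)[OF pp]] by simp
    qed
    \<comment> \<open>Residues are taken at the prime chosen in the compositum, so the primes chosen
      in the three fields need not be compatible.\<close>
    have ra: "\<exists>i::int. a - of_int i \<in> L.prm p" using res[of a] aO frK OKL by blast
    have rb: "\<exists>i::int. b - of_int i \<in> L.prm p" using res[of b] aO frK' OKL by blast
    have "\<exists>i::int. a + of_int c * b - of_int i \<in> L.prm p"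
      by (intro L.residue_add[OF pp ra] L.residue_mult[OF pp L.OK_of_int rb] L.residue_of_int[OF pp])
    then have rt: "\<exists>i::int. t - of_int i \<in> L.prm p" by (fold t_def)
    have "L.split p"
    proof (rule L.split_of_basis[OF p(2)])
      fix x assume "x \<in> BL"
      then show "\<exists>i::int. x - of_int i \<in> L.prm p" using L.residue_power[OF pp tO rt] by (auto simp: BL_def)
    qed
    then show ?thesis using p(2) by (simp add: L.spl_def)
  qed
  then have "A.spl - {p. int p dvd L.dlt} \<subseteq> L.spl" using A.spl_prime by (auto simp: L.good_def)
  moreover have "finite {p. int p dvd L.dlt}"
  proof (rule finite_subset)
    show "{p. int p dvd L.dlt} \<subseteq> {..nat L.dlt}"
      using L.dlt_pos by (auto dest: zdvd_imp_le)
  qed simp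
  ultimately have "card GL \<le> card G"
    using card_lt_of_split_subset[OF A.galois_int_axioms L.galois_int_axioms] by blast
  moreover have "card B < card BL"
  proof -
    have zB: "z \<notin> rv.span B" using z(2) A.span_B by simp
    \<comment> \<open>Adjoining \<open>z\<close> to the basis of \<open>K\<close> keeps it
      independent inside the compositum, which therefore has larger degree.\<close>
    then have "rv.independent (insert z B)" using A.indep_B by (rule rv.independent_insertI)
    moreover have "insert z B \<subseteq> rv.span BL" unfolding L.span_B using z(1) KL A.B_K by blast
    ultimately have "card (insert z B) \<le> card BL" using rv.independent_span_bound[OF L.finite_B] by blast
    moreover have "z \<notin> B" using zB rv.span_base by blast
    ultimately show ?thesis using A.finite_B by simp
  qed
  ultimately show False using A.card_G L.card_G by simp
qed

theorem theorem1p1: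
  fixes K K' :: "'a::{field_char_0,alg_closed_field} set"
  assumes closure_of_rat: "\<forall>x::'a. algebraic x"
    and K: "finite_galois_over_rat K"
    and K': "finite_galois_over_rat K'"
  shows "Int_rat (ring_of_integers K) = Int_rat (ring_of_integers K') \<longleftrightarrow> K = K'"
proof
  assume eq: "Int_rat (ring_of_integers K) = Int_rat (ring_of_integers K')"
  have alg: "algebraic z" for z :: 'a using closure_of_rat by blast
  show "K = K'"
    using subset_of_Int_rat_eq[OF alg K K' eq] subset_of_Int_rat_eq[OF alg K' K eq[symmetric]] by blast
qed simp

end
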